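(* Suppose that the data are modeled as an i.i.d. sequence $Y_1,\dots,Y_n$ drawn from a regular parametric model $\mathbf P=\{P_\theta:\theta\in\Theta\}$ satisfying the fourth-order regularity assumption (defined in the context). Take $m=m(n)$ Monte Carlo simulations per observation, where $\mathcal O(\sqrt n)\ll m\ll\mathcal O(n)$ (that is, $\sqrt n/m(n)\to0$ and $m(n)/n\to0$), and take $\mathcal J=\{-J,-J+1,\dots,0,\dots,J-1,J\}$ for $J$ a fixed integer greater than $1$. Then the maximum cubic log-likelihood estimator $\widehat\theta^{\mathrm{MCLE}}_n$ (defined in the context) is efficient.
   Context: Setting. $\Theta\subset\mathbb R$ is open, $\mu$ is a fixed $\sigma$-finite measure, and each $P_\theta$ is a probability distribution with density $p(\cdot;\theta)=dP_\theta/d\mu$; $s(\theta)=\sqrt{p(\cdot;\theta)}\in L_2(\mu)$ with norm $\|f\|^2=\int f^2d\mu$; $\mathbf l(\theta)=\sum_{i=1}^n\log p(Y_i;\theta)$. "Regular parametric model" has its standard meaning: $\theta\mapsto s(\theta)$ is continuously differentiable into $L_2(\mu)$ with positive Fisher information at every point. A point $\theta_0$ interior to $\Theta$ is a fourth-order regular point if: (1) there are $\dot s(\theta_0),\ddot s(\theta_0),\dddot s(\theta_0),\ddddot s(\theta_0)\in L_2(\mu)$ such that, for any $\delta_n\to0$ and bounded $t_n$, for each $k=2,3,4$, $\big\|\delta_n^{-k}\big(s(\theta_0+\delta_nt_n)-\sum_{j=0}^{k-1}\frac1{j!}s^{(j)}(\theta_0)(\delta_nt_n)^j\big)-\frac1{k!}s^{(k)}(\theta_0)t_n^k\big\|\to0$,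 where $s^{(0)}=s$, $s^{(1)}=\dot s$, etc.; (2) $\dot{\mathbf I}(\theta)=2\frac{\dot s(\theta)}{s(\theta)}\mathbf 1_{\{s(\theta)>0\}}$ has non-zero second moment $\mathcal I(\theta)=E_\theta[\dot{\mathbf I}(\theta)^2]$ and non-zero fourth moment; (3) $\ddot{\mathbf I}(\theta)=2\frac{\ddot s(\theta)}{s(\theta)}\mathbf 1_{\{s(\theta)>0\}}$ has non-zero second moment. Fourth-order regularity assumption: (i) every point of $\Theta$ is a fourth-order regular point; (ii) $\theta\mapsto\ddddot s(\theta)$ is continuous from $\Theta$ to $L_2(\mu)$; (iii) with $\dddot{\mathbf I}(\theta)=2\frac{\dddot s(\theta)}{s(\theta)}\mathbf 1_{\{s(\theta)>0\}}$, $\ddddot{\mathbf I}(\theta)=2\frac{\ddddot s(\theta)}{s(\theta)}\mathbf 1_{\{s(\theta)>0\}}$: $E_\theta|\dot{\mathbf I}(\theta)|^6$, $E_\theta|\ddot{\mathbf I}(\theta)|^3$, $E_\theta|\dddot{\mathbf I}(\theta)|^2$, $E_\theta|\ddddot{\mathbf I}(\theta)|$ are finite. Grid. $\widetilde\theta_n$ is a uniformly $\sqrt n$-consistent estimator of $\theta$; $\theta_n^\ast$ is the midpoint of the interval, in a grid of equally spaced points with separation $n^{-1/2}$ over $\mathbb R$, into which $\widetilde\theta_n$ falls (so $\theta^\ast_n$ is also uniformly $\sqrt n$-consistent). For $j\in\mathcal J$ put $\theta^\ast_{j,n}=\theta^\ast_n+jn^{-1/4}$. Monte Carlo evaluations.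 One does not have access to $\mathbf l(\theta^\ast_{j,n})$ but to a Monte Carlo evaluation of it, which may be generated as follows. The density has the form $p(y;\theta)=\int p_{Y|X}(y|x;\theta)p_X(x;\theta)\,dx$. For each $Y_i$ and $\theta^\ast_{j,n}$, independent Monte Carlo samples $X^{(1)}_{i,j},\dots,X^{(m)}_{i,j}$ are drawn from an appropriate density $q(\cdot;\theta^\ast_{j,n})$; $\overline p(Y_i;\theta^\ast_{j,n})=\frac1m\sum_{\tau=1}^m p_{Y|X}(Y_i|X^{(\tau)}_{i,j};\theta^\ast_{j,n})\,p_X(X^{(\tau)}_{i,j};\theta^\ast_{j,n})/q(X^{(\tau)}_{i,j};\theta^\ast_{j,n})$ and $\overline{\mathbf l}(\theta^\ast_{j,n})=\sum_{i=1}^n\ln\overline p(Y_i;\theta^\ast_{j,n})$. In this setting, for the stated range of $m$, Monte Carlo log-likelihood theory is taken to give $\overline{\mathbf l}(\theta^\ast_{j,n})=\mathbf l(\theta^\ast_{j,n})+\gamma(\theta^\ast_{j,n})+\widetilde\epsilon_{j,n}$, where $\widetilde\epsilon_{j,n}$ is i.i.d. with $\sqrt{m/n}\,\widetilde\epsilon_{j,n}$ converging in distribution to a normal law with mean zero and positive finite variance, and the bias satisfies $\gamma(\theta^\ast_{j,n})=\gamma(\theta^\ast_n)+C_\gamma\frac nm jn^{-1/4}(1+o(1))$ for a finite constant $C_\gamma$. Estimator. Let $\widehat\beta=(\widehat\beta_0,\widehat\beta_1,\widehat\beta_2,\widehat\beta_3)$ be the ordinary least squares coefficients in the regression of $\overline{\mathbf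 l}(\theta^\ast_{j,n})$, $j\in\mathcal J$, on $1,\,jn^{-1/4},\,(jn^{-1/4})^2,\,(jn^{-1/4})^3$. The maximum cubic log-likelihood estimator is defined, when it is finite, as $$\widehat\theta^{\mathrm{MCLE}}_n=\theta^\ast_n+n^{-1/4}\arg\max_{\chi\in\mathbb R}\big\{\widehat\beta_1(\chi n^{-1/4})+\widehat\beta_2(\chi n^{-1/4})^2+\widehat\beta_3(\chi n^{-1/4})^3\big\}.$$ The authors argue that the cubic term contributes negligibly, on the $n^{-1/2}$ scale, to finding the desired maximizer in the interval $[-Jn^{-1/4},Jn^{-1/4}]$, so that they use $\widehat\theta^{\mathrm{MCLE}}_n=\theta_n^\ast+\frac{\widehat\beta_1}{-2\widehat\beta_2}+o(n^{-1/2})$. Efficient has its usual meaning: asymptotically the estimator attains the variance $1/(n\mathcal I(\theta))$ of the classical efficient (one-step) estimator; in particular the squared Monte Carlo standard error is negligible relative to the squared statistical standard error $1/(n\mathcal I(\theta))$. *)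

theory Defs
  imports "HOL-Probability.Probability"
begin

definition L2_fun :: "'y measure \<Rightarrow> ('y \<Rightarrow> real) \<Rightarrow> bool" where
  "L2_fun \<mu> f \<longleftrightarrow> f \<in> borel_measurable \<mu> \<and> integrable \<mu> (\<lambda>y. (f y)\<^sup>2)"

definition L2_norm :: "'y measure \<Rightarrow> ('y \<Rightarrow> real) \<Rightarrow> real" where
  "L2_norm \<mu> f = sqrt (LINT y|\<mu>. (f y)\<^sup>2)"

text \<open>A parametric model is given by its densities \<open>p \<theta>\<close> with respect to \<open>\<mu>\<close>.  Nothing is
  assumed about \<open>p \<theta>\<close> for \<open>\<theta>\<close> outside \<open>\<Theta>\<close>.\<close>

definition model :: "'y measure \<Rightarrow> (real \<Rightarrow> 'y \<Rightarrow> real) \<Rightarrow> real \<Rightarrow> 'y measure" where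
  "model \<mu> p \<theta> = density \<mu> (\<lambda>y. ennreal (p \<theta> y))"

definition parametric_model :: "'y measure \<Rightarrow> real set \<Rightarrow> (real \<Rightarrow> 'y \<Rightarrow> real) \<Rightarrow> bool" where
  "parametric_model \<mu> \<Theta> p \<longleftrightarrow> sigma_finite_measure \<mu> \<and> open \<Theta> \<and>
     (\<forall>\<theta>\<in>\<Theta>. p \<theta> \<in> borel_measurable \<mu> \<and> (\<forall>y\<in>space \<mu>. 0 \<le> p \<theta> y) \<and> prob_space (model \<mu> p \<theta>))"

definition root_density :: "(real \<Rightarrow> 'y \<Rightarrow> real) \<Rightarrow> real \<Rightarrow> 'y \<Rightarrow> real" where
  "root_density p \<theta> y = sqrt (p \<theta> y)"

text \<open>Throughout, \<open>sd k \<theta>\<close> is a representative of the \<open>k\<close>-th derivative of the square root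
  density at \<open>\<theta>\<close>, with \<open>sd 0 = root_density p\<close>.  Only the classes of the \<open>sd k \<theta>\<close> in
  \<open>L\<^sub>2(\<mu>)\<close> matter.  \<open>score p sd k \<theta>\<close> is the function \<open>2 s\<^sup>(\<^sup>k\<^sup>)(\<theta>) / s(\<theta>)\<close> on the set where
  \<open>s(\<theta>) > 0\<close>; for \<open>k = 1\<close> it is the score function.\<close>

definition score ::
  "(real \<Rightarrow> 'y \<Rightarrow> real) \<Rightarrow> (nat \<Rightarrow> real \<Rightarrow> 'y \<Rightarrow> real) \<Rightarrow> nat \<Rightarrow> real \<Rightarrow> 'y \<Rightarrow> real" where
  "score p sd k \<theta> y =
     (if root_density p \<theta> y > 0 then 2 * (sd k \<theta> y / root_density p \<theta> y) else 0)"

definition fisher_info ::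
  "'y measure \<Rightarrow> (real \<Rightarrow> 'y \<Rightarrow> real) \<Rightarrow> (nat \<Rightarrow> real \<Rightarrow> 'y \<Rightarrow> real) \<Rightarrow> real \<Rightarrow> real" where
  "fisher_info \<mu> p sd \<theta> = (LINT y|model \<mu> p \<theta>. (score p sd 1 \<theta> y)\<^sup>2)"

definition L2_continuous_on :: "'y measure \<Rightarrow> real set \<Rightarrow> (real \<Rightarrow> 'y \<Rightarrow> real) \<Rightarrow> bool" where
  "L2_continuous_on \<mu> \<Theta> f \<longleftrightarrow> (\<forall>\<theta>\<in>\<Theta>. L2_fun \<mu> (f \<theta>) \<and>
     ((\<lambda>\<theta>'. L2_norm \<mu> (\<lambda>y. f \<theta>' y - f \<theta> y)) \<longlongrightarrow> 0) (at \<theta> within \<Theta>))"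

definition regular_parametric_model ::
  "'y measure \<Rightarrow> real set \<Rightarrow> (real \<Rightarrow> 'y \<Rightarrow> real) \<Rightarrow> (nat \<Rightarrow> real \<Rightarrow> 'y \<Rightarrow> real) \<Rightarrow> bool" where
  "regular_parametric_model \<mu> \<Theta> p sd \<longleftrightarrow> parametric_model \<mu> \<Theta> p \<and>
     (\<forall>\<theta>\<in>\<Theta>. ((\<lambda>h. L2_norm \<mu> (\<lambda>y. root_density p (\<theta> + h) y - root_density p \<theta> y - h * sd 1 \<theta> y)
                     / \<bar>h\<bar>) \<longlongrightarrow> 0) (at 0)) \<and>
     L2_continuous_on \<mu> \<Theta> (sd 1) \<and>
     (\<forall>\<theta>\<in>\<Theta>. 0 < fisher_info \<mu> p sd \<theta>)"

text \<open>Since the Bochner integral of a non-integrable function is \<open>0\<close>, the conditions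
  \<open>\<dots> \<noteq> 0\<close> on moments below say that the moment is finite and non-zero.\<close>

definition fourth_order_regular_point ::
  "'y measure \<Rightarrow> real set \<Rightarrow> (real \<Rightarrow> 'y \<Rightarrow> real) \<Rightarrow> (nat \<Rightarrow> real \<Rightarrow> 'y \<Rightarrow> real) \<Rightarrow> real \<Rightarrow> bool" where
  "fourth_order_regular_point \<mu> \<Theta> p sd \<theta>\<^sub>0 \<longleftrightarrow>
     \<theta>\<^sub>0 \<in> interior \<Theta> \<and>
     sd 0 \<theta>\<^sub>0 = root_density p \<theta>\<^sub>0 \<and> (\<forall>k\<in>{1..4}. L2_fun \<mu> (sd k \<theta>\<^sub>0)) \<and>
     (\<forall>\<delta> t :: nat \<Rightarrow> real. \<delta> \<longlonglongrightarrow> 0 \<and> (\<forall>n. \<delta> n \<noteq> 0) \<and> Bseq t \<longrightarrow>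
       (\<forall>k\<in>{2..4}.
         (\<lambda>n. L2_norm \<mu> (\<lambda>y.
            (root_density p (\<theta>\<^sub>0 + \<delta> n * t n) y
              - (\<Sum>j<k. sd j \<theta>\<^sub>0 y * (\<delta> n * t n) ^ j / fact j)) / (\<delta> n) ^ k
            - sd k \<theta>\<^sub>0 y * (t n) ^ k / fact k)) \<longlonglongrightarrow> 0)) \<and>
     (LINT y|model \<mu> p \<theta>\<^sub>0. (score p sd 1 \<theta>\<^sub>0 y)\<^sup>2) \<noteq> 0 \<and>
     (LINT y|model \<mu> p \<theta>\<^sub>0. (score p sd 1 \<theta>\<^sub>0 y) ^ 4) \<noteq> 0 \<and>
     (LINT y|model \<mu> p \<theta>\<^sub>0. (score p sd 2 \<theta>\<^sub>0 y)\<^sup>2) \<noteq> 0"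

definition fourth_order_regularity ::
  "'y measure \<Rightarrow> real set \<Rightarrow> (real \<Rightarrow> 'y \<Rightarrow> real) \<Rightarrow> (nat \<Rightarrow> real \<Rightarrow> 'y \<Rightarrow> real) \<Rightarrow> bool" where
  "fourth_order_regularity \<mu> \<Theta> p sd \<longleftrightarrow>
     (\<forall>\<theta>\<in>\<Theta>. fourth_order_regular_point \<mu> \<Theta> p sd \<theta>) \<and>
     L2_continuous_on \<mu> \<Theta> (sd 4) \<and>
     (\<forall>\<theta>\<in>\<Theta>.
        integrable (model \<mu> p \<theta>) (\<lambda>y. \<bar>score p sd 1 \<theta> y\<bar> ^ 6) \<and>
        integrable (model \<mu> p \<theta>) (\<lambda>y. \<bar>score p sd 2 \<theta> y\<bar> ^ 3) \<and>
        integrable (model \<mu> p \<theta>) (\<lambda>y. \<bar>score p sd 3 \<theta> y\<bar> ^ 2) \<and>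
        integrable (model \<mu> p \<theta>) (\<lambda>y. \<bar>score p sd 4 \<theta> y\<bar>))"

text \<open>The sample of size \<open>n\<close> is \<open>Y 0, \<dots>, Y (n - 1)\<close>.\<close>

definition iid_sample :: "'w measure \<Rightarrow> 'y measure \<Rightarrow> 'y measure \<Rightarrow> (nat \<Rightarrow> 'w \<Rightarrow> 'y) \<Rightarrow> bool" where
  "iid_sample M \<mu> D Y \<longleftrightarrow> prob_space.indep_vars M (\<lambda>_. \<mu>) Y UNIV \<and> (\<forall>i. distr M \<mu> (Y i) = D)"

definition log_lik :: "(real \<Rightarrow> 'y \<Rightarrow> real) \<Rightarrow> (nat \<Rightarrow> 'w \<Rightarrow> 'y) \<Rightarrow> nat \<Rightarrow> real \<Rightarrow> 'w \<Rightarrow> real" where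
  "log_lik p Y n \<theta> \<omega> = (\<Sum>i<n. ln (p \<theta> (Y i \<omega>)))"

definition tendsto_zero_in_prob :: "'w measure \<Rightarrow> (nat \<Rightarrow> 'w \<Rightarrow> real) \<Rightarrow> bool" where
  "tendsto_zero_in_prob M X \<longleftrightarrow> (\<forall>n. X n \<in> borel_measurable M) \<and>
     (\<forall>\<epsilon>>0. (\<lambda>n. measure M {\<omega> \<in> space M. \<epsilon> < \<bar>X n \<omega>\<bar>}) \<longlonglongrightarrow> 0)"

definition estimator ::
  "(nat \<Rightarrow> 'w \<Rightarrow> 'y) \<Rightarrow> (nat \<Rightarrow> (nat \<Rightarrow> 'y) \<Rightarrow> real) \<Rightarrow> nat \<Rightarrow> 'w \<Rightarrow> real" where
  "estimator Y T n \<omega> = T n (\<lambda>i\<in>{..<n}. Y i \<omega>)"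

text \<open>Uniformity is over compact subsets of \<open>\<Theta>\<close>, the weakest of the usual conventions.\<close>

definition uniformly_root_n_consistent ::
  "real set \<Rightarrow> (real \<Rightarrow> 'w measure) \<Rightarrow> (nat \<Rightarrow> 'w \<Rightarrow> real) \<Rightarrow> bool" where
  "uniformly_root_n_consistent \<Theta> P T \<longleftrightarrow>
     (\<forall>K. compact K \<and> K \<subseteq> \<Theta> \<longrightarrow>
       (\<forall>\<epsilon>>0. \<exists>B N. \<forall>n\<ge>N. \<forall>\<theta>\<in>K.
          measure (P \<theta>) {\<omega> \<in> space (P \<theta>). B < sqrt (real n) * \<bar>T n \<omega> - \<theta>\<bar>} \<le> \<epsilon>))"

text \<open>The midpoint of the cell \<open>[a + k d, a + (k + 1) d)\<close>, \<open>k\<close> an integer, that contains \<open>x\<close>.\<close>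

definition grid_midpoint :: "real \<Rightarrow> real \<Rightarrow> real \<Rightarrow> real" where
  "grid_midpoint a d x = a + (real_of_int \<lfloor>(x - a) / d\<rfloor> + 1 / 2) * d"

definition eval_point :: "(nat \<Rightarrow> 'w \<Rightarrow> real) \<Rightarrow> nat \<Rightarrow> int \<Rightarrow> 'w \<Rightarrow> real" where
  "eval_point \<theta>s n j \<omega> = \<theta>s n \<omega> + real_of_int j * real n powr (- 1 / 4)"

text \<open>\<open>lbar n j\<close> is a Monte Carlo evaluation, with Monte Carlo sample size \<open>m n\<close>, of the log
  likelihood at \<open>eval_point \<theta>s n j\<close>: log likelihood plus bias \<open>\<gamma> n\<close>, a function of the parameter at
  which it is evaluated, plus error \<open>\<epsilon> n j\<close>.  The term \<open>o(1)\<close> in the bias is the \<open>r j n\<close>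
  below; it is random because the evaluation points are.  The two equations are only imposed where
  the terms occurring in them are meaningful: evaluation points in \<open>\<Theta>\<close> and (because \<open>ln 0 = 0\<close>
  in HOL) a log likelihood different from \<open>-\<infinity>\<close>.\<close>

definition mc_evaluation ::
  "'w measure \<Rightarrow> real set \<Rightarrow> (real \<Rightarrow> 'y \<Rightarrow> real) \<Rightarrow> (nat \<Rightarrow> 'w \<Rightarrow> 'y) \<Rightarrow> (nat \<Rightarrow> nat) \<Rightarrow> int \<Rightarrow>
     (nat \<Rightarrow> 'w \<Rightarrow> real) \<Rightarrow> (nat \<Rightarrow> int \<Rightarrow> 'w \<Rightarrow> real) \<Rightarrow> bool" where
  "mc_evaluation M \<Theta> p Y m J \<theta>s lbar \<longleftrightarrow>
     (\<exists>(\<gamma> :: nat \<Rightarrow> real \<Rightarrow> real) (\<epsilon> :: nat \<Rightarrow> int \<Rightarrow> 'w \<Rightarrow> real) (r :: int \<Rightarrow> nat \<Rightarrow> 'w \<Rightarrow> real)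
        (C :: real) (\<sigma> :: real).
       (\<forall>n\<ge>1. \<forall>j\<in>{-J..J}. \<forall>\<omega>\<in>space M.
          eval_point \<theta>s n j \<omega> \<in> \<Theta> \<and> (\<forall>i<n. 0 < p (eval_point \<theta>s n j \<omega>) (Y i \<omega>)) \<longrightarrow>
          lbar n j \<omega> =
            log_lik p Y n (eval_point \<theta>s n j \<omega>) \<omega> + \<gamma> n (eval_point \<theta>s n j \<omega>) + \<epsilon> n j \<omega>) \<and>
       (\<forall>n\<ge>1. prob_space.indep_vars M (\<lambda>_. borel) (\<epsilon> n) {-J..J} \<and>
          (\<forall>j\<in>{-J..J}. \<forall>k\<in>{-J..J}. distr M borel (\<epsilon> n j) = distr M borel (\<epsilon> n k))) \<and>
       0 < \<sigma> \<and>
       (\<forall>j\<in>{-J..J}. weak_conv_m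
          (\<lambda>n. distr M borel (\<lambda>\<omega>. sqrt (real (m n) / real n) * \<epsilon> n j \<omega>))
          (density lborel (normal_density 0 \<sigma>))) \<and>
       (\<forall>n\<ge>1. \<forall>j\<in>{-J..J}. \<forall>\<omega>\<in>space M.
          \<theta>s n \<omega> \<in> \<Theta> \<and> eval_point \<theta>s n j \<omega> \<in> \<Theta> \<longrightarrow>
          \<gamma> n (eval_point \<theta>s n j \<omega>) = \<gamma> n (\<theta>s n \<omega>)
            + C * (real n / real (m n)) * (real_of_int j * real n powr (- 1 / 4)) * (1 + r j n \<omega>)) \<and>
       (\<forall>j\<in>{-J..J}. tendsto_zero_in_prob M (r j)))"

text \<open>Ordinary least squares coefficients \<open>\<beta> 0, \<dots>, \<beta> 3\<close> for the cubic regression of \<open>z j\<close>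
  on \<open>j h\<close>, \<open>-J \<le> j \<le> J\<close>.\<close>

definition cubic_ols :: "int \<Rightarrow> real \<Rightarrow> (int \<Rightarrow> real) \<Rightarrow> (nat \<Rightarrow> real) \<Rightarrow> bool" where
  "cubic_ols J h z \<beta> \<longleftrightarrow>
     (\<forall>b :: nat \<Rightarrow> real.
        (\<Sum>j\<in>{-J..J}. (z j - (\<Sum>k\<le>3. \<beta> k * (real_of_int j * h) ^ k))\<^sup>2)
        \<le> (\<Sum>j\<in>{-J..J}. (z j - (\<Sum>k\<le>3. b k * (real_of_int j * h) ^ k))\<^sup>2))"

definition fitted_cubic :: "real \<Rightarrow> (nat \<Rightarrow> real) \<Rightarrow> real \<Rightarrow> real" where
  "fitted_cubic h \<beta> x = \<beta> 1 * (x * h) + \<beta> 2 * (x * h)\<^sup>2 + \<beta> 3 * (x * h) ^ 3"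

text \<open>A cubic with \<open>\<beta> 3 \<noteq> 0\<close> is unbounded above on the real line, so that its global argmax
  does not exist; the maximizer that is then meant is the one over \<open>-J \<le> x \<le> J\<close>.\<close>

definition cubic_argmax :: "int \<Rightarrow> real \<Rightarrow> (nat \<Rightarrow> real) \<Rightarrow> real \<Rightarrow> bool" where
  "cubic_argmax J h \<beta> x \<longleftrightarrow>
     (if \<exists>u. is_arg_max (fitted_cubic h \<beta>) (\<lambda>_. True) u
      then is_arg_max (fitted_cubic h \<beta>) (\<lambda>_. True) x
      else is_arg_max (fitted_cubic h \<beta>) (\<lambda>u. u \<in> {- real_of_int J..real_of_int J}) x)"

definition mcle ::
  "int \<Rightarrow> (nat \<Rightarrow> 'w \<Rightarrow> real) \<Rightarrow> (nat \<Rightarrow> 'w \<Rightarrow> nat \<Rightarrow> real) \<Rightarrow> 'w set \<Rightarrow> (nat \<Rightarrow> 'w \<Rightarrow> real) \<Rightarrow> bool" where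
  "mcle J \<theta>s \<beta> \<Omega> \<theta>hat \<longleftrightarrow>
     (\<forall>n\<ge>1. \<forall>\<omega>\<in>\<Omega>. \<exists>x. cubic_argmax J (real n powr (- 1 / 4)) (\<beta> n \<omega>) x \<and>
        \<theta>hat n \<omega> = \<theta>s n \<omega> + real n powr (- 1 / 4) * x)"

text \<open>The form \<open>\<theta>s n + \<beta> 1 / (- 2 \<beta> 2) + o(n\<^sup>-\<^sup>1\<^sup>/\<^sup>2)\<close> in which the estimator is used.\<close>

definition mcle_quadratic_form ::
  "real set \<Rightarrow> (real \<Rightarrow> 'w measure) \<Rightarrow> (nat \<Rightarrow> 'w \<Rightarrow> real) \<Rightarrow> (nat \<Rightarrow> 'w \<Rightarrow> nat \<Rightarrow> real) \<Rightarrow>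
     (nat \<Rightarrow> 'w \<Rightarrow> real) \<Rightarrow> bool" where
  "mcle_quadratic_form \<Theta> P \<theta>s \<beta> \<theta>hat \<longleftrightarrow>
     (\<forall>\<theta>\<in>\<Theta>. tendsto_zero_in_prob (P \<theta>)
        (\<lambda>n \<omega>. sqrt (real n) * (\<theta>hat n \<omega> - (\<theta>s n \<omega> + \<beta> n \<omega> 1 / (- 2 * \<beta> n \<omega> 2)))))"

text \<open>The first conjunct is attainment of the asymptotic variance \<open>1 / (n I(\<theta>))\<close>.  The second is
  asymptotic linearity with the efficient influence function \<open>score / I(\<theta>)\<close>: on the
  scale \<open>n\<^sup>-\<^sup>1\<^sup>/\<^sup>2\<close> the estimator equals a function of the data alone, i.e. the Monte Carlo error is
  negligible compared to the statistical error.\<close>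

definition efficient ::
  "'y measure \<Rightarrow> real set \<Rightarrow> (real \<Rightarrow> 'y \<Rightarrow> real) \<Rightarrow> (nat \<Rightarrow> real \<Rightarrow> 'y \<Rightarrow> real) \<Rightarrow>
     (real \<Rightarrow> 'w measure) \<Rightarrow> (nat \<Rightarrow> 'w \<Rightarrow> 'y) \<Rightarrow> (nat \<Rightarrow> 'w \<Rightarrow> real) \<Rightarrow> bool" where
  "efficient \<mu> \<Theta> p sd P Y \<theta>hat \<longleftrightarrow>
     (\<forall>\<theta>\<in>\<Theta>.
        weak_conv_m (\<lambda>n. distr (P \<theta>) borel (\<lambda>\<omega>. sqrt (real n) * (\<theta>hat n \<omega> - \<theta>)))
          (density lborel (normal_density 0 (sqrt (1 / fisher_info \<mu> p sd \<theta>)))) \<and>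
        tendsto_zero_in_prob (P \<theta>)
          (\<lambda>n \<omega>. sqrt (real n) * (\<theta>hat n \<omega> - \<theta>)
             - (\<Sum>i<n. score p sd 1 \<theta> (Y i \<omega>) / fisher_info \<mu> p sd \<theta>) / sqrt (real n)))"

end

theory Submission
  imports Defs
begin

text \<open>Write \<open>\<delta> = n\<^sup>-\<^sup>1\<^sup>/\<^sup>4\<close>, \<open>I\<close> for the Fisher information at the true parameter \<open>\<theta>\<close>,
  \<open>Z\<close> for \<open>n\<^sup>-\<^sup>1\<^sup>/\<^sup>2\<close> times the sum of the scores, and \<open>T = \<surd>n (\<theta>* - \<theta>)\<close> for the scaled error of the
  discretized preliminary estimator.  The evaluation points are \<open>\<theta> + h\<^sub>j\<close> with \<open>h\<^sub>j = \<delta> (j + \<delta> T)\<close>, so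
  that \<open>h\<^sub>j = O(\<delta>)\<close>.  At this distance the log likelihood satisfies
  \<open>l(\<theta> + h) = l(\<theta>) + A\<^sub>1 h + A\<^sub>2 h\<^sup>2 + A\<^sub>3 h\<^sup>3 + o(1 / \<delta>)\<close> in probability, where \<open>A\<^sub>1 = \<surd>n Z\<close>,
  \<open>A\<^sub>2 / n \<rightarrow> - I / 2\<close> and \<open>A\<^sub>3 = O(n)\<close>.

  Let \<open>b\<^sub>k = \<beta>\<^sub>k \<delta>\<^sup>k\<close>.  Least squares is linear in the responses and reproduces cubics, so \<open>b\<^sub>k\<close> is the
  coefficient of \<open>j\<^sup>k\<close> in the expansion above plus a weighted sum of the errors.  The shift \<open>\<delta> T\<close>
  turns the curvature into a contribution to the slope: \<open>V = \<delta> b\<^sub>1 = Z - I T + o(1)\<close>, while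
  \<open>U = \<delta>\<^sup>2 b\<^sub>2 \<rightarrow> - I / 2\<close> and \<open>Q = \<delta> b\<^sub>3 = O(1)\<close>.  The Monte Carlo noise in the \<open>b\<^sub>k\<close> has size \<open>\<surd>(n / m)\<close>,
  and the bias changes between evaluation points by an amount of order \<open>\<delta> n / m\<close>; multiplied by \<open>\<delta>\<close> both
  vanish because \<open>\<surd>n / m \<rightarrow> 0\<close>.  The quadratic step therefore gives
  \<open>T + V / (- 2 U) = T + (Z - I T) / I + o(1) = Z / I + o(1)\<close>: the error of the preliminary
  estimator cancels, and what is left is the efficient influence function.  The maximizer of the
  fitted cubic is within \<open>O(\<delta>)\<close> of zero on the scale of \<open>j\<close>, and there the cubic term shifts the
  estimator by only \<open>O(\<delta>\<^sup>2 n\<^sup>-\<^sup>1\<^sup>/\<^sup>2)\<close> (\<open>cubic_argmax_near_quadratic\<close>).  Asymptotic normality follows by the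
  central limit theorem and Slutsky's lemma.

  The expansion (\<open>log_density_expansion\<close>) comes from the third-order Taylor formula of the root
  density in \<open>L\<^sub>2(\<mu>)\<close>.  Outside an event of probability \<open>o(h\<^sup>4)\<close> for one observation, hence \<open>o(1)\<close>
  for the sample, every term of the formula divided by \<open>s(\<theta>)\<close> is small, and there the logarithm
  can be expanded pointwise with an error whose mean is \<open>o(h\<^sup>3)\<close>.  The mean of the quadratic
  coefficient is found by differentiating the identity \<open>\<parallel>s(\<theta> + h)\<parallel> = 1\<close> twice.  The evaluation points
  depend on the data; since \<open>\<theta>*\<close> has only boundedly many possible values at distance \<open>O(n\<^sup>-\<^sup>1\<^sup>/\<^sup>2)\<close> from
  \<open>\<theta>\<close>, a union bound (\<open>eventually_in_prob_grid\<close>) reduces them to deterministic ones.\<close>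

section \<open>Convergence and boundedness in probability\<close>

text \<open>A property of pairs \<open>(n, \<omega>)\<close> holds eventually with respect to this filter if it holds, for
  large \<open>n\<close>, on a measurable set of probability close to one.  Convergence in probability to zero is
  then the limit \<open>X \<longlongrightarrow> 0\<close> along the filter, so that the library of limits applies, and it makes sense
  for functions such as the least squares coefficients that come without measurability.\<close>
definition in_prob :: "'w measure \<Rightarrow> (nat \<times> 'w) filter" where
  "in_prob M = Abs_filter (\<lambda>Q. \<forall>e>0. \<forall>\<^sub>F n in sequentially.
     \<exists>A\<in>sets M. measure M (space M - A) \<le> e \<and> (\<forall>\<omega>\<in>A. Q (n, \<omega>)))"

lemma (in prob_space) eventually_in_prob:
  "eventually Q (in_prob M) \<longleftrightarrow> (\<forall>e>0. \<forall>\<^sub>F n in sequentially.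
     \<exists>A\<in>sets M. measure M (space M - A) \<le> e \<and> (\<forall>\<omega>\<in>A. Q (n, \<omega>)))"
  unfolding in_prob_def
proof (rule eventually_Abs_filter, rule is_filter.intro, goal_cases)
  case 1
  then show ?case
    by (intro allI impI always_eventually) (auto intro!: bexI[of _ "space M"])
next
  case (2 P Q)
  show ?case
  proof (intro allI impI)
    fix e :: real assume "e > 0"
    then have "e / 2 > 0" by simp
    from 2(1)[rule_format, OF this] 2(2)[rule_format, OF this]
    show "\<forall>\<^sub>F n in sequentially. \<exists>A\<in>events. prob (space M - A) \<le> e \<and> (\<forall>\<omega>\<in>A. P (n, \<omega>) \<and> Q (n, \<omega>))"
    proof eventually_elim
      case (elim n)
      then obtain A B where A: "A \<in> events" "prob (space M - A) \<le> e / 2" "\<forall>\<omega>\<in>A. P (n, \<omega>)"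
        and B: "B \<in> events" "prob (space M - B) \<le> e / 2" "\<forall>\<omega>\<in>B. Q (n, \<omega>)" by blast
      have "prob (space M - A \<inter> B) = prob ((space M - A) \<union> (space M - B))"
        by (simp add: Diff_Int)
      also have "\<dots> \<le> prob (space M - A) + prob (space M - B)"
        using A B by (intro measure_Un_le) auto
      finally show ?case using A B by (intro bexI[of _ "A \<inter> B"]) auto
    qed
  qed
next
  case (3 P Q)
  then show ?case
    by (intro allI impI) (drule spec, drule (1) mp, erule eventually_mono, blast)
qed

text \<open>Deterministic limits transfer to limits in probability.\<close>
lemma (in prob_space) filterlim_fst_in_prob: "filterlim fst sequentially (in_prob M)"
  unfolding filterlim_iff eventually_in_prob
  by (intro allI impI) (auto elim!: eventually_mono intro!: bexI[of _ "space M"])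

lemmas (in prob_space) eventually_fst_in_prob =
  eventually_compose_filterlim[OF _ filterlim_fst_in_prob]

lemma (in prob_space) tendsto_fst_in_prob:
  assumes "f \<longlonglongrightarrow> l" shows "((\<lambda>x. f (fst x)) \<longlongrightarrow> l) (in_prob M)"
  using filterlim_compose[OF assms filterlim_fst_in_prob] .

lemma (in prob_space) eventually_snd_in_prob: "\<forall>\<^sub>F x in in_prob M. snd x \<in> space M"
  unfolding eventually_in_prob by (auto intro!: always_eventually bexI[of _ "space M"])

lemma (in prob_space) tendsto_zero_in_prob_iff:
  "tendsto_zero_in_prob M X \<longleftrightarrow>
     (\<forall>n. X n \<in> borel_measurable M) \<and> ((\<lambda>x. X (fst x) (snd x)) \<longlongrightarrow> 0) (in_prob M)"
proof (cases "\<forall>n. X n \<in> borel_measurable M")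
  case True
  then have [measurable]: "X n \<in> borel_measurable M" for n by blast
  have "((\<lambda>n. prob {\<omega>\<in>space M. \<epsilon> < \<bar>X n \<omega>\<bar>}) \<longlonglongrightarrow> 0) \<longleftrightarrow>
      (\<forall>\<^sub>F x in in_prob M. \<bar>X (fst x) (snd x)\<bar> \<le> \<epsilon>)" (is "?l \<longleftrightarrow> ?r") for \<epsilon>
  proof
    assume ?l
    then show ?r unfolding eventually_in_prob
    proof (intro allI impI)
      fix e :: real assume "e > 0"
      from \<open>?l\<close> have "\<forall>\<^sub>F n in sequentially. prob {\<omega>\<in>space M. \<epsilon> < \<bar>X n \<omega>\<bar>} < e"
        by (rule order_tendstoD) fact
      then show "\<forall>\<^sub>F n in sequentially. \<exists>A\<in>events. prob (space M - A) \<le> e \<and>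
          (\<forall>\<omega>\<in>A. \<bar>X (fst (n, \<omega>)) (snd (n, \<omega>))\<bar> \<le> \<epsilon>)"
      proof eventually_elim
        case (elim n)
        have "space M - {\<omega>\<in>space M. \<bar>X n \<omega>\<bar> \<le> \<epsilon>} = {\<omega>\<in>space M. \<epsilon> < \<bar>X n \<omega>\<bar>}" by auto
        with elim show ?case
          by (intro bexI[of _ "{\<omega>\<in>space M. \<bar>X n \<omega>\<bar> \<le> \<epsilon>}"]) auto
      qed
    qed
  next
    assume r: ?r
    show ?l
    proof (rule tendstoI)
      fix e :: real assume "e > 0"
      then have "e / 2 > 0" by simp
      from r[unfolded eventually_in_prob, rule_format, OF this]
      show "\<forall>\<^sub>F n in sequentially. dist (prob {\<omega>\<in>space M. \<epsilon> < \<bar>X n \<omega>\<bar>}) 0 < e"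
      proof eventually_elim
        case (elim n)
        then obtain A where A: "A \<in> events" "prob (space M - A) \<le> e / 2" "\<forall>\<omega>\<in>A. \<bar>X n \<omega>\<bar> \<le> \<epsilon>"
          by auto
        have "prob {\<omega>\<in>space M. \<epsilon> < \<bar>X n \<omega>\<bar>} \<le> prob (space M - A)"
          using A by (intro finite_measure_mono) auto
        with A \<open>e > 0\<close> show ?case by (simp add: dist_real_def)
      qed
    qed
  qed
  moreover have "(\<forall>\<epsilon>>0. \<forall>\<^sub>F x in in_prob M. \<bar>X (fst x) (snd x)\<bar> \<le> \<epsilon>) \<longleftrightarrow>
      ((\<lambda>x. X (fst x) (snd x)) \<longlongrightarrow> 0) (in_prob M)"
  proof
    assume *: "\<forall>\<epsilon>>0. \<forall>\<^sub>F x in in_prob M. \<bar>X (fst x) (snd x)\<bar> \<le> \<epsilon>"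
    show "((\<lambda>x. X (fst x) (snd x)) \<longlongrightarrow> 0) (in_prob M)"
    proof (rule tendstoI)
      fix e :: real assume "e > 0"
      then have "e / 2 > 0" by simp
      with * have "\<forall>\<^sub>F x in in_prob M. \<bar>X (fst x) (snd x)\<bar> \<le> e / 2"
        by blast
      then show "\<forall>\<^sub>F x in in_prob M. dist (X (fst x) (snd x)) 0 < e"
        by (rule eventually_mono) (use \<open>e > 0\<close> in auto)
    qed
  next
    assume "((\<lambda>x. X (fst x) (snd x)) \<longlongrightarrow> 0) (in_prob M)"
    then show "\<forall>\<epsilon>>0. \<forall>\<^sub>F x in in_prob M. \<bar>X (fst x) (snd x)\<bar> \<le> \<epsilon>"
      by (auto dest!: tendstoD elim!: eventually_mono)
  qed
  ultimately show ?thesis using True by (simp add: tendsto_zero_in_prob_def)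
qed (auto simp: tendsto_zero_in_prob_def)

text \<open>Tightness, again with measurable sets inside the event in place of the event itself.  The bound
  depends on the probability allowed for exceeding it, which is why this is weaker than being
  eventually bounded along \<open>in_prob\<close>.\<close>
definition bounded_in_prob :: "'w measure \<Rightarrow> (nat \<times> 'w \<Rightarrow> real) \<Rightarrow> bool" where
  "bounded_in_prob M X \<longleftrightarrow> (\<forall>e>0. \<exists>B. \<forall>\<^sub>F n in sequentially.
     \<exists>A\<in>sets M. measure M (space M - A) \<le> e \<and> (\<forall>\<omega>\<in>A. \<bar>X (n, \<omega>)\<bar> \<le> B))"

lemma (in prob_space) bounded_in_prob_tail:
  assumes "\<And>e. e > 0 \<Longrightarrow> \<exists>B. \<forall>\<^sub>F n in sequentially. {\<omega>\<in>space M. \<bar>X (n, \<omega>)\<bar> > B} \<in> events \<and>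
            prob {\<omega>\<in>space M. \<bar>X (n, \<omega>)\<bar> > B} \<le> e"
  shows "bounded_in_prob M X"
  unfolding bounded_in_prob_def
proof (intro allI impI)
  fix e :: real assume "e > 0"
  from assms[OF this] obtain B where B: "\<forall>\<^sub>F n in sequentially. {\<omega>\<in>space M. \<bar>X (n, \<omega>)\<bar> > B} \<in> events \<and>
            prob {\<omega>\<in>space M. \<bar>X (n, \<omega>)\<bar> > B} \<le> e" by blast
  show "\<exists>B. \<forall>\<^sub>F n in sequentially. \<exists>A\<in>events. prob (space M - A) \<le> e \<and> (\<forall>\<omega>\<in>A. \<bar>X (n, \<omega>)\<bar> \<le> B)"
  proof (intro exI[of _ B], rule eventually_mono[OF B])
    fix n assume *: "{\<omega>\<in>space M. \<bar>X (n, \<omega>)\<bar> > B} \<in> events \<and> prob {\<omega>\<in>space M. \<bar>X (n, \<omega>)\<bar> > B} \<le> e"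
    let ?A = "{\<omega>\<in>space M. \<bar>X (n, \<omega>)\<bar> > B}"
    have eq: "space M - (space M - ?A) = ?A" by blast
    show "\<exists>A\<in>events. prob (space M - A) \<le> e \<and> (\<forall>\<omega>\<in>A. \<bar>X (n, \<omega>)\<bar> \<le> B)"
    proof (rule bexI[of _ "space M - ?A"], rule conjI)
      show "prob (space M - (space M - ?A)) \<le> e" unfolding eq using * by (rule conjunct2)
      show "\<forall>\<omega>\<in>space M - ?A. \<bar>X (n, \<omega>)\<bar> \<le> B" by auto
      show "space M - ?A \<in> events" using conjunct1[OF *] by (rule sets.compl_sets)
    qed
  qed
qed

text \<open>Closure of boundedness in probability under sums, products and eventual equality reduces to
  the corresponding pointwise bounds.\<close>
lemma (in prob_space) bounded_in_prob_combine:
  assumes X: "bounded_in_prob M X" and Y: "bounded_in_prob M Y"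
    and Z: "\<And>B C. \<exists>D. \<forall>\<^sub>F x in in_prob M. \<bar>X x\<bar> \<le> B \<longrightarrow> \<bar>Y x\<bar> \<le> C \<longrightarrow> \<bar>Z x\<bar> \<le> D"
  shows "bounded_in_prob M Z"
  unfolding bounded_in_prob_def
proof (intro allI impI)
  fix e :: real assume "e > 0"
  then have e: "e / 3 > 0" by simp
  from X[unfolded bounded_in_prob_def, rule_format, OF e] obtain B where
    B: "\<forall>\<^sub>F n in sequentially. \<exists>A\<in>events. prob (space M - A) \<le> e/3 \<and> (\<forall>\<omega>\<in>A. \<bar>X (n, \<omega>)\<bar> \<le> B)" ..
  from Y[unfolded bounded_in_prob_def, rule_format, OF e] obtain C where
    C: "\<forall>\<^sub>F n in sequentially. \<exists>A\<in>events. prob (space M - A) \<le> e/3 \<and> (\<forall>\<omega>\<in>A. \<bar>Y (n, \<omega>)\<bar> \<le> C)" ..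
  from Z[of B C] obtain D where
    "\<forall>\<^sub>F x in in_prob M. \<bar>X x\<bar> \<le> B \<longrightarrow> \<bar>Y x\<bar> \<le> C \<longrightarrow> \<bar>Z x\<bar> \<le> D" ..
  from this[unfolded eventually_in_prob, rule_format, OF e] B C
  have "\<forall>\<^sub>F n in sequentially. \<exists>A\<in>events. prob (space M - A) \<le> e \<and> (\<forall>\<omega>\<in>A. \<bar>Z (n, \<omega>)\<bar> \<le> D)"
  proof eventually_elim
    case (elim n)
    then obtain A1 A2 A3 where A: "A1 \<in> events" "A2 \<in> events" "A3 \<in> events"
      "prob (space M - A1) \<le> e/3" "prob (space M - A2) \<le> e/3" "prob (space M - A3) \<le> e/3"
      "\<forall>\<omega>\<in>A1. \<bar>X (n, \<omega>)\<bar> \<le> B \<longrightarrow> \<bar>Y (n, \<omega>)\<bar> \<le> C \<longrightarrow> \<bar>Z (n, \<omega>)\<bar> \<le> D"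
      "\<forall>\<omega>\<in>A2. \<bar>X (n, \<omega>)\<bar> \<le> B" "\<forall>\<omega>\<in>A3. \<bar>Y (n, \<omega>)\<bar> \<le> C" by blast
    have "prob (space M - A1 \<inter> A2 \<inter> A3) = prob ((space M - A1) \<union> (space M - A2) \<union> (space M - A3))"
      by (rule arg_cong[where f = prob]) auto
    also have "\<dots> \<le> prob ((space M - A1) \<union> (space M - A2)) + prob (space M - A3)"
      using A by (intro measure_Un_le) auto
    also have "\<dots> \<le> prob (space M - A1) + prob (space M - A2) + prob (space M - A3)"
      using A by (intro add_right_mono measure_Un_le) auto
    finally have "prob (space M - A1 \<inter> A2 \<inter> A3) \<le> e" using A by simp
    moreover have "\<forall>\<omega>\<in>A1 \<inter> A2 \<inter> A3. \<bar>Z (n, \<omega>)\<bar> \<le> D" using A(7-9) by blast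
    ultimately show ?case using A(1-3) by (intro bexI[of _ "A1 \<inter> A2 \<inter> A3"]) auto
  qed
  then show "\<exists>B. \<forall>\<^sub>F n in sequentially. \<exists>A\<in>events. prob (space M - A) \<le> e \<and> (\<forall>\<omega>\<in>A. \<bar>Z (n, \<omega>)\<bar> \<le> B)" ..
qed

lemma (in prob_space) tendsto_imp_bounded_in_prob:
  assumes "(X \<longlongrightarrow> l) (in_prob M)" shows "bounded_in_prob M X"
proof -
  have "\<forall>\<^sub>F x in in_prob M. dist (X x) l < 1"
    using tendstoD[OF assms, of 1] by simp
  then have "\<forall>\<^sub>F x in in_prob M. \<bar>X x\<bar> \<le> \<bar>l\<bar> + 1"
    by (rule eventually_mono) (simp add: dist_real_def)
  then show ?thesis
    unfolding eventually_in_prob bounded_in_prob_def by (intro allI impI exI) (erule allE, erule (1) mp)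
qed

lemma (in prob_space) bounded_in_prob_add:
  assumes "bounded_in_prob M X" "bounded_in_prob M Y"
  shows "bounded_in_prob M (\<lambda>x. X x + Y x)"
proof (rule bounded_in_prob_combine[OF assms])
  fix B C
  show "\<exists>D. \<forall>\<^sub>F x in in_prob M. \<bar>X x\<bar> \<le> B \<longrightarrow> \<bar>Y x\<bar> \<le> C \<longrightarrow> \<bar>X x + Y x\<bar> \<le> D"
    by (rule exI[of _ "B + C"]) (auto intro!: always_eventually)
qed

lemma (in prob_space) bounded_in_prob_mult:
  assumes "bounded_in_prob M X" "bounded_in_prob M Y"
  shows "bounded_in_prob M (\<lambda>x. X x * Y x)"
proof (rule bounded_in_prob_combine[OF assms])
  fix B C
  show "\<exists>D. \<forall>\<^sub>F x in in_prob M. \<bar>X x\<bar> \<le> B \<longrightarrow> \<bar>Y x\<bar> \<le> C \<longrightarrow> \<bar>X x * Y x\<bar> \<le> D"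
    by (intro exI[of _ "B * C"] always_eventually allI impI) (simp add: abs_mult mult_mono')
qed

lemma (in prob_space) bounded_in_prob_const: "bounded_in_prob M (\<lambda>x. c)"
  by (rule tendsto_imp_bounded_in_prob[of _ c]) simp

lemma (in prob_space) bounded_in_prob_cong:
  assumes "bounded_in_prob M X" "\<forall>\<^sub>F x in in_prob M. X x = Y x"
  shows "bounded_in_prob M Y"
proof (rule bounded_in_prob_combine[OF assms(1) assms(1)])
  fix B C
  show "\<exists>D. \<forall>\<^sub>F x in in_prob M. \<bar>X x\<bar> \<le> B \<longrightarrow> \<bar>X x\<bar> \<le> C \<longrightarrow> \<bar>Y x\<bar> \<le> D"
    by (rule exI[of _ B], rule eventually_mono[OF assms(2)]) auto
qed

text \<open>On the event that \<open>X\<close> is bounded by \<open>B\<close>, the product is small as soon as \<open>Y\<close> is small compared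
  with \<open>1 / B\<close>.\<close>
lemma (in prob_space) tendsto_zero_mult_bounded_in_prob:
  assumes X: "bounded_in_prob M X" and Y: "(Y \<longlongrightarrow> 0) (in_prob M)"
  shows "((\<lambda>x. X x * Y x) \<longlongrightarrow> 0) (in_prob M)"
proof (rule tendstoI)
  fix r :: real assume r: "r > 0"
  show "\<forall>\<^sub>F x in in_prob M. dist (X x * Y x) 0 < r"
    unfolding eventually_in_prob
  proof (intro allI impI)
    fix e :: real assume "e > 0"
    then have e: "e / 2 > 0" by simp
    from X[unfolded bounded_in_prob_def, rule_format, OF e] obtain B where
      B: "\<forall>\<^sub>F n in sequentially. \<exists>A\<in>events. prob (space M - A) \<le> e/2 \<and> (\<forall>\<omega>\<in>A. \<bar>X (n, \<omega>)\<bar> \<le> B)" ..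
    have "r / (\<bar>B\<bar> + 1) > 0" using r by simp
    from tendstoD[OF Y this, unfolded eventually_in_prob, rule_format, OF e] B
    show "\<forall>\<^sub>F n in sequentially. \<exists>A\<in>events. prob (space M - A) \<le> e \<and> (\<forall>\<omega>\<in>A. dist (X (n, \<omega>) * Y (n, \<omega>)) 0 < r)"
    proof eventually_elim
      case (elim n)
      then obtain A1 A2 where A: "A1 \<in> events" "A2 \<in> events"
        "prob (space M - A1) \<le> e/2" "prob (space M - A2) \<le> e/2"
        "\<forall>\<omega>\<in>A1. \<bar>X (n, \<omega>)\<bar> \<le> B" "\<forall>\<omega>\<in>A2. dist (Y (n, \<omega>)) 0 < r / (\<bar>B\<bar> + 1)" by blast
      have "prob (space M - A1 \<inter> A2) = prob ((space M - A1) \<union> (space M - A2))"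
        by (simp add: Diff_Int)
      also have "\<dots> \<le> prob (space M - A1) + prob (space M - A2)"
        using A by (intro measure_Un_le) auto
      finally have P: "prob (space M - A1 \<inter> A2) \<le> e" using A by simp
      have "dist (X (n, \<omega>) * Y (n, \<omega>)) 0 < r" if "\<omega> \<in> A1 \<inter> A2" for \<omega>
      proof -
        have "\<bar>X (n, \<omega>) * Y (n, \<omega>)\<bar> \<le> (\<bar>B\<bar> + 1) * \<bar>Y (n, \<omega>)\<bar>"
          using A(5) that unfolding abs_mult by (intro mult_right_mono) fastforce+
        also have "\<dots> < (\<bar>B\<bar> + 1) * (r / (\<bar>B\<bar> + 1))"
          using A(6) that by (intro mult_strict_left_mono) (auto simp: dist_real_def)
        finally show ?thesis by (simp add: dist_real_def)
      qed
      with A P show ?case by (intro bexI[of _ "A1 \<inter> A2"]) auto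
    qed
  qed
qed

text \<open>The tails are values of the distribution function at \<open>\<plusminus> B\<close>, which converge because the limit
  distribution function is continuous.\<close>

lemma (in prob_space) weak_conv_imp_bounded_in_prob:
  assumes meas: "\<And>n. n \<ge> 1 \<Longrightarrow> X n \<in> borel_measurable M"
    and D: "real_distribution D" and cont: "\<And>x. isCont (cdf D) x"
    and conv: "weak_conv_m (\<lambda>n. distr M borel (X n)) D"
  shows "bounded_in_prob M (\<lambda>x. X (fst x) (snd x))"
proof (rule bounded_in_prob_tail)
  fix e :: real assume "e > 0"
  interpret D: real_distribution D by fact
  have "\<forall>\<^sub>F b in at_top. cdf D b > 1 - e / 3"
    by (rule order_tendstoD(1)[OF D.cdf_lim_at_top_prob]) (use \<open>e > 0\<close> in simp)
  moreover have "\<forall>\<^sub>F b in at_top. cdf D (- b) < e / 3"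
    by (rule order_tendstoD(2)[OF filterlim_compose[OF D.cdf_lim_at_bot filterlim_uminus_at_bot_at_top]])
      (use \<open>e > 0\<close> in simp)
  ultimately have "\<forall>\<^sub>F b in at_top. cdf D b > 1 - e / 3 \<and> cdf D (- b) < e / 3"
    by (rule eventually_conj)
  from eventually_happens'[OF _ this] obtain B where B: "cdf D B > 1 - e/3" "cdf D (-B) < e/3"
    by (auto simp: trivial_limit_at_top_linorder)
  have lim: "(\<lambda>n. cdf (distr M borel (X n)) x) \<longlonglongrightarrow> cdf D x" for x
    using conv cont unfolding weak_conv_m_def weak_conv_def by blast
  have "\<forall>\<^sub>F n in sequentially. {\<omega>\<in>space M. \<bar>X (fst (n, \<omega>)) (snd (n, \<omega>))\<bar> > B} \<in> events \<and>
            prob {\<omega>\<in>space M. \<bar>X (fst (n, \<omega>)) (snd (n, \<omega>))\<bar> > B} \<le> e"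
    using order_tendstoD(1)[OF lim B(1)] order_tendstoD(2)[OF lim B(2)] eventually_ge_at_top[of 1]
  proof eventually_elim
    case (elim n)
    have [measurable]: "X n \<in> borel_measurable M" using meas elim by simp
    have c: "cdf (distr M borel (X n)) x = prob {\<omega>\<in>space M. X n \<omega> \<le> x}" for x
      by (simp add: cdf_def measure_distr vimage_def Int_def conj_commute)
    have "prob {\<omega>\<in>space M. \<bar>X n \<omega>\<bar> > B} \<le>
        prob ({\<omega>\<in>space M. X n \<omega> \<le> -B} \<union> (space M - {\<omega>\<in>space M. X n \<omega> \<le> B}))"
      by (intro finite_measure_mono) auto
    also have "\<dots> \<le> prob {\<omega>\<in>space M. X n \<omega> \<le> -B} + prob (space M - {\<omega>\<in>space M. X n \<omega> \<le> B})"
      by (intro measure_Un_le) auto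
    also have "\<dots> = prob {\<omega>\<in>space M. X n \<omega> \<le> -B} + (1 - prob {\<omega>\<in>space M. X n \<omega> \<le> B})"
      by (subst prob_compl) auto
    also have "\<dots> \<le> e" using elim \<open>e > 0\<close> unfolding c by simp
    finally show ?case by simp
  qed
  then show "\<exists>B. \<forall>\<^sub>F n in sequentially. {\<omega>\<in>space M. \<bar>X (fst (n, \<omega>)) (snd (n, \<omega>))\<bar> > B} \<in> events \<and>
            prob {\<omega>\<in>space M. \<bar>X (fst (n, \<omega>)) (snd (n, \<omega>))\<bar> > B} \<le> e" ..
qed

lemma (in prob_space) tendsto_in_probI:
  fixes X :: "nat \<Rightarrow> 'a \<Rightarrow> real"
  assumes "\<And>n. X n \<in> borel_measurable M"
    and "\<And>\<epsilon>. \<epsilon> > 0 \<Longrightarrow> (\<lambda>n. prob {\<omega>\<in>space M. \<epsilon> \<le> \<bar>X n \<omega>\<bar>}) \<longlonglongrightarrow> 0"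
  shows "((\<lambda>x. X (fst x) (snd x)) \<longlongrightarrow> 0) (in_prob M)"
proof -
  note [measurable] = assms(1)
  have mono: "prob {\<omega>\<in>space M. \<epsilon> < \<bar>X n \<omega>\<bar>} \<le> prob {\<omega>\<in>space M. \<epsilon> \<le> \<bar>X n \<omega>\<bar>}" for n \<epsilon>
  proof (rule finite_measure_mono)
    show "{\<omega>\<in>space M. \<epsilon> \<le> \<bar>X n \<omega>\<bar>} \<in> events"
      using assms(1)[of n] by measurable
  qed auto
  have "(\<lambda>n. prob {\<omega>\<in>space M. \<epsilon> < \<bar>X n \<omega>\<bar>}) \<longlonglongrightarrow> 0" if "\<epsilon> > 0" for \<epsilon>
    by (rule tendsto_sandwich[OF _ _ tendsto_const assms(2)[OF that]])
      (auto intro!: always_eventually mono)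
  then have "tendsto_zero_in_prob M X" using assms(1) by (simp add: tendsto_zero_in_prob_def)
  then show ?thesis using tendsto_zero_in_prob_iff by blast
qed

text \<open>The variance of the mean of \<open>n\<close> terms is a constant divided by \<open>n\<close>, as the mixed terms in the
  second moment of the centred sum vanish by independence.\<close>
lemma (in prob_space) weak_law_of_large_numbers:
  fixes X :: "nat \<Rightarrow> 'a \<Rightarrow> real"
  assumes indep: "indep_vars (\<lambda>_. borel) X UNIV"
    and sq: "\<And>i. integrable M (\<lambda>\<omega>. (X i \<omega>)\<^sup>2)"
    and mean: "\<And>i. expectation (X i) = c" and second: "\<And>i. expectation (\<lambda>\<omega>. (X i \<omega>)\<^sup>2) = v"
  shows "((\<lambda>x. (\<Sum>i<fst x. X i (snd x)) / real (fst x)) \<longlongrightarrow> c) (in_prob M)"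
proof -
  have [measurable]: "X i \<in> borel_measurable M" for i
    using indep by (auto simp: indep_vars_def)
  have int: "integrable M (X i)" for i
    by (rule square_integrable_imp_integrable[OF _ sq]) measurable
  define U where "U = (\<lambda>i \<omega>. X i \<omega> - c)"
  have [measurable]: "U i \<in> borel_measurable M" for i unfolding U_def by measurable
  have indepU: "indep_vars (\<lambda>_. borel) U UNIV"
    unfolding U_def by (rule indep_vars_compose2[OF indep, where Y = "\<lambda>_ x. x - c"]) measurable
  have Usq: "integrable M (\<lambda>\<omega>. (U i \<omega>)\<^sup>2)" for i
    unfolding U_def power2_diff using sq int by auto
  have Uint: "integrable M (U i)" for i
    unfolding U_def using int by auto
  have U0: "expectation (U i) = 0" for i
    unfolding U_def using int mean by (simp add: prob_space)
  have Uv: "expectation (\<lambda>\<omega>. (U i \<omega>)\<^sup>2) = v - c\<^sup>2" for i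
  proof -
    have "expectation (\<lambda>\<omega>. (U i \<omega>)\<^sup>2) = expectation (\<lambda>\<omega>. (X i \<omega>)\<^sup>2 - 2 * c * X i \<omega> + c\<^sup>2)"
      unfolding U_def by (intro Bochner_Integration.integral_cong) (auto simp: power2_eq_square algebra_simps)
    also have "\<dots> = v - 2 * c * c + c\<^sup>2"
      using sq int mean second by (simp add: prob_space)
    finally show ?thesis by (simp add: power2_eq_square)
  qed
  have prod: "integrable M (\<lambda>\<omega>. U i \<omega> * U j \<omega>) \<and> expectation (\<lambda>\<omega>. U i \<omega> * U j \<omega>) = (if i = j then v - c\<^sup>2 else 0)" for i j
  proof (cases "i = j")
    case True
    then show ?thesis using Uv Usq by (simp flip: power2_eq_square)
  next
    case False
    have "indep_vars (\<lambda>_. borel) U {i, j}" by (rule indep_vars_subset[OF indepU]) simp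
    from indep_vars_lebesgue_integral[OF _ this] indep_vars_integrable[OF _ this] Uint False U0
    show ?thesis by simp
  qed
  define V where "V = (\<lambda>n \<omega>. (\<Sum>i<n. U i \<omega>))"
  have [measurable]: "V n \<in> borel_measurable M" for n unfolding V_def by measurable
  have Vsq: "(V n \<omega>)\<^sup>2 = (\<Sum>i<n. \<Sum>j<n. U i \<omega> * U j \<omega>)" for n \<omega>
    by (simp add: V_def power2_eq_square sum_product)
  have Vint: "integrable M (\<lambda>\<omega>. (V n \<omega>)\<^sup>2)" for n
    unfolding Vsq using prod by (intro Bochner_Integration.integrable_sum) blast
  have EV: "expectation (\<lambda>\<omega>. (V n \<omega>)\<^sup>2) = real n * (v - c\<^sup>2)" for n
  proof -
    have "expectation (\<lambda>\<omega>. (V n \<omega>)\<^sup>2) = (\<Sum>i<n. \<Sum>j<n. expectation (\<lambda>\<omega>. U i \<omega> * U j \<omega>))"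
      unfolding Vsq using prod
      by (subst Bochner_Integration.integral_sum, intro Bochner_Integration.integrable_sum, blast)
        (intro sum.cong refl Bochner_Integration.integral_sum, blast)
    also have "\<dots> = (\<Sum>i<n. v - c\<^sup>2)"
    proof (rule sum.cong)
      fix i assume "i \<in> {..<n}"
      have "(\<Sum>j<n. expectation (\<lambda>\<omega>. U i \<omega> * U j \<omega>)) = (\<Sum>j<n. if i = j then v - c\<^sup>2 else 0)"
        using prod by (intro sum.cong) blast+
      also have "\<dots> = v - c\<^sup>2" using \<open>i \<in> {..<n}\<close> by simp
      finally show "(\<Sum>j<n. expectation (\<lambda>\<omega>. U i \<omega> * U j \<omega>)) = v - c\<^sup>2" .
    qed simp
    finally show ?thesis by simp
  qed
  have "((\<lambda>x. V (fst x) (snd x) / real (fst x)) \<longlongrightarrow> 0) (in_prob M)"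
  proof (rule tendsto_in_probI[of "\<lambda>n \<omega>. V n \<omega> / real n"])
    show "(\<lambda>\<omega>. V n \<omega> / real n) \<in> borel_measurable M" for n by measurable
    fix \<epsilon> :: real assume \<epsilon>: "\<epsilon> > 0"
    show "(\<lambda>n. prob {\<omega>\<in>space M. \<epsilon> \<le> \<bar>V n \<omega> / real n\<bar>}) \<longlonglongrightarrow> 0"
    proof (rule tendsto_sandwich[OF _ _ tendsto_const])
      show "(\<lambda>n. (v - c\<^sup>2) / \<epsilon>\<^sup>2 * inverse (real n)) \<longlonglongrightarrow> 0"
        by (rule tendsto_mult_right_zero[OF LIMSEQ_inverse_real_of_nat[THEN LIMSEQ_offset[of _ 1, simplified]]]) 
      show "\<forall>\<^sub>F n in sequentially. prob {\<omega>\<in>space M. \<epsilon> \<le> \<bar>V n \<omega> / real n\<bar>} \<le> (v - c\<^sup>2) / \<epsilon>\<^sup>2 * inverse (real n)"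
        using eventually_gt_at_top[of 0]
      proof eventually_elim
        case (elim n)
        have "{\<omega>\<in>space M. \<epsilon> \<le> \<bar>V n \<omega> / real n\<bar>} = {\<omega>\<in>space M. (\<epsilon> * real n)\<^sup>2 \<le> (V n \<omega>)\<^sup>2}"
          unfolding abs_le_square_iff[symmetric] using elim \<epsilon> by (simp add: field_simps abs_mult)
        moreover have "prob {\<omega>\<in>space M. (\<epsilon> * real n)\<^sup>2 \<le> (V n \<omega>)\<^sup>2} \<le> expectation (\<lambda>\<omega>. (V n \<omega>)\<^sup>2) / (\<epsilon> * real n)\<^sup>2"
          using elim \<epsilon> by (intro integral_Markov_inequality_measure[OF Vint sets.top]) auto
        moreover have "real n * (v - c\<^sup>2) / (\<epsilon> * real n)\<^sup>2 = (v - c\<^sup>2) / \<epsilon>\<^sup>2 * inverse (real n)"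
          using elim \<epsilon> by (simp add: power_mult_distrib power2_eq_square[of "real n"] field_simps)
        ultimately show ?case by (simp only: EV)
      qed
    qed simp
  qed
  then have "((\<lambda>x. V (fst x) (snd x) / real (fst x) + c) \<longlongrightarrow> 0 + c) (in_prob M)"
    by (intro tendsto_add tendsto_const)
  moreover have "\<forall>\<^sub>F x in in_prob M. V (fst x) (snd x) / real (fst x) + c = (\<Sum>i<fst x. X i (snd x)) / real (fst x)"
    using eventually_fst_in_prob[OF eventually_gt_at_top[of 0]]
  proof eventually_elim
    case (elim x)
    then show ?case by (simp add: V_def U_def sum_subtractf diff_divide_distrib)
  qed
  ultimately show ?thesis by (simp add: tendsto_cong)
qed

text \<open>Why the preliminary estimator is discretized.  A statement \<open>Q n c\<close> with probability close to
  one for each fixed \<open>c\<close> at distance \<open>O(n\<^sup>-\<^sup>1\<^sup>/\<^sup>2)\<close> from \<open>\<theta>\<close> may fail for a random \<open>c\<close>.  If \<open>c\<close> takes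
  values in a grid of step \<open>n\<^sup>-\<^sup>1\<^sup>/\<^sup>2\<close>, only boundedly many values matter, and the exceptional
  probabilities can be added up.\<close>
lemma (in prob_space) eventually_in_prob_grid:
  fixes g :: "nat \<Rightarrow> 'a \<Rightarrow> real" and a :: "nat \<Rightarrow> real"
  assumes bdd: "bounded_in_prob M (\<lambda>x. sqrt (real (fst x)) * (g (fst x) (snd x) - \<theta>))"
    and grid: "\<And>n \<omega>. \<exists>k::int. g n \<omega> = a n + (real_of_int k + 1 / 2) / sqrt (real n)"
    and Q: "\<And>B e. B > 0 \<Longrightarrow> e > 0 \<Longrightarrow> \<forall>\<^sub>F n in sequentially. \<forall>c. \<bar>c - \<theta>\<bar> \<le> B / sqrt (real n) \<longrightarrow>
              (\<exists>A\<in>events. prob (space M - A) \<le> e \<and> (\<forall>\<omega>\<in>A. Q n c \<omega>))"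
  shows "\<forall>\<^sub>F x in in_prob M. Q (fst x) (g (fst x) (snd x)) (snd x)"
  unfolding eventually_in_prob
proof (intro allI impI)
  fix e :: real assume e: "e > 0"
  then have e2: "e / 2 > 0" by simp
  from bdd[unfolded bounded_in_prob_def, rule_format, OF e2] obtain B0 where
    "\<forall>\<^sub>F n in sequentially. \<exists>A\<in>events. prob (space M - A) \<le> e / 2 \<and>
       (\<forall>\<omega>\<in>A. \<bar>sqrt (real (fst (n, \<omega>))) * (g (fst (n, \<omega>)) (snd (n, \<omega>)) - \<theta>)\<bar> \<le> B0)" ..
  then have B0: "\<forall>\<^sub>F n in sequentially. \<exists>A\<in>events. prob (space M - A) \<le> e / 2 \<and>
       (\<forall>\<omega>\<in>A. \<bar>sqrt (real n) * (g n \<omega> - \<theta>)\<bar> \<le> B0)" by simp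
  define B where "B = max B0 1"
  \<comment> \<open>At most \<open>2 B + 1\<close> grid points lie within \<open>B\<close> steps of \<open>\<theta>\<close>.\<close>
  define K where "K = 2 * B + 1"
  have B: "B > 0" and K: "K > 0" by (auto simp: B_def K_def)
  have eK: "e / (2 * K) > 0" using e K by simp
  from B0 Q[OF B eK] eventually_gt_at_top[of 0]
  show "\<forall>\<^sub>F n in sequentially. \<exists>A\<in>events. prob (space M - A) \<le> e \<and>
      (\<forall>\<omega>\<in>A. Q (fst (n, \<omega>)) (g (fst (n, \<omega>)) (snd (n, \<omega>))) (snd (n, \<omega>)))"
  proof eventually_elim
    case (elim n)
    then have r: "sqrt (real n) > 0" by simp
    define pt where "pt = (\<lambda>k::int. a n + (real_of_int k + 1 / 2) / sqrt (real n))"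
    define S where "S = {k. \<bar>pt k - \<theta>\<bar> \<le> B / sqrt (real n)}"
    \<comment> \<open>\<open>u\<close> is the real index at which the grid would hit \<open>\<theta>\<close>.\<close>
    define u where "u = (\<theta> - a n) * sqrt (real n) - 1 / 2"
    have sub: "S \<subseteq> {\<lceil>u - B\<rceil>..\<lfloor>u + B\<rfloor>}"
    proof
      fix k assume "k \<in> S"
      then have "\<bar>pt k - \<theta>\<bar> * sqrt (real n) \<le> B / sqrt (real n) * sqrt (real n)"
        unfolding S_def using r by (intro mult_right_mono) auto
      also have "\<bar>pt k - \<theta>\<bar> * sqrt (real n) = \<bar>(pt k - \<theta>) * sqrt (real n)\<bar>"
        using r by (simp add: abs_mult)
      also have "(pt k - \<theta>) * sqrt (real n) = real_of_int k - u"
      proof -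
        have "(a n + x / sqrt (real n) - \<theta>) * sqrt (real n) = x - (\<theta> - a n) * sqrt (real n)" for x
          using r by (simp add: algebra_simps)
        then show ?thesis unfolding pt_def u_def by simp
      qed
      finally have "\<bar>real_of_int k - u\<bar> \<le> B" using r by simp
      then show "k \<in> {\<lceil>u - B\<rceil>..\<lfloor>u + B\<rfloor>}" by (auto simp: ceiling_le_iff le_floor_iff)
    qed
    then have fin: "finite S" by (rule finite_subset) simp
    have "real (card S) \<le> real (card {\<lceil>u - B\<rceil>..\<lfloor>u + B\<rfloor>})"
      using sub by (intro of_nat_mono card_mono) auto
    also have "\<dots> \<le> K" using B unfolding K_def by (simp, linarith)
    finally have card: "real (card S) \<le> K" .
    have "\<forall>k\<in>S. \<exists>A\<in>events. prob (space M - A) \<le> e / (2 * K) \<and> (\<forall>\<omega>\<in>A. Q n (pt k) \<omega>)"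
      using elim(2) by (auto simp: S_def)
    then obtain A where A: "\<And>k. k \<in> S \<Longrightarrow> A k \<in> events" "\<And>k. k \<in> S \<Longrightarrow> prob (space M - A k) \<le> e / (2 * K)"
      "\<And>k \<omega>. k \<in> S \<Longrightarrow> \<omega> \<in> A k \<Longrightarrow> Q n (pt k) \<omega>"
      unfolding Bex_def by (metis bchoice)
    obtain A0 where A0: "A0 \<in> events" "prob (space M - A0) \<le> e / 2"
        "\<And>\<omega>. \<omega> \<in> A0 \<Longrightarrow> \<bar>sqrt (real n) * (g n \<omega> - \<theta>)\<bar> \<le> B0"
      using elim(1) by blast
    define E where "E = A0 - (\<Union>k\<in>S. space M - A k)"
    have E: "E \<in> events" unfolding E_def using A0 A fin by (intro sets.Diff sets.finite_UN) auto
    have "prob (space M - E) \<le> prob ((space M - A0) \<union> (\<Union>k\<in>S. space M - A k))"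
      using A0 A fin by (intro finite_measure_mono sets.Un sets.finite_UN) (auto simp: E_def)
    also have "\<dots> \<le> prob (space M - A0) + prob (\<Union>k\<in>S. space M - A k)"
      using A0 A fin by (intro measure_Un_le sets.finite_UN) auto
    also have "prob (\<Union>k\<in>S. space M - A k) \<le> (\<Sum>k\<in>S. prob (space M - A k))"
      using A fin by (intro measure_UNION_le) auto
    also have "(\<Sum>k\<in>S. prob (space M - A k)) \<le> (\<Sum>k\<in>S. e / (2 * K))"
      using A by (intro sum_mono) auto
    also have "(\<Sum>k\<in>S. e / (2 * K)) = real (card S) * (e / (2 * K))" by simp
    also have "\<dots> \<le> K * (e / (2 * K))" using card eK by (intro mult_right_mono) auto
    also have "\<dots> = e / 2" using K by simp
    finally have PE: "prob (space M - E) \<le> e" using A0(2) by simp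
    have "Q n (g n \<omega>) \<omega>" if \<omega>: "\<omega> \<in> E" for \<omega>
    proof -
      obtain k where k: "g n \<omega> = pt k" using grid[of n \<omega>] by (auto simp: pt_def)
      have "\<bar>sqrt (real n) * (g n \<omega> - \<theta>)\<bar> \<le> B"
        using A0(3)[of \<omega>] \<omega> by (auto simp: E_def B_def)
      then have "\<bar>pt k - \<theta>\<bar> \<le> B / sqrt (real n)"
        unfolding k using r by (simp add: abs_mult pos_le_divide_eq mult.commute)
      then have "k \<in> S" by (simp add: S_def)
      moreover have "\<omega> \<in> A k"
        using \<omega> \<open>k \<in> S\<close> sets.sets_into_space[OF A0(1)] by (auto simp: E_def)
      ultimately show ?thesis using A(3) k by simp
    qed
    with E PE show ?case by (intro bexI[of _ E]) auto
  qed
qed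

section \<open>Normal limits and tightness\<close>

lemma real_distribution_normal: "real_distribution (density lborel (normal_density 0 \<sigma>))" if "\<sigma> > 0"
  using prob_space_normal_density[OF that, of 0]
  by (auto simp: real_distribution_def real_distribution_axioms_def)

lemma isCont_cdf_normal:
  assumes "\<sigma> > 0" shows "isCont (cdf (density lborel (normal_density 0 \<sigma>))) x"
proof -
  interpret real_distribution "density lborel (normal_density 0 \<sigma>)"
    using real_distribution_normal[OF assms] .
  have "emeasure (density lborel (normal_density 0 \<sigma>)) {x} = 0"
  proof (subst emeasure_density)
    have "AE y in lborel. ennreal (normal_density 0 \<sigma> y) * indicator {x} y = 0"
      using AE_lborel_singleton[of x] by eventually_elim (auto simp: indicator_def)
    then show "(\<integral>\<^sup>+ y. ennreal (normal_density 0 \<sigma> y) * indicator {x} y \<partial>lborel) = 0"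
      by (subst nn_integral_0_iff_AE) auto
  qed auto
  then show ?thesis by (simp add: isCont_cdf measure_def)
qed

text \<open>The centred normal law with standard deviation \<open>\<sigma>\<close> is the image of the standard one under
  multiplication by \<open>\<sigma>\<close>.\<close>
lemma char_normal:
  assumes "\<sigma> > 0"
  shows "char (density lborel (normal_density 0 \<sigma>)) t = char std_normal_distribution (\<sigma> * t)"
proof -
  interpret S: real_distribution std_normal_distribution by (rule real_dist_normal_dist)
  have "distributed std_normal_distribution lborel (\<lambda>x. x) (\<lambda>x. ennreal (std_normal_density x))"
    by (auto simp: distributed_def distr_id2)
  from S.normal_density_affine[OF this, of \<sigma> 0] assms
  have "distr std_normal_distribution lborel (\<lambda>x. \<sigma> * x) = density lborel (normal_density 0 \<sigma>)"
    by (simp add: distributed_def)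
  then have "char (density lborel (normal_density 0 \<sigma>)) t = char (distr std_normal_distribution lborel (\<lambda>x. \<sigma> * x)) t"
    by simp
  also have "\<dots> = char std_normal_distribution (\<sigma> * t)"
    unfolding char_def by (subst integral_distr) (auto simp: ac_simps)
  finally show ?thesis .
qed

lemma norm_iexp_diff_le: "cmod (iexp a - iexp b) \<le> \<bar>a - b\<bar>"
proof -
  have "iexp a - iexp b = iexp b * (iexp (a - b) - 1)"
    by (simp add: algebra_simps flip: exp_add)
  then have "cmod (iexp a - iexp b) = cmod (iexp (a - b) - 1)"
    by (simp add: norm_mult)
  also have "\<dots> \<le> \<bar>a - b\<bar>" using iexp_approx1[of "a - b" 0] by simp
  finally show ?thesis .
qed

text \<open>Characteristic functions are Lipschitz in the random variable, and bounded.  Hence a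
  perturbation that tends to zero in probability does not change their limit, and Levy's
  continuity theorem applies.\<close>
lemma (in prob_space) slutsky_normal:
  assumes [measurable]: "\<And>n. X n \<in> borel_measurable M" "\<And>n. Z n \<in> borel_measurable M"
    and Z: "weak_conv_m (\<lambda>n. distr M borel (Z n)) std_normal_distribution"
    and \<sigma>: "\<sigma> > 0"
    and XZ: "((\<lambda>x. X (fst x) (snd x) - \<sigma> * Z (fst x) (snd x)) \<longlongrightarrow> 0) (in_prob M)"
  shows "weak_conv_m (\<lambda>n. distr M borel (X n)) (density lborel (normal_density 0 \<sigma>))"
proof (rule levy_continuity)
  show "real_distribution (distr M borel (X n))" for n by (rule real_distribution_distr) measurable
  show "real_distribution (density lborel (normal_density 0 \<sigma>))" by (rule real_distribution_normal[OF \<sigma>])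
  fix t
  have char: "char (distr M borel W) u = (CLINT \<omega>|M. iexp (u * W \<omega>))"
    if "W \<in> borel_measurable M" for W u
    unfolding char_def using that by (subst integral_distr) auto
  have int: "integrable M (\<lambda>\<omega>. iexp (u * W \<omega>))" if [measurable]: "W \<in> borel_measurable M" for W :: "'a \<Rightarrow> real" and u
    by (rule integrable_const_bound[of _ 1]) auto
  have "(\<lambda>n. char (distr M borel (Z n)) (\<sigma> * t)) \<longlonglongrightarrow> char std_normal_distribution (\<sigma> * t)"
    by (rule levy_continuity1[OF _ real_dist_normal_dist Z]) (rule real_distribution_distr, measurable)
  moreover have "(\<lambda>n. char (distr M borel (X n)) t - char (distr M borel (Z n)) (\<sigma> * t)) \<longlonglongrightarrow> 0"
  proof (rule tendstoI)
    fix e :: real assume "e > 0"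
    define r where "r = e / 4"
    have r: "r > 0" using \<open>e > 0\<close> by (simp add: r_def)
    then have "r / (\<bar>t\<bar> + 1) > 0" by simp
    from tendstoD[OF XZ this, unfolded eventually_in_prob, rule_format, OF r]
    show "\<forall>\<^sub>F n in sequentially. dist (char (distr M borel (X n)) t - char (distr M borel (Z n)) (\<sigma> * t)) 0 < e"
    proof eventually_elim
      case (elim n)
      then obtain A where A: "A \<in> events" "prob (space M - A) \<le> r"
        "\<And>\<omega>. \<omega> \<in> A \<Longrightarrow> dist (X n \<omega> - \<sigma> * Z n \<omega>) 0 < r / (\<bar>t\<bar> + 1)" by auto
      have ind: "integrable M (\<lambda>\<omega>. indicator (space M - A) \<omega> :: real)"
      proof (rule integrable_const_bound[of _ 1])
        show "indicator (space M - A) \<in> borel_measurable M"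
          by (rule borel_measurable_indicator) (rule sets.compl_sets[OF A(1)])
      qed (simp add: indicator_def)
      have "char (distr M borel (X n)) t - char (distr M borel (Z n)) (\<sigma> * t)
          = (CLINT \<omega>|M. iexp (t * X n \<omega>) - iexp (\<sigma> * t * Z n \<omega>))"
        unfolding char[OF assms(1)] char[OF assms(2)]
        by (rule Bochner_Integration.integral_diff[symmetric]) (rule int, measurable)+
      also have "cmod \<dots> \<le> (LINT \<omega>|M. cmod (iexp (t * X n \<omega>) - iexp (\<sigma> * t * Z n \<omega>)))"
        by (rule integral_norm_bound)
      also have "\<dots> \<le> (LINT \<omega>|M. r + 2 * indicator (space M - A) \<omega>)"
      proof (rule integral_mono)
        show "integrable M (\<lambda>\<omega>. cmod (iexp (t * X n \<omega>) - iexp (\<sigma> * t * Z n \<omega>)))"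
          by (intro integrable_norm Bochner_Integration.integrable_diff int assms(1,2))
        show "integrable M (\<lambda>\<omega>. r + 2 * indicator (space M - A) \<omega>)"
          by (intro Bochner_Integration.integrable_add integrable_const integrable_mult_right ind)
        fix \<omega> assume \<omega>: "\<omega> \<in> space M"
        show "cmod (iexp (t * X n \<omega>) - iexp (\<sigma> * t * Z n \<omega>)) \<le> r + 2 * indicator (space M - A) \<omega>"
        proof (cases "\<omega> \<in> A")
          case True
          have "cmod (iexp (t * X n \<omega>) - iexp (\<sigma> * t * Z n \<omega>)) \<le> \<bar>t * X n \<omega> - \<sigma> * t * Z n \<omega>\<bar>"
            by (rule norm_iexp_diff_le)
          also have "\<dots> = \<bar>t\<bar> * \<bar>X n \<omega> - \<sigma> * Z n \<omega>\<bar>"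
            by (simp add: abs_mult[symmetric] algebra_simps)
          also have "\<dots> \<le> (\<bar>t\<bar> + 1) * (r / (\<bar>t\<bar> + 1))"
            using A(3)[OF True] by (intro mult_mono) (auto simp: dist_real_def)
          finally show ?thesis using True by simp
        next
          case False
          have "cmod (iexp (t * X n \<omega>) - iexp (\<sigma> * t * Z n \<omega>)) \<le> cmod (iexp (t * X n \<omega>)) + cmod (iexp (\<sigma> * t * Z n \<omega>))"
            by (rule norm_triangle_ineq4)
          then show ?thesis using False \<omega> r by (simp add: norm_exp_i_times)
        qed
      qed
      also have "\<dots> = r + 2 * prob (space M - A)"
      proof -
        have "(space M - A) \<inter> space M = space M - A" by blast
        then have "(LINT \<omega>|M. indicator (space M - A) \<omega> :: real) = prob (space M - A)"
          by (simp only: Bochner_Integration.integral_indicator)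
        then have "(LINT \<omega>|M. 2 * (indicator (space M - A) \<omega> :: real)) = 2 * prob (space M - A)"
          by (simp only: integral_mult_right_zero)
        moreover have "(LINT \<omega>|M. r) = r" by (simp only: lebesgue_integral_const prob_space scaleR_one)
        moreover have "(LINT \<omega>|M. r + 2 * indicator (space M - A) \<omega>)
          = (LINT \<omega>|M. r) + (LINT \<omega>|M. 2 * indicator (space M - A) \<omega>)"
          by (intro Bochner_Integration.integral_add integrable_const integrable_mult_right ind)
        ultimately show ?thesis by (simp only:)
      qed
      also have "\<dots> < e" using A(2) r by (simp add: r_def)
      finally show ?case by (simp add: dist_norm)
    qed
  qed
  ultimately have "(\<lambda>n. (char (distr M borel (X n)) t - char (distr M borel (Z n)) (\<sigma> * t)) + char (distr M borel (Z n)) (\<sigma> * t))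
      \<longlonglongrightarrow> 0 + char std_normal_distribution (\<sigma> * t)"
    by (intro tendsto_add)
  then show "(\<lambda>n. char (distr M borel (X n)) t) \<longlonglongrightarrow> char (density lborel (normal_density 0 \<sigma>)) t"
    unfolding char_normal[OF \<sigma>, of t] by (simp only: diff_add_cancel add_0)
qed

text \<open>Markov's inequality.\<close>
lemma (in prob_space) bounded_in_prob_of_expectation:
  fixes X :: "nat \<Rightarrow> 'a \<Rightarrow> real"
  assumes int: "\<And>n. integrable M (X n)" and le: "\<And>n. expectation (\<lambda>\<omega>. \<bar>X n \<omega>\<bar>) \<le> C"
  shows "bounded_in_prob M (\<lambda>x. X (fst x) (snd x))"
proof (rule bounded_in_prob_tail)
  fix e :: real assume e: "e > 0"
  define B where "B = (\<bar>C\<bar> + 1) / e"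
  have B: "B > 0" using e by (simp add: B_def)
  have "{\<omega>\<in>space M. \<bar>X n \<omega>\<bar> > B} \<in> events \<and> prob {\<omega>\<in>space M. \<bar>X n \<omega>\<bar> > B} \<le> e" for n
  proof
    have [measurable]: "X n \<in> borel_measurable M" using int by auto
    show "{\<omega>\<in>space M. \<bar>X n \<omega>\<bar> > B} \<in> events" by measurable
    have ev: "{\<omega>\<in>space M. \<bar>X n \<omega>\<bar> \<ge> B} \<in> events" by measurable
    have "prob {\<omega>\<in>space M. \<bar>X n \<omega>\<bar> > B} \<le> prob {\<omega>\<in>space M. \<bar>X n \<omega>\<bar> \<ge> B}"
      by (rule finite_measure_mono[OF _ ev]) auto
    also have "\<dots> \<le> expectation (\<lambda>\<omega>. \<bar>X n \<omega>\<bar>) / B"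
      using B int by (intro integral_Markov_inequality_measure[OF _ sets.top]) auto
    also have "\<dots> \<le> e"
    proof -
      have "e * B = \<bar>C\<bar> + 1" using e by (simp add: B_def)
      with le[of n] show ?thesis using B by (simp add: pos_divide_le_eq)
    qed
    finally show "prob {\<omega>\<in>space M. \<bar>X n \<omega>\<bar> > B} \<le> e" .
  qed
  then show "\<exists>B. \<forall>\<^sub>F n in sequentially. {\<omega>\<in>space M. \<bar>X (fst (n, \<omega>)) (snd (n, \<omega>))\<bar> > B} \<in> events \<and>
            prob {\<omega>\<in>space M. \<bar>X (fst (n, \<omega>)) (snd (n, \<omega>))\<bar> > B} \<le> e"
    by (intro exI[of _ B] always_eventually) simp
qed

section \<open>Truncated expansion of the logarithm\<close>

text \<open>The difference of \<open>ln (1 + x)\<close> and its Taylor polynomial has derivative \<open>- x\<^sup>3 / (1 + x)\<close>, so it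
  has its maximum at \<open>0\<close>; adding \<open>x\<^sup>4 / 2\<close> makes the derivative \<open>x\<^sup>3 (1 + 2 x) / (1 + x)\<close>, and \<open>0\<close> becomes
  the minimum on \<open>x \<ge> - 1 / 2\<close>.\<close>
lemma ln_one_plus_cubic_bound:
  fixes x :: real
  assumes x: "\<bar>x\<bar> \<le> 1/2"
  shows "\<bar>ln (1 + x) - (x - x\<^sup>2 / 2 + x ^ 3 / 3)\<bar> \<le> x ^ 4 / 2"
proof -
  define f where "f = (\<lambda>x::real. ln (1 + x) - (x - x\<^sup>2 / 2 + x ^ 3 / 3))"
  have f': "(f has_real_derivative - (t ^ 3) / (1 + t)) (at t)" if "t > -1" for t
    unfolding f_def using that
    by (auto intro!: derivative_eq_intros simp: field_simps) algebra
  define g where "g = (\<lambda>x. f x + x ^ 4 / 2)"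
  have g': "(g has_real_derivative (t ^ 3 * (1 + 2 * t) / (1 + t))) (at t)" if "t > -1" for t
    unfolding g_def using that
    by (auto intro!: derivative_eq_intros f' simp: field_simps)
  have f0: "f 0 = 0" "g 0 = 0" by (simp_all add: f_def g_def)
  have "f x \<le> 0 \<and> g x \<ge> 0"
  proof (cases "x \<ge> 0")
    case True
    have "f x \<le> f 0"
    proof (rule DERIV_nonpos_imp_nonincreasing[OF True])
      fix t assume "0 \<le> t" "t \<le> x"
      then show "\<exists>y. (f has_real_derivative y) (at t) \<and> y \<le> 0"
        by (intro exI[of _ "- (t ^ 3) / (1 + t)"] conjI f') (auto intro!: divide_nonpos_nonneg)
    qed
    moreover have "g 0 \<le> g x"
    proof (rule DERIV_nonneg_imp_nondecreasing[OF True])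
      fix t assume "0 \<le> t" "t \<le> x"
      then show "\<exists>y. (g has_real_derivative y) (at t) \<and> 0 \<le> y"
        by (intro exI[of _ "t ^ 3 * (1 + 2 * t) / (1 + t)"] conjI g') auto
    qed
    ultimately show ?thesis using f0 by simp
  next
    case False
    have sgn: "t ^ 3 \<le> 0" if "t \<le> 0" for t :: real
      using that by (simp add: power_le_zero_eq)
    have "f x \<le> f 0"
    proof (rule DERIV_nonneg_imp_nondecreasing[where f = f and a = x and b = 0])
      show "x \<le> 0" using False by simp
      fix t assume "x \<le> t" "t \<le> 0"
      then show "\<exists>y. (f has_real_derivative y) (at t) \<and> 0 \<le> y"
        using x sgn[of t] by (intro exI[of _ "- (t ^ 3) / (1 + t)"] conjI f') (auto intro!: divide_nonpos_nonneg)
    qed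
    moreover have "g x \<ge> g 0"
    proof (rule DERIV_nonpos_imp_nonincreasing[where f = g and a = x and b = 0])
      show "x \<le> 0" using False by simp
      fix t assume t: "x \<le> t" "t \<le> 0"
      then have "t ^ 3 * (1 + 2 * t) / (1 + t) \<le> 0"
        using x sgn[of t] by (intro divide_nonpos_nonneg mult_nonpos_nonneg) auto
      then show "\<exists>y. (g has_real_derivative y) (at t) \<and> y \<le> 0"
        using t x by (intro exI[of _ "t ^ 3 * (1 + 2 * t) / (1 + t)"] conjI g') auto
    qed
    ultimately show ?thesis using f0 by simp
  qed
  then have "f x \<le> 0" "f x \<ge> - (x ^ 4 / 2)" by (auto simp: g_def)
  then have "\<bar>f x\<bar> \<le> x ^ 4 / 2" by linarith
  then show ?thesis by (simp add: f_def)
qed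

text \<open>Here \<open>a\<close>, \<open>b\<close>, \<open>e\<close> are the contributions of order \<open>h\<close>, \<open>h\<^sup>2\<close>, \<open>h\<^sup>3\<close> to a ratio of root
  densities and \<open>r\<close> is the remainder.  Only terms of order up to \<open>h\<^sup>3\<close> are kept.  The error bound
  contains \<open>r\<close> to the first power because only \<open>\<bar>r\<bar>\<close> has a mean of order \<open>o(h\<^sup>3)\<close>; the other terms
  in it are of order at least \<open>h\<^sup>4\<close> and integrable under the moment assumptions.\<close>
lemma two_ln_one_plus_truncation:
  fixes a b e r :: real
  assumes s: "\<bar>a\<bar> \<le> 1/8" "\<bar>b\<bar> \<le> 1/8" "\<bar>e\<bar> \<le> 1/8" "\<bar>r\<bar> \<le> 1/8"
  shows "\<bar>2 * ln (1 + (a + b + e + r)) - (2 * (a + b + e) - a\<^sup>2 - 2 * a * b + 2 * a ^ 3 / 3)\<bar>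
           \<le> 50 * (\<bar>r\<bar> + a ^ 4 + b\<^sup>2 + \<bar>a * e\<bar> + e\<^sup>2)"
proof -
  define X where "X = \<bar>r\<bar> + a ^ 4 + b\<^sup>2 + \<bar>a * e\<bar> + e\<^sup>2"
  define g where "g = b + e + r"
  have nn: "0 \<le> a ^ 4" "0 \<le> b\<^sup>2" "0 \<le> e\<^sup>2" by auto
  have part: "\<bar>r\<bar> + b\<^sup>2 + e\<^sup>2 \<le> X" "a ^ 4 + b\<^sup>2 + \<bar>a * e\<bar> + \<bar>r\<bar> \<le> X"
    using nn by (auto simp: X_def)
  have g: "\<bar>g\<bar> \<le> 3/8" using s unfolding g_def by linarith
  have rr: "r\<^sup>2 \<le> \<bar>r\<bar> / 8"
    using mult_left_mono[OF s(4), of "\<bar>r\<bar>"] by (simp add: power2_eq_square flip: abs_mult)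
  have ar: "\<bar>a * r\<bar> \<le> \<bar>r\<bar> / 8"
    using mult_right_mono[OF s(1), of "\<bar>r\<bar>"] by (simp add: abs_mult)
  have g2: "g\<^sup>2 \<le> 3 * X"
  proof -
    have "3 * (b\<^sup>2 + e\<^sup>2 + r\<^sup>2) - g\<^sup>2 = (b - e)\<^sup>2 + (b - r)\<^sup>2 + (e - r)\<^sup>2"
      by (simp add: g_def power2_eq_square algebra_simps)
    then have "g\<^sup>2 \<le> 3 * (b\<^sup>2 + e\<^sup>2 + r\<^sup>2)"
      using zero_le_power2[of "b - e"] zero_le_power2[of "b - r"] zero_le_power2[of "e - r"] by linarith
    also have "\<dots> \<le> 3 * X" using rr part(1) abs_ge_zero[of r] by argo
    finally show ?thesis .
  qed
  have a2g: "\<bar>a\<^sup>2 * g\<bar> \<le> X"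
  proof -
    have 1: "\<bar>a\<^sup>2 * g\<bar> \<le> a\<^sup>2 * \<bar>b\<bar> + \<bar>a\<bar> * \<bar>a * e\<bar> + \<bar>a\<bar> * \<bar>a * r\<bar>"
    proof -
      have "a\<^sup>2 * g = a\<^sup>2 * b + a * (a * e) + a * (a * r)"
        by (simp add: g_def power2_eq_square algebra_simps)
      then have "\<bar>a\<^sup>2 * g\<bar> \<le> \<bar>a\<^sup>2 * b\<bar> + \<bar>a * (a * e)\<bar> + \<bar>a * (a * r)\<bar>"
        by linarith
      then show ?thesis by (simp only: abs_mult[of "a\<^sup>2"] abs_mult[of a "a * e"] abs_mult[of a "a * r"] abs_power2)
    qed
    have 2: "a\<^sup>2 * \<bar>b\<bar> \<le> a ^ 4 + b\<^sup>2"
    proof -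
      have "0 \<le> (a\<^sup>2 - \<bar>b\<bar>)\<^sup>2" by simp
      then have "2 * (a\<^sup>2 * \<bar>b\<bar>) \<le> a ^ 4 + b\<^sup>2"
        by (simp add: power2_diff flip: power_mult)
      moreover have "0 \<le> a\<^sup>2 * \<bar>b\<bar>" by simp
      ultimately show ?thesis by linarith
    qed
    have 3: "\<bar>a\<bar> * \<bar>a * e\<bar> \<le> 1 * \<bar>a * e\<bar>" using s by (intro mult_right_mono) auto
    have 4: "\<bar>a\<bar> * \<bar>a * r\<bar> \<le> 1 * \<bar>a * r\<bar>" using s by (intro mult_right_mono) auto
    show ?thesis using 1 2 3 4 ar part(2) abs_ge_zero[of r] by argo
  qed
  have ag2: "\<bar>a * g\<^sup>2\<bar> \<le> 3 * X"
  proof -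
    have "\<bar>a * g\<^sup>2\<bar> \<le> 1 * g\<^sup>2" unfolding abs_mult using s by (intro mult_mono) auto
    with g2 show ?thesis by simp
  qed
  have g3: "\<bar>g ^ 3\<bar> \<le> 3 * X"
  proof -
    have "\<bar>g ^ 3\<bar> = \<bar>g\<bar> * g\<^sup>2" by (simp add: power3_eq_cube power2_eq_square abs_mult)
    also have "\<dots> \<le> 1 * g\<^sup>2" using g by (intro mult_right_mono) auto
    finally show ?thesis using g2 by simp
  qed
  have W4: "(a + g) ^ 4 \<le> 8 * X + 24 * X"
  proof -
    have "(a + g)\<^sup>2 \<le> 2 * (a\<^sup>2 + g\<^sup>2)"
      using zero_le_power2[of "a - g"] by (simp add: power2_sum power2_diff)
    then have "((a + g)\<^sup>2)\<^sup>2 \<le> (2 * (a\<^sup>2 + g\<^sup>2))\<^sup>2" by (intro power_mono) auto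
    also have "\<dots> \<le> 8 * (a ^ 4 + g ^ 4)"
      using zero_le_power2[of "a\<^sup>2 - g\<^sup>2"] by (simp add: power2_sum power2_diff power_mult_distrib flip: power_mult)
    also have "g ^ 4 \<le> 1 * g\<^sup>2"
    proof -
      have "g ^ 4 = g\<^sup>2 * g\<^sup>2" by (simp flip: power_add)
      also have "\<dots> \<le> 1 * g\<^sup>2" using g by (intro mult_right_mono) (auto simp: abs_square_le_1)
      finally show ?thesis .
    qed
    finally have "(a + g) ^ 4 \<le> 8 * (a ^ 4 + g\<^sup>2)" by (simp flip: power_mult)
    moreover have "a ^ 4 \<le> X" using nn by (simp add: X_def)
    ultimately show ?thesis using g2 by argo
  qed
  have L: "\<bar>ln (1 + (a + g)) - ((a + g) - (a + g)\<^sup>2 / 2 + (a + g) ^ 3 / 3)\<bar> \<le> (a + g) ^ 4 / 2"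
    using s g by (intro ln_one_plus_cubic_bound) linarith
  have eq: "(2 * (a + g) - (a + g)\<^sup>2 + 2 * (a + g) ^ 3 / 3) - (2 * (a + b + e) - a\<^sup>2 - 2 * a * b + 2 * a ^ 3 / 3)
     = 2 * r - 2 * (a * e) - 2 * (a * r) - g\<^sup>2 + 2 * (a\<^sup>2 * g) + 2 * (a * g\<^sup>2) + 2 / 3 * g ^ 3"
    by (simp add: g_def power2_eq_square power3_eq_cube field_simps)
  have X: "\<bar>r\<bar> \<le> X" "\<bar>a * e\<bar> \<le> X" using nn by (auto simp: X_def)
  have "\<bar>(2 * (a + g) - (a + g)\<^sup>2 + 2 * (a + g) ^ 3 / 3) - (2 * (a + b + e) - a\<^sup>2 - 2 * a * b + 2 * a ^ 3 / 3)\<bar>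
      \<le> 2 * X + 2 * X + X + 3 * X + 2 * X + 6 * X + 2 * X"
    unfolding eq using X ar g2 a2g ag2 g3 zero_le_power2[of g] by linarith
  moreover have "a + b + e + r = a + g" by (simp add: g_def)
  ultimately have "\<bar>2 * ln (1 + (a + b + e + r)) - (2 * (a + b + e) - a\<^sup>2 - 2 * a * b + 2 * a ^ 3 / 3)\<bar>
      \<le> 2 * ((a + g) ^ 4 / 2) + 18 * X"
    using L by (simp add: field_simps)
  also have "\<dots> \<le> 50 * X" using W4 by linarith
  finally show ?thesis by (simp add: X_def)
qed

section \<open>Square integrable functions\<close>

lemma L2_fun_measurable: "L2_fun \<mu> f \<Longrightarrow> f \<in> borel_measurable \<mu>"
  by (simp add: L2_fun_def)

lemma L2_fun_integrable_square: "L2_fun \<mu> f \<Longrightarrow> integrable \<mu> (\<lambda>y. (f y)\<^sup>2)"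
  by (simp add: L2_fun_def)

text \<open>From \<open>2 \<bar>f g\<bar> \<le> f\<^sup>2 + g\<^sup>2\<close>.\<close>
lemma L2_fun_integrable_mult:
  assumes f: "L2_fun \<mu> f" and g: "L2_fun \<mu> g"
  shows "integrable \<mu> (\<lambda>y. f y * g y)"
proof (rule Bochner_Integration.integrable_bound)
  show "integrable \<mu> (\<lambda>y. (f y)\<^sup>2 + (g y)\<^sup>2)"
    using f g by (auto simp: L2_fun_def)
  show "(\<lambda>y. f y * g y) \<in> borel_measurable \<mu>"
    using f g by (auto simp: L2_fun_def)
  show "AE y in \<mu>. norm (f y * g y) \<le> norm ((f y)\<^sup>2 + (g y)\<^sup>2)"
  proof (rule AE_I2)
    fix y
    have "0 \<le> (\<bar>f y\<bar> - \<bar>g y\<bar>)\<^sup>2" by simp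
    then have "2 * (\<bar>f y\<bar> * \<bar>g y\<bar>) \<le> (f y)\<^sup>2 + (g y)\<^sup>2" by (simp add: power2_diff)
    moreover have "0 \<le> \<bar>f y\<bar> * \<bar>g y\<bar>" by simp
    ultimately have "\<bar>f y\<bar> * \<bar>g y\<bar> \<le> (f y)\<^sup>2 + (g y)\<^sup>2" by linarith
    then show "norm (f y * g y) \<le> norm ((f y)\<^sup>2 + (g y)\<^sup>2)" by (simp add: abs_mult)
  qed
qed

lemma L2_fun_add:
  assumes f: "L2_fun \<mu> f" and g: "L2_fun \<mu> g"
  shows "L2_fun \<mu> (\<lambda>y. f y + g y)"
  using f g L2_fun_integrable_mult[OF f g] by (auto simp: L2_fun_def power2_sum mult.assoc)

lemma L2_fun_cmult:
  assumes f: "L2_fun \<mu> f" shows "L2_fun \<mu> (\<lambda>y. c * f y)"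
  using f by (auto simp: L2_fun_def power_mult_distrib)

lemma L2_fun_diff:
  assumes f: "L2_fun \<mu> f" and g: "L2_fun \<mu> g"
  shows "L2_fun \<mu> (\<lambda>y. f y - g y)"
  using L2_fun_add[OF f L2_fun_cmult[OF g, of "-1"]] by simp

section \<open>The root density at a fourth-order regular point\<close>

text \<open>Adding the bounds at \<open>h\<close> and \<open>- h\<close> isolates \<open>b\<close>, which is then bounded by \<open>C h\<close> for all small
  \<open>h\<close>; once \<open>b = 0\<close>, the same argument applies to \<open>a\<close>.\<close>
lemma polynomial_coeffs_zero_if_cubic_bound:
  fixes a b C \<eta> :: real
  assumes \<eta>: "\<eta> > 0" and bound: "\<And>h. \<bar>h\<bar> < \<eta> \<Longrightarrow> \<bar>a * h + b * h\<^sup>2\<bar> \<le> C * \<bar>h\<bar> ^ 3"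
  shows "a = 0" "b = 0"
proof -
  have small: "\<forall>\<^sub>F h in at_right 0. h < \<eta>" "\<forall>\<^sub>F h in at_right (0::real). h > 0"
    using \<eta> by (auto simp: eventually_at_right_less intro: eventually_at_right_real eventually_mono
        [OF eventually_at_right_real[OF \<eta>]])
  have b: "\<bar>b\<bar> \<le> 0"
  proof (rule tendsto_lowerbound)
    show "((\<lambda>h. C * h) \<longlongrightarrow> 0) (at_right 0)" by (auto intro!: tendsto_eq_intros)
    show "\<forall>\<^sub>F h in at_right 0. \<bar>b\<bar> \<le> C * h"
      using small
    proof eventually_elim
      case (elim h)
      have "\<bar>a * h + b * h\<^sup>2\<bar> \<le> C * h ^ 3" "\<bar>- a * h + b * h\<^sup>2\<bar> \<le> C * h ^ 3"
        using bound[of h] bound[of "-h"] elim by auto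
      then have "\<bar>b * h\<^sup>2\<bar> \<le> (C * h) * h\<^sup>2"
        by (simp add: power2_eq_square power3_eq_cube)
      then show ?case using elim by (simp add: abs_mult)
    qed
  qed simp
  then show "b = 0" by simp
  have "\<bar>a\<bar> \<le> 0"
  proof (rule tendsto_lowerbound)
    show "((\<lambda>h. C * h\<^sup>2) \<longlongrightarrow> 0) (at_right 0)" by (auto intro!: tendsto_eq_intros)
    show "\<forall>\<^sub>F h in at_right 0. \<bar>a\<bar> \<le> C * h\<^sup>2"
      using small
    proof eventually_elim
      case (elim h)
      have "\<bar>a * h\<bar> \<le> (C * h\<^sup>2) * h"
        using bound[of h] elim \<open>b = 0\<close> by (auto simp: power2_eq_square power3_eq_cube)
      then show ?case using elim by (simp add: abs_mult)
    qed
  qed simp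
  then show "a = 0" by simp
qed

locale regular_point =
  fixes \<mu> :: "'y measure" and \<Theta> :: "real set" and p :: "real \<Rightarrow> 'y \<Rightarrow> real"
    and sd :: "nat \<Rightarrow> real \<Rightarrow> 'y \<Rightarrow> real" and \<theta> :: real
  assumes regular: "regular_parametric_model \<mu> \<Theta> p sd"
    and fourth_order: "fourth_order_regularity \<mu> \<Theta> p sd"
    and \<theta>: "\<theta> \<in> \<Theta>"
begin

abbreviation "s \<equiv> root_density p \<theta>"
abbreviation "D \<equiv> model \<mu> p \<theta>"
abbreviation "I \<equiv> fisher_info \<mu> p sd \<theta>"
abbreviation "l \<equiv> \<lambda>k. score p sd k \<theta>"

lemma open_parameter_space: "open \<Theta>"
  using regular by (simp add: regular_parametric_model_def parametric_model_def)

lemma density_measurable: "\<theta>' \<in> \<Theta> \<Longrightarrow> p \<theta>' \<in> borel_measurable \<mu>"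
  and density_nonneg: "\<theta>' \<in> \<Theta> \<Longrightarrow> y \<in> space \<mu> \<Longrightarrow> 0 \<le> p \<theta>' y"
  and prob_space_model: "\<theta>' \<in> \<Theta> \<Longrightarrow> prob_space (model \<mu> p \<theta>')"
  using regular by (auto simp: regular_parametric_model_def parametric_model_def)

lemma root_density_L2:
  assumes "\<theta>' \<in> \<Theta>"
  shows "L2_fun \<mu> (root_density p \<theta>')" "(LINT y|\<mu>. (root_density p \<theta>' y)\<^sup>2) = 1"
proof -
  note [measurable] = density_measurable[OF assms]
  note nonneg = density_nonneg[OF assms]
  interpret prob_space "model \<mu> p \<theta>'" by (rule prob_space_model[OF assms])
  have "(\<integral>\<^sup>+y. ennreal (p \<theta>' y) \<partial>\<mu>) = 1"
    using emeasure_space_1 by (simp add: model_def emeasure_density cong: nn_integral_cong)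
  moreover have "(\<integral>\<^sup>+y. ennreal (p \<theta>' y) \<partial>\<mu>) = ennreal 1 \<longleftrightarrow>
      integrable \<mu> (p \<theta>') \<and> (LINT y|\<mu>. p \<theta>' y) = 1"
    by (rule nn_integral_eq_integrable) (auto simp: nonneg)
  ultimately have "integrable \<mu> (p \<theta>')" "(LINT y|\<mu>. p \<theta>' y) = 1"
    by simp_all
  moreover have "(root_density p \<theta>' y)\<^sup>2 = p \<theta>' y" if "y \<in> space \<mu>" for y
    using nonneg[OF that] by (simp add: root_density_def)
  ultimately show "L2_fun \<mu> (root_density p \<theta>')" "(LINT y|\<mu>. (root_density p \<theta>' y)\<^sup>2) = 1"
    by (auto simp: L2_fun_def root_density_def[abs_def] cong: Bochner_Integration.integrable_cong
        Bochner_Integration.integral_cong)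
qed

lemma sd_L2: "k \<in> {1..4} \<Longrightarrow> L2_fun \<mu> (sd k \<theta>)" and sd_0: "sd 0 \<theta> = s"
  using fourth_order \<theta> by (auto simp: fourth_order_regularity_def fourth_order_regular_point_def)

lemma s_L2: "L2_fun \<mu> s" and s_norm: "(LINT y|\<mu>. (s y)\<^sup>2) = 1"
  using root_density_L2[OF \<theta>] by auto

lemma s_nonneg: "y \<in> space \<mu> \<Longrightarrow> 0 \<le> s y"
  using density_nonneg[OF \<theta>] by (simp add: root_density_def)

lemma s_eq_0_iff: "y \<in> space \<mu> \<Longrightarrow> s y = 0 \<longleftrightarrow> \<not> 0 < s y"
  using s_nonneg[of y] by auto

lemma L2s: "L2_fun \<mu> s" "L2_fun \<mu> (sd 1 \<theta>)" "L2_fun \<mu> (sd 2 \<theta>)" "L2_fun \<mu> (sd 3 \<theta>)"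
  by (auto intro: s_L2 sd_L2)

lemmas [measurable] = density_measurable[OF \<theta>] L2s[THEN L2_fun_measurable]
  L2s[THEN L2_fun_measurable, simplified]

lemma sets_model [measurable_cong]: "sets D = sets \<mu>"
  by (simp add: model_def)

lemma space_model: "space D = space \<mu>"
  by (simp add: model_def)

lemma score_measurable [measurable]: "k \<in> {1..3} \<Longrightarrow> l k \<in> borel_measurable \<mu>"
proof -
  assume "k \<in> {1..3}"
  then have [measurable]: "sd k \<theta> \<in> borel_measurable \<mu>" by (intro L2_fun_measurable sd_L2) auto
  show "l k \<in> borel_measurable \<mu>" unfolding score_def[abs_def] by measurable
qed

text \<open>Integrals with respect to \<open>D\<close> are moved to \<open>\<mu>\<close> with weight \<open>s\<^sup>2\<close>, where the factor \<open>s\<close> cancels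
  against the denominators of the scores.\<close>
lemma integrable_model:
  assumes [measurable]: "f \<in> borel_measurable \<mu>"
  shows "integrable D f \<longleftrightarrow> integrable \<mu> (\<lambda>y. (s y)\<^sup>2 * f y)"
proof -
  have "integrable D f \<longleftrightarrow> integrable \<mu> (\<lambda>y. p \<theta> y * f y)"
    unfolding model_def using density_nonneg[OF \<theta>] by (subst integrable_density) auto
  also have "\<dots> \<longleftrightarrow> integrable \<mu> (\<lambda>y. (s y)\<^sup>2 * f y)"
    using density_nonneg[OF \<theta>] by (intro Bochner_Integration.integrable_cong) (auto simp: root_density_def)
  finally show ?thesis .
qed

lemma integral_model:
  fixes f :: "'y \<Rightarrow> real"
  assumes [measurable]: "f \<in> borel_measurable \<mu>"
  shows "(LINT y|D. f y) = (LINT y|\<mu>. (s y)\<^sup>2 * f y)"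
proof -
  have "(LINT y|D. f y) = (LINT y|\<mu>. p \<theta> y * f y)"
    unfolding model_def using density_nonneg[OF \<theta>] by (subst integral_density) auto
  also have "\<dots> = (LINT y|\<mu>. (s y)\<^sup>2 * f y)"
    using density_nonneg[OF \<theta>] by (intro Bochner_Integration.integral_cong) (auto simp: root_density_def)
  finally show ?thesis .
qed

lemma score_moments:
  "integrable D (\<lambda>y. \<bar>l 1 y\<bar> ^ 6)" "integrable D (\<lambda>y. \<bar>l 2 y\<bar> ^ 3)" "integrable D (\<lambda>y. (l 3 y)\<^sup>2)"
  using fourth_order \<theta> by (auto simp: fourth_order_regularity_def)

lemma integrable_model_bound:
  assumes "integrable D f" "g \<in> borel_measurable \<mu>" "\<And>y. \<bar>g y\<bar> \<le> f y"
  shows "integrable D (g :: 'y \<Rightarrow> real)"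
proof (rule Bochner_Integration.integrable_bound[OF assms(1)])
  show "g \<in> borel_measurable D" using assms(2) by (simp add: model_def)
  show "AE y in D. norm (g y) \<le> norm (f y)"
    using assms(3) by (intro AE_I2) (simp add: order_trans[OF assms(3) abs_ge_self])
qed

lemma integrable_model_const: "integrable D (\<lambda>y. c :: real)"
proof -
  interpret prob_space D by (rule prob_space_model[OF \<theta>])
  show ?thesis by simp
qed

text \<open>\<open>D\<close> has total mass one, so that lower powers are dominated by \<open>1\<close> plus higher ones.\<close>
lemma score_lower_moments:
  "integrable D (l 1)" "integrable D (\<lambda>y. (l 1 y)\<^sup>2)" "integrable D (\<lambda>y. (l 1 y) ^ 3)"
  "integrable D (\<lambda>y. (l 1 y) ^ 4)" "integrable D (l 2)" "integrable D (\<lambda>y. (l 2 y)\<^sup>2)" "integrable D (l 3)"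
proof -
  note c = integrable_model_const[of 1]
  have low: "\<bar>x\<bar> ^ i \<le> 1 + \<bar>x\<bar> ^ j" if "i \<le> j" for x :: real and i j
  proof (cases "\<bar>x\<bar> \<le> 1")
    case True
    then show ?thesis using power_le_one[of "\<bar>x\<bar>" i] by (simp add: add_increasing2)
  next
    case False
    then have "\<bar>x\<bar> ^ i \<le> \<bar>x\<bar> ^ j" using that by (intro power_increasing) auto
    then show ?thesis by simp
  qed
  have 1: "integrable D (\<lambda>y. (l 1 y) ^ i)" if "i \<le> 6" for i
    by (rule integrable_model_bound[OF Bochner_Integration.integrable_add[OF c score_moments(1)]])
      (measurable, auto simp only: power_abs intro!: low[OF that])
  show "integrable D (l 1)" "integrable D (\<lambda>y. (l 1 y)\<^sup>2)" "integrable D (\<lambda>y. (l 1 y) ^ 3)"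
    "integrable D (\<lambda>y. (l 1 y) ^ 4)"
    using 1[of 1] 1[of 2] 1[of 3] 1[of 4] by simp_all
  have 2: "integrable D (\<lambda>y. (l 2 y) ^ i)" if "i \<le> 3" for i
    by (rule integrable_model_bound[OF Bochner_Integration.integrable_add[OF c score_moments(2)]])
      (measurable, auto simp only: power_abs intro!: low[OF that])
  show "integrable D (l 2)" "integrable D (\<lambda>y. (l 2 y)\<^sup>2)"
    using 2[of 1] 2[of 2] by simp_all
  show "integrable D (l 3)"
    by (rule integrable_model_bound[OF Bochner_Integration.integrable_add[OF c score_moments(3)]])
      (auto intro!: low[of 1 2, simplified])
qed

lemma score_product_moments:
  "integrable D (\<lambda>y. l 1 y * l 2 y)" "integrable D (\<lambda>y. \<bar>l 1 y * l 3 y\<bar>)"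
proof -
  have am: "\<bar>u * v\<bar> \<le> u\<^sup>2 + v\<^sup>2" for u v :: real
  proof -
    have "0 \<le> (\<bar>u\<bar> - \<bar>v\<bar>)\<^sup>2" by simp
    then have "2 * \<bar>u * v\<bar> \<le> u\<^sup>2 + v\<^sup>2" by (simp add: power2_diff abs_mult)
    then show ?thesis using abs_ge_zero[of "u * v"] by linarith
  qed
  show "integrable D (\<lambda>y. l 1 y * l 2 y)"
    by (rule integrable_model_bound[OF Bochner_Integration.integrable_add[OF score_lower_moments(2,6)]])
      (auto intro: am)
  show "integrable D (\<lambda>y. \<bar>l 1 y * l 3 y\<bar>)"
    by (rule integrable_model_bound[OF Bochner_Integration.integrable_add[OF score_lower_moments(2) score_moments(3)]])
      (auto intro: am)
qed

text \<open>The Taylor polynomial of degree three of the root density.\<close>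
definition taylor :: "real \<Rightarrow> 'y \<Rightarrow> real" where
  "taylor h y = s y + h * sd 1 \<theta> y + h\<^sup>2 / 2 * sd 2 \<theta> y + h ^ 3 / 6 * sd 3 \<theta> y"

definition remainder :: "real \<Rightarrow> 'y \<Rightarrow> real" where
  "remainder h y = root_density p (\<theta> + h) y - taylor h y"

lemma taylor_L2: "L2_fun \<mu> (taylor h)"
  unfolding taylor_def by (intro L2_fun_add L2_fun_cmult L2s)

lemma remainder_L2: "\<theta> + h \<in> \<Theta> \<Longrightarrow> L2_fun \<mu> (remainder h)"
  unfolding remainder_def by (intro L2_fun_diff taylor_L2 root_density_L2)

lemma remainder_0: "remainder 0 y = 0"
  by (simp add: remainder_def taylor_def)

lemma eventually_in_parameter_space: "\<forall>\<^sub>F h in at 0. \<theta> + h \<in> \<Theta>"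
proof -
  have "((\<lambda>h. \<theta> + h) \<longlongrightarrow> \<theta>) (at 0)" by (auto intro!: tendsto_eq_intros)
  then show ?thesis using topological_tendstoD[OF _ open_parameter_space \<theta>] by blast
qed

text \<open>The regularity condition of order \<open>k = 3\<close> with \<open>t\<^sub>n = 1\<close>, read as a limit over \<open>h \<rightarrow> 0\<close>.\<close>
lemma remainder_tendsto: "((\<lambda>h. L2_norm \<mu> (remainder h) / \<bar>h\<bar> ^ 3) \<longlongrightarrow> 0) (at 0)"
  unfolding tendsto_at_iff_sequentially
proof (intro allI impI)
  fix X :: "nat \<Rightarrow> real" assume X0: "\<forall>i. X i \<in> UNIV - {0}" and X: "X \<longlonglongrightarrow> 0"
  have B: "Bseq (\<lambda>n. 1::real)" by (rule convergent_imp_Bseq) (rule convergent_const)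
  have "fourth_order_regular_point \<mu> \<Theta> p sd \<theta>"
    using fourth_order \<theta> by (simp add: fourth_order_regularity_def)
  then have "\<forall>\<delta> t :: nat \<Rightarrow> real. \<delta> \<longlonglongrightarrow> 0 \<and> (\<forall>n. \<delta> n \<noteq> 0) \<and> Bseq t \<longrightarrow>
       (\<forall>k\<in>{2..4}.
         (\<lambda>n. L2_norm \<mu> (\<lambda>y.
            (root_density p (\<theta> + \<delta> n * t n) y
              - (\<Sum>j<k. sd j \<theta> y * (\<delta> n * t n) ^ j / fact j)) / (\<delta> n) ^ k
            - sd k \<theta> y * (t n) ^ k / fact k)) \<longlonglongrightarrow> 0)"
    unfolding fourth_order_regular_point_def by (elim conjE)
  from this[rule_format, of X "\<lambda>_. 1" 3] X X0 B
  have lim: "(\<lambda>n. L2_norm \<mu> (\<lambda>y. (root_density p (\<theta> + X n * 1) y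
              - (\<Sum>j<3. sd j \<theta> y * (X n * 1) ^ j / fact j)) / (X n) ^ 3
            - sd 3 \<theta> y * 1 ^ 3 / fact 3)) \<longlonglongrightarrow> 0" by auto
  have eq: "L2_norm \<mu> (\<lambda>y. (root_density p (\<theta> + h * 1) y
              - (\<Sum>j<3. sd j \<theta> y * (h * 1) ^ j / fact j)) / h ^ 3
            - sd 3 \<theta> y * 1 ^ 3 / fact 3) = L2_norm \<mu> (remainder h) / \<bar>h\<bar> ^ 3" if "h \<noteq> 0" for h
  proof -
    have "((root_density p (\<theta> + h * 1) y - (\<Sum>j<3. sd j \<theta> y * (h * 1) ^ j / fact j)) / h ^ 3
            - sd 3 \<theta> y * 1 ^ 3 / fact 3) = remainder h y / h ^ 3" for y
    proof -
      have "(\<Sum>j<3. sd j \<theta> y * (h * 1) ^ j / fact j) = s y + sd 1 \<theta> y * h + sd 2 \<theta> y * h\<^sup>2 / 2"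
        by (simp add: numeral_3_eq_3 sd_0 fact_numeral) (simp add: numeral_2_eq_2)
      then show ?thesis using that
        by (simp add: remainder_def taylor_def fact_numeral field_simps)
    qed
    then have "L2_norm \<mu> (\<lambda>y. (root_density p (\<theta> + h * 1) y
              - (\<Sum>j<3. sd j \<theta> y * (h * 1) ^ j / fact j)) / h ^ 3
            - sd 3 \<theta> y * 1 ^ 3 / fact 3) = L2_norm \<mu> (\<lambda>y. remainder h y / h ^ 3)" by simp
    also have "\<dots> = sqrt ((LINT y|\<mu>. (remainder h y)\<^sup>2) / (h ^ 3)\<^sup>2)"
      by (simp add: L2_norm_def power_divide)
    also have "\<dots> = L2_norm \<mu> (remainder h) / \<bar>h\<bar> ^ 3"
      by (simp only: L2_norm_def real_sqrt_divide real_sqrt_abs power_abs)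
    finally show ?thesis .
  qed
  show "((\<lambda>h. L2_norm \<mu> (remainder h) / \<bar>h\<bar> ^ 3) \<circ> X) \<longlonglongrightarrow> 0"
    using lim X0 eq by (simp add: comp_def)
qed

lemma square_integral_le_of_L2_norm_le:
  assumes "L2_norm \<mu> f \<le> c" shows "(LINT y|\<mu>. (f y)\<^sup>2) \<le> c\<^sup>2"
proof -
  have nn: "0 \<le> (LINT y|\<mu>. (f y)\<^sup>2)" by (rule Bochner_Integration.integral_nonneg) simp
  then have "(LINT y|\<mu>. (f y)\<^sup>2) = (L2_norm \<mu> f)\<^sup>2" by (simp add: L2_norm_def)
  also have "\<dots> \<le> c\<^sup>2" using assms nn by (intro power_mono) (auto simp: L2_norm_def)
  finally show ?thesis .
qed

text \<open>The form of the Taylor formula used below: uniform over a neighbourhood of \<open>h = 0\<close>, and squared,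
  so that no norms of sums have to be estimated.\<close>
lemma remainder_small:
  assumes "\<kappa> > 0"
  shows "\<exists>\<eta>>0. \<forall>h. \<bar>h\<bar> < \<eta> \<longrightarrow> \<theta> + h \<in> \<Theta> \<and> (LINT y|\<mu>. (remainder h y)\<^sup>2) \<le> (\<kappa> * \<bar>h\<bar> ^ 3)\<^sup>2"
proof -
  have "\<forall>\<^sub>F h in at 0. \<theta> + h \<in> \<Theta> \<and> L2_norm \<mu> (remainder h) / \<bar>h\<bar> ^ 3 < \<kappa>"
    using eventually_in_parameter_space order_tendstoD(2)[OF remainder_tendsto assms]
    by (rule eventually_conj)
  then obtain \<eta> where \<eta>: "\<eta> > 0" "\<And>h. h \<noteq> 0 \<Longrightarrow> \<bar>h\<bar> < \<eta> \<Longrightarrow>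
      \<theta> + h \<in> \<Theta> \<and> L2_norm \<mu> (remainder h) / \<bar>h\<bar> ^ 3 < \<kappa>"
    unfolding eventually_at by (auto simp: dist_real_def)
  have "\<theta> + h \<in> \<Theta> \<and> (LINT y|\<mu>. (remainder h y)\<^sup>2) \<le> (\<kappa> * \<bar>h\<bar> ^ 3)\<^sup>2" if "\<bar>h\<bar> < \<eta>" for h
  proof (cases "h = 0")
    case True
    then show ?thesis using \<theta> by (simp add: remainder_0)
  next
    case False
    from \<eta>(2)[OF this that] have *: "\<theta> + h \<in> \<Theta>" "L2_norm \<mu> (remainder h) / \<bar>h\<bar> ^ 3 < \<kappa>" by auto
    from *(2) False have "L2_norm \<mu> (remainder h) \<le> \<kappa> * \<bar>h\<bar> ^ 3"
      by (simp add: field_simps)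
    from square_integral_le_of_L2_norm_le[OF this] *(1) show ?thesis by simp
  qed
  with \<eta>(1) show ?thesis by blast
qed

lemma off_support_integrable:
  "integrable \<mu> (\<lambda>y. (sd 1 \<theta> y)\<^sup>2 * indicator {y. s y = 0} y)"
proof (rule Bochner_Integration.integrable_bound[OF L2_fun_integrable_square[OF L2s(2)]])
  have "(\<lambda>y. (sd 1 \<theta> y)\<^sup>2 * indicator {y \<in> space \<mu>. s y = 0} y) \<in> borel_measurable \<mu>" by measurable
  then show "(\<lambda>y. (sd 1 \<theta> y)\<^sup>2 * indicator {y. s y = 0} y) \<in> borel_measurable \<mu>"
    by (rule measurable_cong[THEN iffD1, rotated]) (simp add: indicator_def)
qed (auto simp: indicator_def)

text \<open>Where \<open>s = 0\<close>, the nonnegative function \<open>s(\<theta> + h)\<close> equals \<open>h\<close> times the derivative up to \<open>o(h)\<close>.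
  Taking \<open>h\<close> of either sign shows that the derivative can be neither negative nor positive.\<close>
lemma first_derivative_vanishes_off_support:
  "(LINT y|\<mu>. (sd 1 \<theta> y)\<^sup>2 * indicator {y. s y = 0} y) = 0" (is "?Z = 0")
proof -
  define R where "R = (\<lambda>h y. root_density p (\<theta> + h) y - s y - h * sd 1 \<theta> y)"
  have lim: "((\<lambda>h. L2_norm \<mu> (R h) / \<bar>h\<bar>) \<longlongrightarrow> 0) (at 0)"
    unfolding R_def using regular \<theta> by (simp add: regular_parametric_model_def)
  have "?Z \<le> 2 * \<kappa>\<^sup>2" if \<kappa>: "\<kappa> > 0" for \<kappa>
  proof -
    have "\<forall>\<^sub>F h in at 0. \<theta> + h \<in> \<Theta> \<and> L2_norm \<mu> (R h) / \<bar>h\<bar> < \<kappa>"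
      using eventually_in_parameter_space order_tendstoD(2)[OF lim \<kappa>] by (rule eventually_conj)
    then obtain \<eta> where \<eta>: "\<eta> > 0" "\<And>h. h \<noteq> 0 \<Longrightarrow> \<bar>h\<bar> < \<eta> \<Longrightarrow>
        \<theta> + h \<in> \<Theta> \<and> L2_norm \<mu> (R h) / \<bar>h\<bar> < \<kappa>"
      unfolding eventually_at by (auto simp: dist_real_def)
    \<comment> \<open>Any point of the punctured neighbourhood would do; both \<open>h\<close> and \<open>- h\<close> are used.\<close>
    define h where "h = \<eta> / 2"
    have h: "h > 0" "\<bar>h\<bar> < \<eta>" "\<bar>- h\<bar> < \<eta>" "-h \<noteq> 0" using \<eta>(1) by (auto simp: h_def)
    have R: "L2_fun \<mu> (R g)" "(LINT y|\<mu>. (R g y)\<^sup>2) \<le> (\<kappa> * h)\<^sup>2" "\<theta> + g \<in> \<Theta>" if "g = h \<or> g = -h" for g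
    proof -
      have *: "\<theta> + g \<in> \<Theta>" "L2_norm \<mu> (R g) / \<bar>g\<bar> < \<kappa>"
        using \<eta>(2)[of g] h that by auto
      show "L2_fun \<mu> (R g)"
        unfolding R_def by (intro L2_fun_diff L2_fun_cmult L2s root_density_L2 *)
      show "(LINT y|\<mu>. (R g y)\<^sup>2) \<le> (\<kappa> * h)\<^sup>2"
        using *(2) h that by (intro square_integral_le_of_L2_norm_le) (auto simp: field_simps)
      show "\<theta> + g \<in> \<Theta>" by fact
    qed
    have "h\<^sup>2 * ?Z = (LINT y|\<mu>. h\<^sup>2 * ((sd 1 \<theta> y)\<^sup>2 * indicator {y. s y = 0} y))" by simp
    also have "\<dots> \<le> (LINT y|\<mu>. (R h y)\<^sup>2 + (R (-h) y)\<^sup>2)"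
    proof (rule integral_mono)
      show "integrable \<mu> (\<lambda>y. h\<^sup>2 * ((sd 1 \<theta> y)\<^sup>2 * indicator {y. s y = 0} y))"
        using off_support_integrable by simp
      show "integrable \<mu> (\<lambda>y. (R h y)\<^sup>2 + (R (-h) y)\<^sup>2)"
        using R(1)[of h] R(1)[of "-h"] by (auto simp: L2_fun_def)
      fix y assume y: "y \<in> space \<mu>"
      show "h\<^sup>2 * ((sd 1 \<theta> y)\<^sup>2 * indicator {y. s y = 0} y) \<le> (R h y)\<^sup>2 + (R (-h) y)\<^sup>2"
      proof (cases "s y = 0")
        case True
        have "0 \<le> root_density p (\<theta> + h) y" "0 \<le> root_density p (\<theta> + (-h)) y"
          using density_nonneg[OF R(3)[of h] y] density_nonneg[OF R(3)[of "-h"] y]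
          unfolding root_density_def by auto
        then have ge: "- (h * sd 1 \<theta> y) \<le> R h y" "h * sd 1 \<theta> y \<le> R (-h) y"
          using True by (auto simp: R_def)
        have "(h * sd 1 \<theta> y)\<^sup>2 \<le> (R h y)\<^sup>2 + (R (-h) y)\<^sup>2"
        proof (cases "h * sd 1 \<theta> y \<ge> 0")
          case True
          then have "(h * sd 1 \<theta> y)\<^sup>2 \<le> (R (-h) y)\<^sup>2" using ge by (intro power_mono)
          then show ?thesis by (simp add: add_increasing)
        next
          case False
          then have "(- (h * sd 1 \<theta> y))\<^sup>2 \<le> (R h y)\<^sup>2" using ge by (intro power_mono) auto
          then show ?thesis by (simp add: add_increasing2)
        qed
        with True show ?thesis by (simp add: power_mult_distrib)
      qed simp
    qed
    also have "\<dots> = (LINT y|\<mu>. (R h y)\<^sup>2) + (LINT y|\<mu>. (R (-h) y)\<^sup>2)"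
      using R(1)[of h] R(1)[of "-h"] by (intro Bochner_Integration.integral_add) (auto simp: L2_fun_def)
    also have "\<dots> \<le> (\<kappa> * h)\<^sup>2 + (\<kappa> * h)\<^sup>2" using R(2) by (intro add_mono) auto
    finally have "h\<^sup>2 * ?Z \<le> h\<^sup>2 * (2 * \<kappa>\<^sup>2)" by (simp add: power_mult_distrib ac_simps)
    then show ?thesis using h by simp
  qed
  moreover have "((\<lambda>\<kappa>::real. 2 * \<kappa>\<^sup>2) \<longlongrightarrow> 0) (at_right 0)" by (auto intro!: tendsto_eq_intros)
  ultimately have "?Z \<le> 0"
    by (intro tendsto_lowerbound[of "\<lambda>\<kappa>. 2 * \<kappa>\<^sup>2" 0 "at_right 0"])
      (auto simp: eventually_at_right_less intro: eventually_mono[OF eventually_at_right_less])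
  moreover have "0 \<le> ?Z" by (rule Bochner_Integration.integral_nonneg) simp
  ultimately show ?thesis by (rule order.antisym)
qed

text \<open>The score is defined to be zero where \<open>s = 0\<close>; since the derivative vanishes there as well, no mass
  is lost in passing to the integral over the whole space.\<close>
lemma fisher_info_eq: "I = 4 * (LINT y|\<mu>. (sd 1 \<theta> y)\<^sup>2)"
proof -
  have "I = (LINT y|\<mu>. (s y)\<^sup>2 * (l 1 y)\<^sup>2)"
    unfolding fisher_info_def by (rule integral_model) measurable
  also have "\<dots> = (LINT y|\<mu>. 4 * ((sd 1 \<theta> y)\<^sup>2 - (sd 1 \<theta> y)\<^sup>2 * indicator {y. s y = 0} y))"
    by (intro Bochner_Integration.integral_cong)
      (auto simp: s_eq_0_iff score_def indicator_def field_simps power2_eq_square)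
  also have "\<dots> = 4 * ((LINT y|\<mu>. (sd 1 \<theta> y)\<^sup>2) - (LINT y|\<mu>. (sd 1 \<theta> y)\<^sup>2 * indicator {y. s y = 0} y))"
    using L2_fun_integrable_square[OF L2s(2)] off_support_integrable
    by (simp add: Bochner_Integration.integral_diff)
  finally show ?thesis using first_derivative_vanishes_off_support by simp
qed

lemma I_pos: "I > 0"
  using regular \<theta> by (simp add: regular_parametric_model_def)

lemma score_mean:
  assumes "k \<in> {1..3}"
  shows "(LINT y|D. l k y) = 2 * (LINT y|\<mu>. s y * sd k \<theta> y)"
proof -
  have "(LINT y|D. l k y) = (LINT y|\<mu>. (s y)\<^sup>2 * l k y)"
    using assms by (intro integral_model) auto
  also have "\<dots> = (LINT y|\<mu>. 2 * (s y * sd k \<theta> y))"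
    by (intro Bochner_Integration.integral_cong)
      (auto simp: score_def power2_eq_square s_eq_0_iff[symmetric])
  finally show ?thesis by simp
qed

text \<open>These are the first two derivatives at \<open>h = 0\<close> of \<open>\<parallel>s(\<theta> + h)\<parallel>\<^sup>2 = 1\<close>.  The squared norm of the Taylor
  polynomial is a polynomial in \<open>h\<close>, and it differs from \<open>1\<close> by \<open>O(\<bar>h\<bar>\<^sup>3)\<close> because the remainder does;
  so its coefficients of \<open>h\<close> and \<open>h\<^sup>2\<close> vanish.\<close>

lemma norm_identities:
  "(LINT y|\<mu>. s y * sd 1 \<theta> y) = 0"
  "(LINT y|\<mu>. s y * sd 2 \<theta> y) = - (LINT y|\<mu>. (sd 1 \<theta> y)\<^sup>2)"
proof -
  note prods = L2s[THEN L2_fun_integrable_square] L2_fun_integrable_mult[OF L2s(1) L2s(2)]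
    L2_fun_integrable_mult[OF L2s(1) L2s(3)] L2_fun_integrable_mult[OF L2s(1) L2s(4)]
    L2_fun_integrable_mult[OF L2s(2) L2s(3)] L2_fun_integrable_mult[OF L2s(2) L2s(4)]
    L2_fun_integrable_mult[OF L2s(3) L2s(4)]
  define a where "a = 2 * (LINT y|\<mu>. s y * sd 1 \<theta> y)"
  define b where "b = (LINT y|\<mu>. (sd 1 \<theta> y)\<^sup>2) + (LINT y|\<mu>. s y * sd 2 \<theta> y)"
  define c3 where "c3 = (LINT y|\<mu>. sd 1 \<theta> y * sd 2 \<theta> y) + (LINT y|\<mu>. s y * sd 3 \<theta> y) / 3"
  define c4 where "c4 = (LINT y|\<mu>. (sd 2 \<theta> y)\<^sup>2) / 4 + (LINT y|\<mu>. sd 1 \<theta> y * sd 3 \<theta> y) / 3"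
  define c5 where "c5 = (LINT y|\<mu>. sd 2 \<theta> y * sd 3 \<theta> y) / 6"
  define c6 where "c6 = (LINT y|\<mu>. (sd 3 \<theta> y)\<^sup>2) / 36"
  have N: "(LINT y|\<mu>. (taylor h y)\<^sup>2) = 1 + a * h + b * h\<^sup>2 + c3 * h ^ 3 + c4 * h ^ 4 + c5 * h ^ 5 + c6 * h ^ 6" for h
  proof -
    have "(taylor h y)\<^sup>2 = (s y)\<^sup>2 + (2 * h) * (s y * sd 1 \<theta> y) + (h\<^sup>2) * (sd 1 \<theta> y)\<^sup>2 + (h\<^sup>2) * (s y * sd 2 \<theta> y)
      + (h ^ 3) * (sd 1 \<theta> y * sd 2 \<theta> y) + (h ^ 3 / 3) * (s y * sd 3 \<theta> y)
      + (h ^ 4 / 4) * (sd 2 \<theta> y)\<^sup>2 + (h ^ 4 / 3) * (sd 1 \<theta> y * sd 3 \<theta> y)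
      + (h ^ 5 / 6) * (sd 2 \<theta> y * sd 3 \<theta> y) + (h ^ 6 / 36) * (sd 3 \<theta> y)\<^sup>2" for y
      by (simp add: taylor_def field_simps power2_eq_square power3_eq_cube eval_nat_numeral)
    then have "(LINT y|\<mu>. (taylor h y)\<^sup>2) = (LINT y|\<mu>. (s y)\<^sup>2) + (2 * h) * (LINT y|\<mu>. s y * sd 1 \<theta> y)
      + (h\<^sup>2) * (LINT y|\<mu>. (sd 1 \<theta> y)\<^sup>2) + (h\<^sup>2) * (LINT y|\<mu>. s y * sd 2 \<theta> y)
      + (h ^ 3) * (LINT y|\<mu>. sd 1 \<theta> y * sd 2 \<theta> y) + (h ^ 3 / 3) * (LINT y|\<mu>. s y * sd 3 \<theta> y)
      + (h ^ 4 / 4) * (LINT y|\<mu>. (sd 2 \<theta> y)\<^sup>2) + (h ^ 4 / 3) * (LINT y|\<mu>. sd 1 \<theta> y * sd 3 \<theta> y)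
      + (h ^ 5 / 6) * (LINT y|\<mu>. sd 2 \<theta> y * sd 3 \<theta> y) + (h ^ 6 / 36) * (LINT y|\<mu>. (sd 3 \<theta> y)\<^sup>2)"
      using prods by (simp del: Bochner_Integration.integral_mult_right_zero
          add: Bochner_Integration.integral_add Bochner_Integration.integral_mult_right)
    then show ?thesis unfolding a_def b_def c3_def c4_def c5_def c6_def s_norm
      by (simp add: algebra_simps add_divide_distrib)
  qed
  obtain \<eta> where \<eta>: "\<eta> > 0" "\<And>h. \<bar>h\<bar> < \<eta> \<Longrightarrow>
      \<theta> + h \<in> \<Theta> \<and> (LINT y|\<mu>. (remainder h y)\<^sup>2) \<le> (1 * \<bar>h\<bar> ^ 3)\<^sup>2"
    using remainder_small[of 1] by auto
  define C where "C = 3 + \<bar>c3\<bar> + \<bar>c4\<bar> + \<bar>c5\<bar> + \<bar>c6\<bar>"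
  have bound: "\<bar>a * h + b * h\<^sup>2\<bar> \<le> C * \<bar>h\<bar> ^ 3" if h: "\<bar>h\<bar> < min \<eta> 1" for h
  proof (cases "h = 0")
    case False
    define H where "H = \<bar>h\<bar> ^ 3"
    have H: "H > 0" "H \<le> 1" using False h by (auto simp: H_def intro!: power_le_one)
    have \<Theta>: "\<theta> + h \<in> \<Theta>" and R: "(LINT y|\<mu>. (remainder h y)\<^sup>2) \<le> H\<^sup>2"
      using \<eta>(2)[of h] h by (auto simp: H_def)
    let ?r = "root_density p (\<theta> + h)"
    have ri: "integrable \<mu> (\<lambda>y. (?r y)\<^sup>2)" "integrable \<mu> (\<lambda>y. (remainder h y)\<^sup>2)"
       "integrable \<mu> (\<lambda>y. ?r y * remainder h y)"
      using root_density_L2(1)[OF \<Theta>] remainder_L2[OF \<Theta>] L2_fun_integrable_mult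
      by (auto simp: L2_fun_def)
    \<comment> \<open>Cauchy-Schwarz, in the form of an arithmetic-geometric mean inequality with weight \<open>H\<close>.\<close>
    have rR: "\<bar>LINT y|\<mu>. ?r y * remainder h y\<bar> \<le> H"
    proof -
      have "\<bar>LINT y|\<mu>. ?r y * remainder h y\<bar> \<le> (LINT y|\<mu>. \<bar>?r y * remainder h y\<bar>)"
        by (rule integral_abs_bound)
      also have "\<dots> \<le> (LINT y|\<mu>. H / 2 * (?r y)\<^sup>2 + 1 / (2 * H) * (remainder h y)\<^sup>2)"
      proof (rule integral_mono)
        fix y
        have "0 \<le> (H * \<bar>?r y\<bar> - \<bar>remainder h y\<bar>)\<^sup>2 / (2 * H)" using H by simp
        also have "\<dots> = H / 2 * (?r y)\<^sup>2 + 1 / (2 * H) * (remainder h y)\<^sup>2 - \<bar>?r y\<bar> * \<bar>remainder h y\<bar>"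
          using H by (simp add: power2_diff power_mult_distrib field_simps) (simp add: power2_eq_square)
        finally show "\<bar>?r y * remainder h y\<bar> \<le> H / 2 * (?r y)\<^sup>2 + 1 / (2 * H) * (remainder h y)\<^sup>2"
          by (simp add: abs_mult)
      qed (use ri in auto)
      also have "\<dots> = H / 2 * (LINT y|\<mu>. (?r y)\<^sup>2) + 1 / (2 * H) * (LINT y|\<mu>. (remainder h y)\<^sup>2)"
        using ri by (simp add: Bochner_Integration.integral_add)
      also have "\<dots> \<le> H / 2 * 1 + 1 / (2 * H) * H\<^sup>2"
        using R H root_density_L2(2)[OF \<Theta>] by (intro add_mono mult_left_mono) auto
      also have "\<dots> = H" using H by (simp add: power2_eq_square)
      finally show ?thesis .
    qed
    have "(LINT y|\<mu>. (taylor h y)\<^sup>2) = (LINT y|\<mu>. (?r y)\<^sup>2 - 2 * (?r y * remainder h y) + (remainder h y)\<^sup>2)"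
      by (rule Bochner_Integration.integral_cong) (auto simp: remainder_def power2_eq_square algebra_simps)
    also have "\<dots> = 1 - 2 * (LINT y|\<mu>. ?r y * remainder h y) + (LINT y|\<mu>. (remainder h y)\<^sup>2)"
      using ri root_density_L2(2)[OF \<Theta>] by (simp add: Bochner_Integration.integral_add Bochner_Integration.integral_diff)
    moreover have "0 \<le> (LINT y|\<mu>. (remainder h y)\<^sup>2)"
      by (rule Bochner_Integration.integral_nonneg) simp
    moreover have "H\<^sup>2 \<le> H" using H by (simp add: power2_eq_square mult_left_le)
    ultimately have N2: "\<bar>(LINT y|\<mu>. (taylor h y)\<^sup>2) - 1\<bar> \<le> 3 * H"
      using rR R by linarith
    have P: "\<bar>c * h ^ k\<bar> \<le> \<bar>c\<bar> * H" if "k \<ge> 3" for c and k :: nat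
      unfolding H_def abs_mult power_abs using h that
      by (intro mult_left_mono power_decreasing) auto
    have "\<bar>a * h + b * h\<^sup>2\<bar> \<le> \<bar>(LINT y|\<mu>. (taylor h y)\<^sup>2) - 1\<bar> + \<bar>c3 * h ^ 3\<bar> + \<bar>c4 * h ^ 4\<bar> + \<bar>c5 * h ^ 5\<bar> + \<bar>c6 * h ^ 6\<bar>"
      unfolding N by linarith
    also have "\<dots> \<le> 3 * H + \<bar>c3\<bar> * H + \<bar>c4\<bar> * H + \<bar>c5\<bar> * H + \<bar>c6\<bar> * H"
      by (intro add_mono N2 P) auto
    also have "\<dots> = C * \<bar>h\<bar> ^ 3" by (simp add: C_def H_def algebra_simps)
    finally show ?thesis .
  qed simp
  have "min \<eta> 1 > 0" using \<eta>(1) by simp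
  from polynomial_coeffs_zero_if_cubic_bound[OF this bound] have "a = 0" "b = 0" by auto
  then show "(LINT y|\<mu>. s y * sd 1 \<theta> y) = 0"
    "(LINT y|\<mu>. s y * sd 2 \<theta> y) = - (LINT y|\<mu>. (sd 1 \<theta> y)\<^sup>2)"
    by (auto simp: a_def b_def)
qed

lemma score_mean_zero: "(LINT y|D. l 1 y) = 0"
  using score_mean[of 1] norm_identities(1) by simp

text \<open>The two summands contribute \<open>- I / 4\<close> each.\<close>
lemma second_score_mean: "(LINT y|D. l 2 y / 2 - (l 1 y)\<^sup>2 / 4) = - I / 2"
proof -
  have "(LINT y|D. l 2 y / 2 - (l 1 y)\<^sup>2 / 4) = (LINT y|D. l 2 y) / 2 - (LINT y|D. (l 1 y)\<^sup>2) / 4"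
    using score_lower_moments by (simp add: Bochner_Integration.integral_diff)
  also have "\<dots> = - I / 2"
    using score_mean[of 2] norm_identities(2) fisher_info_eq by (simp add: fisher_info_def)
  finally show ?thesis .
qed

section \<open>Expansion of the log density\<close>

text \<open>\<open>q2\<close> and \<open>q3\<close> are the coefficients of \<open>h\<^sup>2\<close> and \<open>h\<^sup>3\<close> in the expansion of the log density, obtained
  by inserting \<open>a = h l 1 / 2\<close>, \<open>b = h\<^sup>2 l 2 / 4\<close>, \<open>e = h\<^sup>3 l 3 / 12\<close> into
  \<open>2 (a + b + e) - a\<^sup>2 - 2 a b + 2 a\<^sup>3 / 3\<close>.\<close>
definition q2 :: "'y \<Rightarrow> real" where "q2 y = l 2 y / 2 - (l 1 y)\<^sup>2 / 4"
definition q3 :: "'y \<Rightarrow> real" where "q3 y = l 3 y / 6 - l 1 y * l 2 y / 4 + (l 1 y) ^ 3 / 12"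

definition log_remainder :: "real \<Rightarrow> 'y \<Rightarrow> real" where
  "log_remainder h y = ln (p (\<theta> + h) y) - ln (p \<theta> y) - (h * l 1 y + h\<^sup>2 * q2 y + h ^ 3 * q3 y)"

lemma score_measurable' [measurable]:
  "l 1 \<in> borel_measurable \<mu>" "l (Suc 0) \<in> borel_measurable \<mu>" "l 2 \<in> borel_measurable \<mu>" "l 3 \<in> borel_measurable \<mu>"
  by (auto intro: score_measurable)

lemma q_measurable [measurable]: "q2 \<in> borel_measurable \<mu>" "q3 \<in> borel_measurable \<mu>"
  unfolding q2_def[abs_def] q3_def[abs_def] by measurable

definition rel_remainder :: "real \<Rightarrow> 'y \<Rightarrow> real" where
  "rel_remainder h y = (if s y > 0 then remainder h y / s y else 0)"

lemma AE_s_pos: "AE y in D. 0 < s y"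
  unfolding model_def by (subst AE_density) (auto simp: root_density_def)

text \<open>Dividing by \<open>s\<close> and integrating its square with respect to \<open>D\<close>, which has density \<open>s\<^sup>2\<close>, restores
  the \<open>L\<^sub>2(\<mu>)\<close> norm of the remainder.  The first moment is bounded by the inequality of arithmetic and
  geometric means with weight \<open>H = \<kappa> \<bar>h\<bar>\<^sup>3\<close>.\<close>
lemma rel_remainder_moments:
  assumes h: "\<theta> + h \<in> \<Theta>" and R: "(LINT y|\<mu>. (remainder h y)\<^sup>2) \<le> (\<kappa> * \<bar>h\<bar> ^ 3)\<^sup>2" and \<kappa>: "\<kappa> > 0"
  shows "rel_remainder h \<in> borel_measurable \<mu>"
    "integrable D (\<lambda>y. (rel_remainder h y)\<^sup>2)" "(LINT y|D. (rel_remainder h y)\<^sup>2) \<le> (\<kappa> * \<bar>h\<bar> ^ 3)\<^sup>2"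
    "integrable D (\<lambda>y. \<bar>rel_remainder h y\<bar>)" "(LINT y|D. \<bar>rel_remainder h y\<bar>) \<le> \<kappa> * \<bar>h\<bar> ^ 3"
proof -
  have [measurable]: "remainder h \<in> borel_measurable \<mu>" using remainder_L2[OF h] by (rule L2_fun_measurable)
  show m [measurable]: "rel_remainder h \<in> borel_measurable \<mu>"
    unfolding rel_remainder_def[abs_def] by measurable
  have le: "(s y)\<^sup>2 * (rel_remainder h y)\<^sup>2 \<le> (remainder h y)\<^sup>2" for y
    by (auto simp: rel_remainder_def field_simps)
  have int: "integrable \<mu> (\<lambda>y. (s y)\<^sup>2 * (rel_remainder h y)\<^sup>2)"
    by (rule Bochner_Integration.integrable_bound[OF L2_fun_integrable_square[OF remainder_L2[OF h]]])
      (use le in auto)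
  then show i2: "integrable D (\<lambda>y. (rel_remainder h y)\<^sup>2)"
    by (subst integrable_model) auto
  have "(LINT y|D. (rel_remainder h y)\<^sup>2) = (LINT y|\<mu>. (s y)\<^sup>2 * (rel_remainder h y)\<^sup>2)"
    by (rule integral_model) measurable
  also have "\<dots> \<le> (LINT y|\<mu>. (remainder h y)\<^sup>2)"
    by (rule integral_mono[OF int L2_fun_integrable_square[OF remainder_L2[OF h]] le])
  finally show E2: "(LINT y|D. (rel_remainder h y)\<^sup>2) \<le> (\<kappa> * \<bar>h\<bar> ^ 3)\<^sup>2" using R by simp
  interpret prob_space D by (rule prob_space_model[OF \<theta>])
  show i1: "integrable D (\<lambda>y. \<bar>rel_remainder h y\<bar>)"
    by (intro integrable_abs square_integrable_imp_integrable[OF _ i2]) measurable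
  show "(LINT y|D. \<bar>rel_remainder h y\<bar>) \<le> \<kappa> * \<bar>h\<bar> ^ 3"
  proof (cases "h = 0")
    case True
    then have "rel_remainder h = (\<lambda>_. 0)"
      by (intro ext) (simp add: rel_remainder_def remainder_0)
    then show ?thesis by (simp add: True)
  next
    case False
    define H where "H = \<kappa> * \<bar>h\<bar> ^ 3"
    have H: "H > 0" using False \<kappa> by (simp add: H_def)
    have "(LINT y|D. \<bar>rel_remainder h y\<bar>) \<le> (LINT y|D. 1 / (2 * H) * (rel_remainder h y)\<^sup>2 + H / 2)"
    proof (rule integral_mono[OF i1])
      fix y
      have "0 \<le> (\<bar>rel_remainder h y\<bar> - H)\<^sup>2 / (2 * H)" using H by simp
      also have "\<dots> = 1 / (2 * H) * (rel_remainder h y)\<^sup>2 + H / 2 - \<bar>rel_remainder h y\<bar>"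
        using H by (simp add: power2_diff field_simps) (simp add: power2_eq_square)
      finally show "\<bar>rel_remainder h y\<bar> \<le> 1 / (2 * H) * (rel_remainder h y)\<^sup>2 + H / 2" by simp
    qed (use i2 in auto)
    also have "\<dots> = 1 / (2 * H) * (LINT y|D. (rel_remainder h y)\<^sup>2) + H / 2"
      using i2 by (simp add: Bochner_Integration.integral_add prob_space)
    also have "\<dots> \<le> 1 / (2 * H) * H\<^sup>2 + H / 2"
      using E2 H by (intro add_mono mult_left_mono) (auto simp: H_def)
    also have "\<dots> = H" using H by (simp add: power2_eq_square)
    finally show ?thesis by (simp add: H_def)
  qed
qed

text \<open>The ratio of root densities is \<open>1 + a + b + e + r\<close>, and the log density is twice the logarithm of
  the root density.\<close>
lemma log_density_expansion_pointwise:
  assumes y: "y \<in> space \<mu>" and pos: "0 < s y" and h: "\<theta> + h \<in> \<Theta>"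
    and small: "\<bar>h * l 1 y / 2\<bar> \<le> 1 / 8" "\<bar>h\<^sup>2 * l 2 y / 4\<bar> \<le> 1 / 8" "\<bar>h ^ 3 * l 3 y / 12\<bar> \<le> 1 / 8"
      "\<bar>rel_remainder h y\<bar> \<le> 1 / 8"
  shows "0 < p \<theta> y" "0 < p (\<theta> + h) y"
    "\<bar>log_remainder h y\<bar>
      \<le> 50 * (\<bar>rel_remainder h y\<bar> + (h * l 1 y / 2) ^ 4 + (h\<^sup>2 * l 2 y / 4)\<^sup>2
         + \<bar>(h * l 1 y / 2) * (h ^ 3 * l 3 y / 12)\<bar> + (h ^ 3 * l 3 y / 12)\<^sup>2)"
proof -
  let ?a = "h * l 1 y / 2" and ?b = "h\<^sup>2 * l 2 y / 4" and ?e = "h ^ 3 * l 3 y / 12" and ?r = "rel_remainder h y"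
  have ratio: "root_density p (\<theta> + h) y = s y * (1 + (?a + ?b + ?e + ?r))"
    using pos by (simp add: rel_remainder_def remainder_def taylor_def score_def field_simps)
  have "\<bar>?a + ?b + ?e + ?r\<bar> \<le> 1 / 2" using small by linarith
  then have W: "1 + (?a + ?b + ?e + ?r) > 0" by linarith
  then have pos': "0 < root_density p (\<theta> + h) y" using pos unfolding ratio by (rule mult_pos_pos[rotated])
  show p: "0 < p \<theta> y" "0 < p (\<theta> + h) y" using pos pos' by (auto simp: root_density_def)
  have "ln (p (\<theta> + h) y) = 2 * ln (root_density p (\<theta> + h) y)" "ln (p \<theta> y) = 2 * ln (s y)"
    using p by (auto simp: root_density_def ln_sqrt)
  moreover have "ln (root_density p (\<theta> + h) y) = ln (s y) + ln (1 + (?a + ?b + ?e + ?r))"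
    unfolding ratio using pos W by (rule ln_mult_pos)
  ultimately have "ln (p (\<theta> + h) y) - ln (p \<theta> y) = 2 * ln (1 + (?a + ?b + ?e + ?r))" by simp
  moreover have "h * l 1 y + h\<^sup>2 * q2 y + h ^ 3 * q3 y = 2 * (?a + ?b + ?e) - ?a\<^sup>2 - 2 * ?a * ?b + 2 * ?a ^ 3 / 3"
    by (simp add: q2_def q3_def power2_eq_square power3_eq_cube field_simps)
  ultimately show "\<bar>log_remainder h y\<bar>
      \<le> 50 * (\<bar>?r\<bar> + ?a ^ 4 + ?b\<^sup>2 + \<bar>?a * ?e\<bar> + ?e\<^sup>2)"
    using two_ln_one_plus_truncation[OF small] by (simp add: log_remainder_def)
qed

lemma one_le_power_if_not_small:
  fixes x c :: real assumes "\<not> \<bar>x\<bar> \<le> c" "c > 0" shows "1 \<le> (\<bar>x\<bar> / c) ^ k"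
  using assms by (intro one_le_power) (simp add: field_simps)

text \<open>The expansion for a single observation.  For a sample of size \<open>n\<close> and \<open>h = O(n\<^sup>-\<^sup>1\<^sup>/\<^sup>4)\<close>, the
  exceptional probability \<open>o(h\<^sup>4)\<close> is \<open>o(1 / n)\<close>, and the mean \<open>o(h\<^sup>3)\<close> of the bound \<open>\<psi>\<close> adds up to \<open>o(n\<^sup>1\<^sup>/\<^sup>4)\<close>.
  The sixth, third and second moments of \<open>l 1\<close>, \<open>l 2\<close>, \<open>l 3\<close> are what makes each of the three Taylor
  terms exceed a constant with probability \<open>O(h\<^sup>6)\<close>.  On the good set the density at \<open>\<theta> + h\<close> is
  positive, so that its logarithm is meaningful.\<close>
lemma log_density_expansion:
  assumes "\<epsilon> > 0"
  shows "\<exists>\<eta>>0. \<forall>h. \<bar>h\<bar> < \<eta> \<longrightarrow> (\<exists>G\<in>sets \<mu>. \<exists>\<psi>. measure D (space \<mu> - G) \<le> \<epsilon> * h ^ 4 \<and>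
     integrable D \<psi> \<and> (LINT y|D. \<psi> y) \<le> \<epsilon> * \<bar>h\<bar> ^ 3 \<and> (\<forall>y. 0 \<le> \<psi> y) \<and>
     (\<forall>y\<in>G. 0 < p \<theta> y \<and> 0 < p (\<theta> + h) y \<and> \<bar>log_remainder h y\<bar> \<le> \<psi> y))" (is "\<exists>\<eta>>0. \<forall>h. _ \<longrightarrow> ?expansion h")
proof -
  interpret prob_space D by (rule prob_space_model[OF \<theta>])
  define \<kappa> where "\<kappa> = \<epsilon> / 100"
  have \<kappa>: "\<kappa> > 0" using assms by (simp add: \<kappa>_def)
  obtain \<eta>0 where \<eta>0: "\<eta>0 > 0" "\<And>h. \<bar>h\<bar> < \<eta>0 \<Longrightarrow>
      \<theta> + h \<in> \<Theta> \<and> (LINT y|\<mu>. (remainder h y)\<^sup>2) \<le> (\<kappa> * \<bar>h\<bar> ^ 3)\<^sup>2"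
    using remainder_small[OF \<kappa>] by auto
  \<comment> \<open>\<open>C h\<^sup>6\<close> will bound the exceptional probability, and \<open>K h\<^sup>4\<close> the mean of the terms of order four in \<open>\<psi>\<close>.\<close>
  define M1 where "M1 = (LINT y|D. \<bar>l 1 y\<bar> ^ 6)"
  define M2 where "M2 = (LINT y|D. \<bar>l 2 y\<bar> ^ 3)"
  define M3 where "M3 = (LINT y|D. (l 3 y)\<^sup>2)"
  define C where "C = 4096 * M1 + 8 * M2 + M3 + 64 * \<kappa>\<^sup>2"
  define rest where "rest = (\<lambda>y. (l 1 y) ^ 4 / 16 + (l 2 y)\<^sup>2 / 16 + \<bar>l 1 y * l 3 y\<bar> / 24 + (l 3 y)\<^sup>2 / 144)"
  define K where "K = (LINT y|D. rest y)"
  have rest: "integrable D rest" "\<And>y. 0 \<le> rest y"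
    unfolding rest_def using score_lower_moments score_product_moments score_moments by auto
  have nn: "0 \<le> M1" "0 \<le> M2" "0 \<le> M3" "0 \<le> K"
    unfolding M1_def M2_def M3_def K_def using rest by (auto intro!: Bochner_Integration.integral_nonneg)
  then have C: "C \<ge> 0" by (simp add: C_def)
  define \<eta> where "\<eta> = min (min \<eta>0 1) (min (\<epsilon> / (C + 1)) (\<epsilon> / (100 * (K + 1))))"
  have "\<eta> > 0" using \<eta>0 assms nn C by (simp add: \<eta>_def)
  moreover have "?expansion h" if h: "\<bar>h\<bar> < \<eta>" for h
  proof -
    have h1: "\<bar>h\<bar> \<le> 1" and hC: "\<bar>h\<bar> * (C + 1) \<le> \<epsilon>" and hK: "\<bar>h\<bar> * (100 * (K + 1)) \<le> \<epsilon>" and h0: "\<bar>h\<bar> < \<eta>0"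
      using h nn C by (auto simp: \<eta>_def field_simps)
    have \<Theta>: "\<theta> + h \<in> \<Theta>" and R: "(LINT y|\<mu>. (remainder h y)\<^sup>2) \<le> (\<kappa> * \<bar>h\<bar> ^ 3)\<^sup>2"
      using \<eta>0(2)[OF h0] by auto
    note rr = rel_remainder_moments[OF \<Theta> R \<kappa>]
    note [measurable] = rr(1)
    define G where "G = {y \<in> space \<mu>. 0 < s y \<and> \<bar>h * l 1 y / 2\<bar> \<le> 1 / 8 \<and> \<bar>h\<^sup>2 * l 2 y / 4\<bar> \<le> 1 / 8 \<and>
      \<bar>h ^ 3 * l 3 y / 12\<bar> \<le> 1 / 8 \<and> \<bar>rel_remainder h y\<bar> \<le> 1 / 8}"
    define \<psi> where "\<psi> = (\<lambda>y. 50 * \<bar>rel_remainder h y\<bar> + 50 * h ^ 4 * rest y)"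
    \<comment> \<open>Off \<open>G\<close> one of the four summands of \<open>\<Phi>\<close> is at least \<open>1\<close>, so one application of Markov's inequality suffices.\<close>
    define \<Phi> where "\<Phi> = (\<lambda>y. 4096 * h ^ 6 * \<bar>l 1 y\<bar> ^ 6 + 8 * h ^ 6 * \<bar>l 2 y\<bar> ^ 3 + h ^ 6 * (l 3 y)\<^sup>2
      + 64 * (rel_remainder h y)\<^sup>2)"
    have G: "G \<in> sets \<mu>" unfolding G_def by measurable
    have \<Phi>_int: "integrable D \<Phi>"
      unfolding \<Phi>_def using score_moments rr(2) by simp
    have \<Phi>_nn: "0 \<le> \<Phi> y" for y by (simp add: \<Phi>_def)
    have E\<Phi>: "(LINT y|D. \<Phi> y) \<le> C * h ^ 6"
    proof -
      have "(LINT y|D. \<Phi> y) = 4096 * h ^ 6 * M1 + 8 * h ^ 6 * M2 + h ^ 6 * M3 + 64 * (LINT y|D. (rel_remainder h y)\<^sup>2)"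
        unfolding \<Phi>_def M1_def M2_def M3_def using score_moments rr(2) by (simp add: Bochner_Integration.integral_add)
      also have "\<dots> \<le> 4096 * h ^ 6 * M1 + 8 * h ^ 6 * M2 + h ^ 6 * M3 + 64 * (\<kappa> * \<bar>h\<bar> ^ 3)\<^sup>2"
        using rr(3) by simp
      also have "\<dots> = C * h ^ 6"
        by (simp add: C_def power_mult_distrib algebra_simps flip: power_mult power_abs)
      finally show ?thesis .
    qed
    have "measure D (space \<mu> - G) \<le> measure D {y \<in> space D. 1 \<le> \<Phi> y}"
    proof (rule finite_measure_mono_AE)
      show "AE y in D. y \<in> space \<mu> - G \<longrightarrow> y \<in> {y \<in> space D. 1 \<le> \<Phi> y}"
        using AE_s_pos
      proof eventually_elim
        case (elim y)
        show ?case
        proof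
          assume y: "y \<in> space \<mu> - G"
          consider "\<not> \<bar>h * l 1 y\<bar> \<le> 1/4" | "\<not> \<bar>h\<^sup>2 * l 2 y\<bar> \<le> 1/2" | "\<not> \<bar>h ^ 3 * l 3 y\<bar> \<le> 1" | "\<not> \<bar>rel_remainder h y\<bar> \<le> 1/8"
            using y elim unfolding G_def by auto
          then have "1 \<le> \<Phi> y"
          proof cases
            case 1
            from one_le_power_if_not_small[OF this, of 6]
            have "1 \<le> 4096 * h ^ 6 * \<bar>l 1 y\<bar> ^ 6" by (simp add: power_mult_distrib abs_mult)
            then show ?thesis unfolding \<Phi>_def by (intro add_increasing2) auto
          next
            case 2
            from one_le_power_if_not_small[OF this, of 3]
            have "1 \<le> 8 * h ^ 6 * \<bar>l 2 y\<bar> ^ 3" by (simp add: power_mult_distrib abs_mult flip: power_mult)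
            then show ?thesis unfolding \<Phi>_def by (intro add_increasing2[of _ _ "_ + _"] add_increasing) auto
          next
            case 3
            from one_le_power_if_not_small[OF this, of 2]
            have "1 \<le> h ^ 6 * (l 3 y)\<^sup>2" by (simp add: power_mult_distrib abs_mult flip: power_mult)
            then show ?thesis unfolding \<Phi>_def by (intro add_increasing2[of _ _ "_ + _"] add_increasing) auto
          next
            case 4
            from one_le_power_if_not_small[OF this, of 2]
            have "1 \<le> 64 * (rel_remainder h y)\<^sup>2" by (simp add: power_mult_distrib)
            then show ?thesis unfolding \<Phi>_def by (intro add_increasing) auto
          qed
          with y show "y \<in> {y \<in> space D. 1 \<le> \<Phi> y}" by (simp add: space_model)
        qed
      qed
      have "\<Phi> \<in> borel_measurable D" using \<Phi>_int by auto
      then show "{y \<in> space D. 1 \<le> \<Phi> y} \<in> events" by measurable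
    qed
    also have "\<dots> \<le> (LINT y|D. \<Phi> y) / 1"
      by (rule integral_Markov_inequality_measure[OF \<Phi>_int sets.top]) (auto simp: \<Phi>_nn)
    also have "\<dots> \<le> C * h ^ 6" using E\<Phi> by simp
    also have "\<dots> \<le> \<epsilon> * h ^ 4"
    proof -
      have "h\<^sup>2 = \<bar>h\<bar> * \<bar>h\<bar>" by (simp add: power2_eq_square)
      also have "\<dots> \<le> \<bar>h\<bar> * 1" using h1 by (intro mult_left_mono) auto
      finally have "C * h\<^sup>2 \<le> (C + 1) * \<bar>h\<bar>" using C by (intro mult_mono) auto
      then have "C * h\<^sup>2 \<le> \<epsilon>" using hC by (simp add: mult.commute)
      then have "C * h\<^sup>2 * h ^ 4 \<le> \<epsilon> * h ^ 4" by (intro mult_right_mono) auto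
      then show ?thesis by (simp add: mult.assoc flip: power_add)
    qed
    finally have 1: "measure D (space \<mu> - G) \<le> \<epsilon> * h ^ 4" .
    have 2: "integrable D \<psi>" unfolding \<psi>_def using rr(4) rest by simp
    have "(LINT y|D. \<psi> y) = 50 * (LINT y|D. \<bar>rel_remainder h y\<bar>) + 50 * h ^ 4 * K"
      unfolding \<psi>_def K_def using rr(4) rest by (simp add: Bochner_Integration.integral_add)
    also have "\<dots> \<le> 50 * (\<kappa> * \<bar>h\<bar> ^ 3) + \<epsilon> / 2 * \<bar>h\<bar> ^ 3"
    proof (rule add_mono)
      have "50 * \<bar>h\<bar> * K \<le> \<epsilon> / 2" using hK by (simp add: algebra_simps)
      then have "50 * \<bar>h\<bar> * K * \<bar>h\<bar> ^ 3 \<le> \<epsilon> / 2 * \<bar>h\<bar> ^ 3" by (intro mult_right_mono) auto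
      moreover have "50 * h ^ 4 * K = 50 * \<bar>h\<bar> * K * \<bar>h\<bar> ^ 3"
      proof -
        have "h ^ 4 = \<bar>h\<bar> * \<bar>h\<bar> ^ 3" by (simp flip: power_Suc)
        then show ?thesis by (simp only: ac_simps)
      qed
      ultimately show "50 * h ^ 4 * K \<le> \<epsilon> / 2 * \<bar>h\<bar> ^ 3" by (simp only:)
    qed (use rr(5) in simp)
    also have "\<dots> = \<epsilon> * \<bar>h\<bar> ^ 3" by (simp add: \<kappa>_def)
    finally have 3: "(LINT y|D. \<psi> y) \<le> \<epsilon> * \<bar>h\<bar> ^ 3" .
    have 4: "0 \<le> \<psi> y" for y using rest by (simp add: \<psi>_def)
    have 5: "0 < p \<theta> y \<and> 0 < p (\<theta> + h) y \<and> \<bar>log_remainder h y\<bar> \<le> \<psi> y" if "y \<in> G" for y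
    proof -
      have "h ^ 6 \<le> h ^ 4"
        using power_decreasing[of 4 6 "\<bar>h\<bar>"] h1 by (simp add: power_even_abs)
      then have "h ^ 6 * ((l 3 y)\<^sup>2 / 144) \<le> h ^ 4 * ((l 3 y)\<^sup>2 / 144)" by (intro mult_right_mono) auto
      then have "(h * l 1 y / 2) ^ 4 + (h\<^sup>2 * l 2 y / 4)\<^sup>2
         + \<bar>(h * l 1 y / 2) * (h ^ 3 * l 3 y / 12)\<bar> + (h ^ 3 * l 3 y / 12)\<^sup>2 \<le> h ^ 4 * rest y"
      proof -
        have "(h * l 1 y / 2) * (h ^ 3 * l 3 y / 12) = h ^ 4 * (l 1 y * l 3 y / 24)"
          by (simp add: power3_eq_cube power4_eq_xxxx)
        then have "\<bar>(h * l 1 y / 2) * (h ^ 3 * l 3 y / 12)\<bar> = h ^ 4 * (\<bar>l 1 y * l 3 y\<bar> / 24)"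
          by (simp only: abs_mult[of "h ^ 4"] abs_divide) simp
        moreover have "(h * l 1 y / 2) ^ 4 = h ^ 4 * ((l 1 y) ^ 4 / 16)"
          by (simp add: power_mult_distrib power_divide)
        moreover have "(h\<^sup>2 * l 2 y / 4)\<^sup>2 = h ^ 4 * ((l 2 y)\<^sup>2 / 16)"
          by (simp add: power_mult_distrib power_divide flip: power_mult)
        moreover have "(h ^ 3 * l 3 y / 12)\<^sup>2 = h ^ 6 * ((l 3 y)\<^sup>2 / 144)"
          by (simp add: power_mult_distrib power_divide flip: power_mult)
        ultimately show ?thesis
          using \<open>h ^ 6 * ((l 3 y)\<^sup>2 / 144) \<le> h ^ 4 * ((l 3 y)\<^sup>2 / 144)\<close>
          unfolding rest_def by (simp only: distrib_left)
      qed
      then have "50 * (\<bar>rel_remainder h y\<bar> + (h * l 1 y / 2) ^ 4 + (h\<^sup>2 * l 2 y / 4)\<^sup>2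
         + \<bar>(h * l 1 y / 2) * (h ^ 3 * l 3 y / 12)\<bar> + (h ^ 3 * l 3 y / 12)\<^sup>2) \<le> \<psi> y"
        unfolding \<psi>_def by simp
      with log_density_expansion_pointwise[of y h] that \<Theta> show ?thesis
        unfolding G_def by force
    qed
    show ?thesis using G 1 2 3 4 5 by blast
  qed
  ultimately show ?thesis by blast
qed

end

section \<open>Cubic least squares on a symmetric design\<close>

text \<open>First-order condition: \<open>t = c / (X + 1)\<close> is a small enough step in the direction of descent.\<close>
lemma stationary_if_quadratic_nonneg:
  fixes c X :: real
  assumes "\<And>t. 0 \<le> t\<^sup>2 * X - 2 * t * c" and X: "X \<ge> 0"
  shows "c = 0"
proof -
  have "0 \<le> (c / (X + 1))\<^sup>2 * X - 2 * (c / (X + 1)) * c" by (rule assms)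
  also have "\<dots> = - (c\<^sup>2 * (X + 2) / (X + 1)\<^sup>2)"
    using X by (simp add: power_divide divide_simps) (simp add: power2_eq_square algebra_simps)
  finally have "c\<^sup>2 * (X + 2) / (X + 1)\<^sup>2 \<le> 0" by simp
  moreover have "(X + 1)\<^sup>2 > 0" using X by (auto simp: zero_less_power2)
  ultimately have "c\<^sup>2 * (X + 2) \<le> 0" by (simp add: divide_le_0_iff) 
  then show ?thesis using X by (auto simp: mult_le_0_iff)
qed

text \<open>The residual is orthogonal to each regressor.  The common factor \<open>h\<^sup>k\<close> is divided out, leaving an
  equation in terms of \<open>j\<close> alone.\<close>
lemma cubic_ols_normal_equation:
  assumes ols: "cubic_ols J h z \<beta>" and h: "h > 0" and k: "k \<le> 3"
  shows "(\<Sum>j\<in>{-J..J}. (z j - (\<Sum>m\<le>3. \<beta> m * h ^ m * real_of_int j ^ m)) * real_of_int j ^ k) = 0"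
proof -
  define r where "r = (\<lambda>j. z j - (\<Sum>m\<le>3. \<beta> m * (real_of_int j * h) ^ m))"
  have "(\<Sum>j\<in>{-J..J}. r j * (real_of_int j * h) ^ k) = 0"
  proof (rule stationary_if_quadratic_nonneg)
    fix t
    have "(\<Sum>m\<le>3. (\<beta>(k := \<beta> k + t)) m * x ^ m) = (\<Sum>m\<le>3. \<beta> m * x ^ m) + t * x ^ k" for x :: real
    proof -
      have "(\<Sum>m\<le>3. (\<beta>(k := \<beta> k + t)) m * x ^ m) = (\<Sum>m\<le>3. \<beta> m * x ^ m + (if m = k then t * x ^ k else 0))"
        by (rule sum.cong) (auto simp: algebra_simps)
      then show ?thesis using k by (simp add: sum.distrib)
    qed
    note fit = this
    have "(\<Sum>j\<in>{-J..J}. (r j)\<^sup>2) \<le> (\<Sum>j\<in>{-J..J}. (r j - t * (real_of_int j * h) ^ k)\<^sup>2)"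
      using ols[unfolded cubic_ols_def, rule_format, of "\<beta>(k := \<beta> k + t)"]
      unfolding fit r_def by (simp only: diff_diff_eq)
    also have "\<dots> = (\<Sum>j\<in>{-J..J}. (r j)\<^sup>2 + (t\<^sup>2 * ((real_of_int j * h) ^ k)\<^sup>2 - 2 * t * (r j * (real_of_int j * h) ^ k)))"
      by (rule sum.cong) (auto simp: power2_diff power_mult_distrib)
    also have "\<dots> = (\<Sum>j\<in>{-J..J}. (r j)\<^sup>2) + (t\<^sup>2 * (\<Sum>j\<in>{-J..J}. ((real_of_int j * h) ^ k)\<^sup>2)
        - 2 * t * (\<Sum>j\<in>{-J..J}. r j * (real_of_int j * h) ^ k))"
      by (simp only: sum.distrib sum_subtractf sum_distrib_left)
    finally show "0 \<le> t\<^sup>2 * (\<Sum>j\<in>{-J..J}. ((real_of_int j * h) ^ k)\<^sup>2)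
        - 2 * t * (\<Sum>j\<in>{-J..J}. r j * (real_of_int j * h) ^ k)" by simp
  qed (auto intro!: sum_nonneg)
  moreover have "(\<Sum>j\<in>{-J..J}. r j * (real_of_int j * h) ^ k)
      = h ^ k * (\<Sum>j\<in>{-J..J}. r j * real_of_int j ^ k)"
    by (simp add: sum_distrib_left power_mult_distrib ac_simps)
  ultimately have "(\<Sum>j\<in>{-J..J}. r j * real_of_int j ^ k) = 0" using h by simp
  then show ?thesis by (simp add: r_def power_mult_distrib ac_simps)
qed

lemma sum_odd_power_symmetric:
  assumes "odd m" shows "(\<Sum>j\<in>{-J..J}. real_of_int j ^ m) = 0"
proof -
  have "(\<Sum>j\<in>{-J..J}. real_of_int j ^ m) = (\<Sum>j\<in>{-J..J}. real_of_int (- j) ^ m)"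
    by (rule sum.reindex_bij_witness[of _ uminus uminus]) auto
  also have "\<dots> = - (\<Sum>j\<in>{-J..J}. real_of_int j ^ m)"
    using assms by (simp add: sum_negf)
  finally show ?thesis by simp
qed

text \<open>The weights are cubic polynomials in \<open>j\<close>, hence orthogonal to the residual, and they are dual to the
  monomials.  Applied to the responses they therefore return the coefficient of \<open>j\<^sup>k\<close> in the fit, and
  applied to responses that are cubic in \<open>j\<close> up to errors they return the true coefficient plus a
  weighted sum of errors.  On a symmetric design the odd moments vanish, which splits the
  \<open>4 \<times> 4\<close> system into two of size two.\<close>
lemma cubic_ols_weights:
  fixes J :: int assumes J: "J > 1"
  obtains w :: "nat \<Rightarrow> int \<Rightarrow> real" where
    "\<And>k m. k \<in> {1..3} \<Longrightarrow> m \<le> 3 \<Longrightarrow>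
        (\<Sum>j\<in>{-J..J}. w k j * real_of_int j ^ m) = (if m = k then 1 else 0)"
    "\<And>k z h \<beta>. k \<in> {1..3} \<Longrightarrow> h > 0 \<Longrightarrow> cubic_ols J h z \<beta> \<Longrightarrow>
        \<beta> k * h ^ k = (\<Sum>j\<in>{-J..J}. w k j * z j)"
proof -
  define S where "S = (\<lambda>m::nat. \<Sum>j\<in>{-J..J}. real_of_int j ^ m)"
  have odd: "S 1 = 0" "S 3 = 0" "S 5 = 0" unfolding S_def by (rule sum_odd_power_symmetric, simp)+
  have S2: "S 2 > 0"
    unfolding S_def using J by (intro sum_pos2[of _ 1]) auto
  have S0: "S 0 > 0" using J by (simp add: S_def)
  \<comment> \<open>Strict Cauchy-Schwarz inequalities for the two determinants; \<open>j\<close> and \<open>j\<^sup>3\<close> are not proportional because \<open>J > 1\<close>.\<close>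
  have "0 < (\<Sum>j\<in>{-J..J}. (S 2 * real_of_int j ^ 3 - S 4 * real_of_int j)\<^sup>2)"
  proof (cases "S 4 = S 2")
    case True
    then have "0 < (S 2 * real_of_int 2 ^ 3 - S 4 * real_of_int 2)\<^sup>2" using S2 by simp
    then show ?thesis using J by (intro sum_pos2[of _ 2]) auto
  next
    case False
    then have "0 < (S 2 * real_of_int 1 ^ 3 - S 4 * real_of_int 1)\<^sup>2" by simp
    then show ?thesis using J by (intro sum_pos2[of _ 1]) auto
  qed
  also have "\<dots> = (\<Sum>j\<in>{-J..J}. (S 2)\<^sup>2 * real_of_int j ^ 6 - 2 * S 2 * S 4 * real_of_int j ^ 4 + (S 4)\<^sup>2 * real_of_int j ^ 2)"
    by (rule sum.cong) (simp_all add: power2_eq_square eval_nat_numeral algebra_simps)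
  also have "\<dots> = (S 2)\<^sup>2 * S 6 - 2 * S 2 * S 4 * S 4 + (S 4)\<^sup>2 * S 2"
    by (simp only: S_def sum.distrib sum_subtractf sum_distrib_left)
  also have "\<dots> = S 2 * (S 2 * S 6 - (S 4)\<^sup>2)" by (simp add: power2_eq_square algebra_simps)
  finally have D1: "S 2 * S 6 - (S 4)\<^sup>2 > 0" using S2 by (simp add: zero_less_mult_iff)
  have "0 < (\<Sum>j\<in>{-J..J}. (S 0 * real_of_int j ^ 2 - S 2)\<^sup>2)"
    using J S2 by (intro sum_pos2[of _ 0]) auto
  also have "\<dots> = (\<Sum>j\<in>{-J..J}. (S 0)\<^sup>2 * real_of_int j ^ 4 - 2 * S 0 * S 2 * real_of_int j ^ 2 + (S 2)\<^sup>2 * real_of_int j ^ 0)"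
    by (rule sum.cong) (simp_all add: power2_eq_square eval_nat_numeral algebra_simps)
  also have "\<dots> = (S 0)\<^sup>2 * S 4 - 2 * S 0 * S 2 * S 2 + (S 2)\<^sup>2 * S 0"
    by (simp only: S_def sum.distrib sum_subtractf sum_distrib_left)
  also have "\<dots> = S 0 * (S 0 * S 4 - (S 2)\<^sup>2)" by (simp add: power2_eq_square algebra_simps)
  finally have D2: "S 0 * S 4 - (S 2)\<^sup>2 > 0" using S0 by (simp add: zero_less_mult_iff)
  define d1 where "d1 = S 2 * S 6 - (S 4)\<^sup>2"
  define d2 where "d2 = S 0 * S 4 - (S 2)\<^sup>2"
  have d: "d1 \<noteq> 0" "d2 \<noteq> 0" using D1 D2 by (auto simp: d1_def d2_def)
  \<comment> \<open>Rows of the inverse moment matrix, by Cramer's rule for the even and the odd block.\<close>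
  define c :: "nat \<Rightarrow> nat \<Rightarrow> real" where
    "c = (\<lambda>k i. if k = 1 then (if i = 1 then S 6 / d1 else if i = 3 then - S 4 / d1 else 0)
         else if k = 2 then (if i = 0 then - S 2 / d2 else if i = 2 then S 0 / d2 else 0)
         else (if i = 1 then - S 4 / d1 else if i = 3 then S 2 / d1 else 0))"
  define w where "w = (\<lambda>k j. \<Sum>i\<le>3. c k i * real_of_int j ^ i)"
  have le3: "{..3::nat} = {0, 1, 2, 3}" by auto
  have moments: "(\<Sum>j\<in>{-J..J}. w k j * real_of_int j ^ m) = (if m = k then 1 else 0)"
    if k: "k \<in> {1..3}" and m: "m \<le> 3" for k m
  proof -
    have "(\<Sum>j\<in>{-J..J}. w k j * real_of_int j ^ m) = (\<Sum>j\<in>{-J..J}. \<Sum>i\<le>3. c k i * real_of_int j ^ (i + m))"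
      unfolding w_def by (simp add: sum_distrib_right power_add mult.assoc)
    also have "\<dots> = (\<Sum>i\<le>3. c k i * S (i + m))"
      unfolding S_def by (subst sum.swap) (simp add: sum_distrib_left)
    finally have eq: "(\<Sum>j\<in>{-J..J}. w k j * real_of_int j ^ m) = (\<Sum>i\<le>3. c k i * S (i + m))" .
    have k': "k = 1 \<or> k = 2 \<or> k = 3" and m': "m = 0 \<or> m = 1 \<or> m = 2 \<or> m = 3" using k m by auto
    have e: "S 6 / d1 * S 2 + (- S 4 / d1) * S 4 = 1" "(- S 4 / d1) * S 4 + S 2 / d1 * S 6 = 1"
      "(- S 2 / d2) * S 2 + S 0 / d2 * S 4 = 1"
    proof -
      have "S 6 / d1 * S 2 + (- S 4 / d1) * S 4 = (S 2 * S 6 - (S 4)\<^sup>2) / d1"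
        "(- S 4 / d1) * S 4 + S 2 / d1 * S 6 = (S 2 * S 6 - (S 4)\<^sup>2) / d1"
        "(- S 2 / d2) * S 2 + S 0 / d2 * S 4 = (S 0 * S 4 - (S 2)\<^sup>2) / d2"
        by (simp_all add: power2_eq_square diff_divide_distrib mult.commute)
      then show "S 6 / d1 * S 2 + (- S 4 / d1) * S 4 = 1" "(- S 4 / d1) * S 4 + S 2 / d1 * S 6 = 1"
        "(- S 2 / d2) * S 2 + S 0 / d2 * S 4 = 1"
        unfolding d1_def[symmetric] d2_def[symmetric] using d by simp_all
    qed
    show ?thesis unfolding eq le3 using k' m'
      by (elim disjE; use odd e in \<open>simp add: c_def eval_nat_numeral\<close>)
  qed
  have "\<beta> k * h ^ k = (\<Sum>j\<in>{-J..J}. w k j * z j)"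
    if k: "k \<in> {1..3}" and h: "h > 0" and ols: "cubic_ols J h z \<beta>" for k z h \<beta>
  proof -
    let ?fit = "\<lambda>j. \<Sum>m\<le>3. \<beta> m * h ^ m * real_of_int j ^ m"
    have "(\<Sum>j\<in>{-J..J}. w k j * (z j - ?fit j)) = (\<Sum>j\<in>{-J..J}. \<Sum>i\<le>3. c k i * ((z j - ?fit j) * real_of_int j ^ i))"
      unfolding w_def by (simp add: sum_distrib_left sum_distrib_right ac_simps)
    also have "\<dots> = (\<Sum>i\<le>3. c k i * (\<Sum>j\<in>{-J..J}. (z j - ?fit j) * real_of_int j ^ i))"
      by (subst sum.swap) (simp only: sum_distrib_left)
    also have "\<dots> = 0"
      using cubic_ols_normal_equation[OF ols h] by (intro sum.neutral) auto
    finally have "(\<Sum>j\<in>{-J..J}. w k j * z j) = (\<Sum>j\<in>{-J..J}. w k j * ?fit j)"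
      by (simp add: right_diff_distrib sum_subtractf)
    also have "\<dots> = (\<Sum>j\<in>{-J..J}. \<Sum>m\<le>3. \<beta> m * h ^ m * (w k j * real_of_int j ^ m))"
      by (simp add: sum_distrib_left ac_simps)
    also have "\<dots> = (\<Sum>m\<le>3. \<beta> m * h ^ m * (\<Sum>j\<in>{-J..J}. w k j * real_of_int j ^ m))"
      by (subst sum.swap) (simp only: sum_distrib_left)
    also have "\<dots> = (\<Sum>m\<le>3. \<beta> m * h ^ m * (if m = k then 1 else 0))"
      using moments[OF k] by (intro sum.cong) auto
    also have "\<dots> = \<beta> k * h ^ k" using k by (simp add: if_distrib[of "\<lambda>x. _ * x"] cong: if_cong)
    finally show ?thesis by simp
  qed
  with moments show ?thesis using that by blast
qed

text \<open>The witness has the sign of \<open>b3\<close> and is large enough that the cubic term absorbs the rest.\<close>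
lemma cubic_unbounded:
  fixes b1 b2 b3 :: real
  assumes "b3 \<noteq> 0" shows "\<exists>x. b1 * x + b2 * x\<^sup>2 + b3 * x ^ 3 > K"
proof -
  define c where "c = \<bar>b1\<bar> + \<bar>b2\<bar> + \<bar>K\<bar>"
  define y where "y = 1 + c / \<bar>b3\<bar>"
  have y: "y \<ge> 1" by (simp add: y_def c_def)
  have b3y: "\<bar>b3\<bar> * y = \<bar>b3\<bar> + c"
    using assms by (simp add: y_def distrib_left)
  have y2: "1 \<le> y\<^sup>2" using y by (rule one_le_power)
  have y3: "y \<le> y\<^sup>2" using mult_left_mono[OF y, of y] y by (simp add: power2_eq_square)
  define x where "x = sgn b3 * y"
  have sq: "sgn b3 * sgn b3 = 1" using assms by (simp add: sgn_if)
  have "b3 * x ^ 3 = (b3 * sgn b3) * (sgn b3 * sgn b3) * y ^ 3"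
    by (simp add: x_def power3_eq_cube ac_simps)
  also have "\<dots> = (\<bar>b3\<bar> * y) * y\<^sup>2" unfolding sq
    by (simp add: abs_sgn power3_eq_cube power2_eq_square ac_simps)
  also have "\<dots> = (\<bar>b3\<bar> + \<bar>K\<bar>) * y\<^sup>2 + \<bar>b2\<bar> * y\<^sup>2 + \<bar>b1\<bar> * y\<^sup>2" unfolding b3y c_def by (simp add: algebra_simps)
  finally have 3: "b3 * x ^ 3 = (\<bar>b3\<bar> + \<bar>K\<bar>) * y\<^sup>2 + \<bar>b2\<bar> * y\<^sup>2 + \<bar>b1\<bar> * y\<^sup>2" .
  have "x\<^sup>2 = (sgn b3 * sgn b3) * y\<^sup>2" by (simp add: x_def power2_eq_square ac_simps)
  then have x2: "x\<^sup>2 = y\<^sup>2" unfolding sq by simp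
  have "b2 * x\<^sup>2 \<ge> - (\<bar>b2\<bar> * y\<^sup>2)" unfolding x2
    using mult_right_mono[of "- \<bar>b2\<bar>" b2 "y\<^sup>2"] by simp
  moreover have "b1 * x \<ge> - (\<bar>b1\<bar> * y\<^sup>2)"
  proof -
    have "\<bar>b1 * x\<bar> \<le> \<bar>b1\<bar> * y" unfolding x_def abs_mult using y assms
      by (auto simp: sgn_if)
    also have "\<dots> \<le> \<bar>b1\<bar> * y\<^sup>2" using y3 by (intro mult_left_mono) auto
    finally show ?thesis by linarith
  qed
  moreover have "(\<bar>b3\<bar> + \<bar>K\<bar>) * y\<^sup>2 \<ge> (\<bar>b3\<bar> + \<bar>K\<bar>) * 1" using y2 by (intro mult_left_mono) auto
  ultimately have "b1 * x + b2 * x\<^sup>2 + b3 * x ^ 3 \<ge> \<bar>b3\<bar> + \<bar>K\<bar>" unfolding 3 by argo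
  moreover have "\<bar>b3\<bar> + \<bar>K\<bar> > K" using assms by linarith
  ultimately show ?thesis by (intro exI[of _ x]) linarith
qed

text \<open>A global maximizer forces the cubic coefficient to vanish, and is then a stationary point of a
  quadratic.  Otherwise the maximum is over \<open>[- J, J]\<close>; comparison with the value \<open>0\<close> at \<open>0\<close> and the
  first-order condition at an interior point are what the next lemma needs.\<close>
lemma cubic_argmax_cases:
  fixes h :: real and \<beta> :: "nat \<Rightarrow> real"
  defines "b1 \<equiv> \<beta> 1 * h ^ 1" and "b2 \<equiv> \<beta> 2 * h ^ 2" and "b3 \<equiv> \<beta> 3 * h ^ 3"
  assumes x: "cubic_argmax J h \<beta> x" and J: "J > 0"
  shows "(b3 = 0 \<and> b1 + 2 * b2 * x = 0) \<or>
    (\<bar>x\<bar> \<le> real_of_int J \<and> 0 \<le> b1 * x + b2 * x\<^sup>2 + b3 * x ^ 3 \<and>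
     (\<bar>x\<bar> < real_of_int J \<longrightarrow> b1 + 2 * b2 * x + 3 * b3 * x\<^sup>2 = 0))"
proof -
  define f where "f = (\<lambda>x. b1 * x + b2 * x\<^sup>2 + b3 * x ^ 3)"
  have fit: "fitted_cubic h \<beta> = f"
    by (rule ext) (simp add: fitted_cubic_def f_def b1_def b2_def b3_def power_mult_distrib)
  have f': "(f has_real_derivative b1 + 2 * b2 * x + 3 * b3 * x\<^sup>2) (at x)" for x
    unfolding f_def by (auto intro!: derivative_eq_intros)
  have argmax: "is_arg_max f P y \<longleftrightarrow> P y \<and> (\<forall>z. P z \<longrightarrow> f z \<le> f y)" for P y
    by (auto simp: is_arg_max_linorder)
  show ?thesis
  proof (cases "\<exists>u. is_arg_max f (\<lambda>_. True) u")
    case True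
    then have mx: "f z \<le> f x" for z
      using x unfolding cubic_argmax_def fit argmax by simp
    have "b3 = 0"
    proof (rule ccontr)
      assume "b3 \<noteq> 0"
      from cubic_unbounded[OF this, of "f x" b1 b2] obtain z where "f x < f z"
        unfolding f_def by blast
      with mx[of z] show False by simp
    qed
    moreover have "b1 + 2 * b2 * x + 3 * b3 * x\<^sup>2 = 0"
      by (rule DERIV_local_max[OF f', of 1]) (auto intro: mx)
    ultimately show ?thesis by simp
  next
    case False
    then have mx: "\<bar>x\<bar> \<le> real_of_int J" "\<And>z. \<bar>z\<bar> \<le> real_of_int J \<Longrightarrow> f z \<le> f x"
      using x unfolding cubic_argmax_def fit if_not_P[OF False] argmax by (auto simp: abs_le_iff)
    have "f 0 \<le> f x" using J by (intro mx) simp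
    then have "0 \<le> f x" by (simp add: f_def)
    moreover have "b1 + 2 * b2 * x + 3 * b3 * x\<^sup>2 = 0" if "\<bar>x\<bar> < real_of_int J"
    proof (rule DERIV_local_max[OF f', of "real_of_int J - \<bar>x\<bar>"])
      show "0 < real_of_int J - \<bar>x\<bar>" using that by simp
      show "\<forall>y. \<bar>x - y\<bar> < real_of_int J - \<bar>x\<bar> \<longrightarrow> f y \<le> f x"
        by (intro allI impI mx) linarith
    qed
    ultimately show ?thesis using mx(1) by (simp add: f_def)
  qed
qed

text \<open>For large \<open>N\<close> (the role of \<open>n\<^sup>1\<^sup>/\<^sup>4\<close>) the quadratic term, of order \<open>N\<^sup>2\<close>, dominates the other two, of
  order \<open>N\<close>.  Since the maximum is nonnegative, this confines the maximizer to \<open>\<bar>x\<bar> = O(1 / N)\<close>, inside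
  the interval, so the derivative vanishes, and in that equation the cubic term is \<open>O(x\<^sup>2)\<close>.\<close>
lemma cubic_argmax_near_quadratic:
  fixes \<beta> :: "nat \<Rightarrow> real" and N U V Q x :: real
  assumes x: "cubic_argmax J h \<beta> x" and J: "J > 0" and N: "N > 0"
    and b: "\<beta> 1 * h ^ 1 = N * V" "\<beta> 2 * h ^ 2 = N\<^sup>2 * U" "\<beta> 3 * h ^ 3 = N * Q"
    and U: "U < 0" and small: "(\<bar>V\<bar> + (real_of_int J)\<^sup>2 * \<bar>Q\<bar>) / (\<bar>U\<bar> * N) < real_of_int J"
  shows "\<bar>N * x - V / (- 2 * U)\<bar>
     \<le> 3 * \<bar>Q\<bar> * ((\<bar>V\<bar> + (real_of_int J)\<^sup>2 * \<bar>Q\<bar>) / (\<bar>U\<bar> * N))\<^sup>2 / (2 * \<bar>U\<bar>)"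
proof -
  define B where "B = (\<bar>V\<bar> + (real_of_int J)\<^sup>2 * \<bar>Q\<bar>) / (\<bar>U\<bar> * N)"
  have B: "B \<ge> 0" using N by (simp add: B_def)
  from cubic_argmax_cases[OF x J, unfolded b]
  consider "N * V + 2 * (N\<^sup>2 * U) * x = 0" |
    "\<bar>x\<bar> \<le> real_of_int J" "0 \<le> N * V * x + N\<^sup>2 * U * x\<^sup>2 + N * Q * x ^ 3"
     "\<bar>x\<bar> < real_of_int J \<Longrightarrow> N * V + 2 * (N\<^sup>2 * U) * x + 3 * (N * Q) * x\<^sup>2 = 0" by blast
  then show ?thesis
  proof cases
    case 1
    then have "N * (V + 2 * U * (N * x)) = 0" by (simp add: power2_eq_square algebra_simps)
    then have "V + 2 * U * (N * x) = 0" using N by simp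
    then have "N * x = V / (- 2 * U)" using U by (simp add: field_simps)
    then show ?thesis by simp
  next
    case 2
    have xB: "\<bar>x\<bar> \<le> B"
    proof (cases "x = 0")
      case False
      have "0 \<le> N * (V * x + N * U * x\<^sup>2 + Q * x ^ 3)" using 2(2) by (simp add: power2_eq_square algebra_simps)
      then have "N * \<bar>U\<bar> * x\<^sup>2 \<le> V * x + Q * x ^ 3" using N U by (simp add: zero_le_mult_iff)
      also have "\<dots> \<le> \<bar>V\<bar> * \<bar>x\<bar> + \<bar>Q\<bar> * (x\<^sup>2 * \<bar>x\<bar>)"
        using abs_ge_self[of "V * x"] abs_ge_self[of "Q * x ^ 3"]
        by (simp add: abs_mult power3_eq_cube power2_eq_square)
      also have "\<dots> \<le> \<bar>V\<bar> * \<bar>x\<bar> + \<bar>Q\<bar> * ((real_of_int J)\<^sup>2 * \<bar>x\<bar>)"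
        using 2(1) by (intro add_left_mono mult_left_mono mult_right_mono) (auto simp: abs_le_square_iff[symmetric])
      finally have "(N * \<bar>U\<bar> * \<bar>x\<bar>) * \<bar>x\<bar> \<le> (\<bar>V\<bar> + (real_of_int J)\<^sup>2 * \<bar>Q\<bar>) * \<bar>x\<bar>"
        by (simp add: power2_eq_square algebra_simps)
      then have "N * \<bar>U\<bar> * \<bar>x\<bar> \<le> \<bar>V\<bar> + (real_of_int J)\<^sup>2 * \<bar>Q\<bar>" using False by simp
      then have "\<bar>x\<bar> * (\<bar>U\<bar> * N) \<le> \<bar>V\<bar> + (real_of_int J)\<^sup>2 * \<bar>Q\<bar>" by (simp only: ac_simps)
      moreover have "\<bar>U\<bar> * N > 0" using N U by (intro mult_pos_pos) auto
      ultimately show ?thesis by (simp only: B_def pos_le_divide_eq)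
    qed (use B in simp)
    then have "\<bar>x\<bar> < real_of_int J" using small by (simp add: B_def)
    from 2(3)[OF this] have "N * (V + 2 * U * (N * x) + 3 * Q * x\<^sup>2) = 0" by (simp add: power2_eq_square algebra_simps)
    then have "V + 2 * U * (N * x) + 3 * Q * x\<^sup>2 = 0" using N by simp
    then have "- 2 * U * (N * x) - V = 3 * Q * x\<^sup>2" by simp
    moreover have "N * x - V / (- 2 * U) = (- 2 * U * (N * x) - V) / (- 2 * U)"
      using U by (simp add: diff_divide_distrib)
    ultimately have "N * x - V / (- 2 * U) = 3 * Q * x\<^sup>2 / (- 2 * U)" by simp
    then have "\<bar>N * x - V / (- 2 * U)\<bar> = 3 * \<bar>Q\<bar> * x\<^sup>2 / (2 * \<bar>U\<bar>)" using U by (simp add: abs_mult abs_divide)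
    also have "\<dots> \<le> 3 * \<bar>Q\<bar> * B\<^sup>2 / (2 * \<bar>U\<bar>)"
      using xB B U by (intro divide_right_mono mult_left_mono) (auto simp: abs_le_square_iff[symmetric])
    finally show ?thesis by (simp add: B_def)
  qed
qed

section \<open>The log likelihood at an i.i.d. sample\<close>

locale iid_regular = regular_point \<mu> \<Theta> p sd \<theta> + prob_space M
  for \<mu> :: "'y measure" and \<Theta> p sd \<theta> and M :: "'w measure" +
  fixes Y :: "nat \<Rightarrow> 'w \<Rightarrow> 'y"
  assumes data: "iid_sample M \<mu> (model \<mu> p \<theta>) Y"
begin

lemma Y_measurable [measurable]: "Y i \<in> measurable M \<mu>"
  using data by (auto simp: iid_sample_def indep_vars_def)

lemma distr_Y: "distr M \<mu> (Y i) = D"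
  using data by (simp add: iid_sample_def)

lemma prob_Y: "A \<in> sets \<mu> \<Longrightarrow> prob {\<omega>\<in>space M. Y i \<omega> \<in> A} = measure D A"
  unfolding distr_Y[of i, symmetric]
  by (subst measure_distr) (auto simp: vimage_def Int_def conj_commute)

lemma integrable_Y:
  fixes f :: "'y \<Rightarrow> real"
  shows "f \<in> borel_measurable \<mu> \<Longrightarrow> integrable M (\<lambda>\<omega>. f (Y i \<omega>)) \<longleftrightarrow> integrable D f"
  unfolding distr_Y[of i, symmetric] by (subst integrable_distr_eq) auto

lemma expectation_Y:
  fixes f :: "'y \<Rightarrow> real"
  shows "f \<in> borel_measurable \<mu> \<Longrightarrow> expectation (\<lambda>\<omega>. f (Y i \<omega>)) = (LINT y|D. f y)"
  unfolding distr_Y[of i, symmetric] by (subst integral_distr) auto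

lemma indep_Y: "f \<in> borel_measurable \<mu> \<Longrightarrow> indep_vars (\<lambda>_. borel) (\<lambda>i \<omega>. f (Y i \<omega>)) UNIV"
  using data unfolding iid_sample_def by (intro indep_vars_compose2[where Y = "\<lambda>_. f"]) auto

text \<open>The coefficients of the expansion of the log likelihood.\<close>
definition A1 :: "nat \<Rightarrow> 'w \<Rightarrow> real" where "A1 n \<omega> = (\<Sum>i<n. l 1 (Y i \<omega>))"
definition A2 :: "nat \<Rightarrow> 'w \<Rightarrow> real" where "A2 n \<omega> = (\<Sum>i<n. q2 (Y i \<omega>))"
definition A3 :: "nat \<Rightarrow> 'w \<Rightarrow> real" where "A3 n \<omega> = (\<Sum>i<n. q3 (Y i \<omega>))"

lemma A1_measurable [measurable]: "A1 n \<in> borel_measurable M"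
proof -
  have [measurable]: "l 1 \<in> borel_measurable \<mu>" by (rule score_measurable) simp
  show ?thesis unfolding A1_def[abs_def] by measurable
qed

text \<open>Second moments of \<open>q2\<close> are for the law of large numbers; for \<open>q3\<close> a first moment is enough, since
  only the order of magnitude of \<open>A3\<close> matters.\<close>
lemma q_square_integrable: "integrable D (\<lambda>y. (q2 y)\<^sup>2)" "integrable D q3"
proof -
  have le: "(q2 y)\<^sup>2 \<le> (l 2 y)\<^sup>2 + (l 1 y) ^ 4" for y
  proof -
    have "(q2 y)\<^sup>2 = (l 2 y)\<^sup>2 / 4 - l 2 y * (l 1 y)\<^sup>2 / 4 + (l 1 y) ^ 4 / 16"
      by (simp add: q2_def power2_diff power_divide flip: power_mult)
    moreover have "0 \<le> (l 2 y / 2 + (l 1 y)\<^sup>2 / 4)\<^sup>2" by simp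
    then have "0 \<le> (l 2 y)\<^sup>2 / 4 + l 2 y * (l 1 y)\<^sup>2 / 4 + (l 1 y) ^ 4 / 16"
      by (simp add: power2_sum power_divide flip: power_mult)
    moreover have "0 \<le> (l 2 y)\<^sup>2" "0 \<le> (l 1 y) ^ 4" by auto
    ultimately show ?thesis by linarith
  qed
  show "integrable D (\<lambda>y. (q2 y)\<^sup>2)"
    by (rule integrable_model_bound[OF Bochner_Integration.integrable_add[OF score_lower_moments(6,4)]])
      (use le in auto)
  show "integrable D q3"
    unfolding q3_def[abs_def] using score_lower_moments score_product_moments by auto
qed

lemma A2_limit: "((\<lambda>x. A2 (fst x) (snd x) / real (fst x)) \<longlongrightarrow> - I / 2) (in_prob M)"
  unfolding A2_def
proof (rule weak_law_of_large_numbers)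
  show "indep_vars (\<lambda>_. borel) (\<lambda>i \<omega>. q2 (Y i \<omega>)) UNIV" by (rule indep_Y) measurable
  show "integrable M (\<lambda>\<omega>. (q2 (Y i \<omega>))\<^sup>2)" for i
    using integrable_Y[of "\<lambda>y. (q2 y)\<^sup>2" i] q_square_integrable by simp
  show "expectation (\<lambda>\<omega>. q2 (Y i \<omega>)) = - I / 2" for i
    using expectation_Y[of q2 i] second_score_mean by (simp add: q2_def)
  show "expectation (\<lambda>\<omega>. (q2 (Y i \<omega>))\<^sup>2) = (LINT y|D. (q2 y)\<^sup>2)" for i
    using expectation_Y[of "\<lambda>y. (q2 y)\<^sup>2" i] by simp
qed

lemma A3_bounded: "bounded_in_prob M (\<lambda>x. A3 (fst x) (snd x) / real (fst x))"
proof (rule bounded_in_prob_of_expectation[of "\<lambda>n \<omega>. A3 n \<omega> / real n"])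
  have int: "integrable M (\<lambda>\<omega>. q3 (Y i \<omega>))" for i
    using integrable_Y[of q3 i] q_square_integrable by simp
  then show 1: "integrable M (\<lambda>\<omega>. A3 n \<omega> / real n)" for n
    unfolding A3_def by auto
  fix n
  have "expectation (\<lambda>\<omega>. \<bar>A3 n \<omega> / real n\<bar>) \<le> expectation (\<lambda>\<omega>. (\<Sum>i<n. \<bar>q3 (Y i \<omega>)\<bar>) / real n)"
    using 1 int unfolding A3_def
    by (intro integral_mono integrable_abs) (auto simp: abs_divide intro!: divide_right_mono sum_abs)
  also have "\<dots> = (\<Sum>i<n. expectation (\<lambda>\<omega>. \<bar>q3 (Y i \<omega>)\<bar>)) / real n"
    using int by (simp add: Bochner_Integration.integral_sum)
  also have "\<dots> = (\<Sum>i<n. (LINT y|D. \<bar>q3 y\<bar>)) / real n"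
    using expectation_Y[of "\<lambda>y. \<bar>q3 y\<bar>"] by simp
  also have "\<dots> \<le> (LINT y|D. \<bar>q3 y\<bar>)"
    by (cases "n = 0") (auto intro!: Bochner_Integration.integral_nonneg)
  finally show "expectation (\<lambda>\<omega>. \<bar>A3 n \<omega> / real n\<bar>) \<le> (LINT y|D. \<bar>q3 y\<bar>)" .
qed

lemma score_clt: "weak_conv_m (\<lambda>n. distr M borel (\<lambda>\<omega>. A1 n \<omega> / sqrt (real n * I))) std_normal_distribution"
proof -
  have [measurable]: "l 1 \<in> borel_measurable \<mu>" by (rule score_measurable) simp
  have "weak_conv_m (\<lambda>n. distr M borel (\<lambda>\<omega>. (\<Sum>i<n. l 1 (Y i \<omega>)) / sqrt (real n * (sqrt I)\<^sup>2))) std_normal_distribution"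
  proof (rule central_limit_theorem_zero_mean)
    show "indep_vars (\<lambda>_. borel) (\<lambda>i \<omega>. l 1 (Y i \<omega>)) UNIV" by (rule indep_Y) measurable
    show m: "expectation (\<lambda>\<omega>. l 1 (Y n \<omega>)) = 0" for n
      using expectation_Y[of "l 1" n] score_mean_zero by simp
    show "sqrt I > 0" using I_pos by simp
    show "integrable M (\<lambda>\<omega>. (l 1 (Y n \<omega>))\<^sup>2)" for n
      using integrable_Y[of "\<lambda>y. (l 1 y)\<^sup>2" n] score_lower_moments by simp
    show "variance (\<lambda>\<omega>. l 1 (Y n \<omega>)) = (sqrt I)\<^sup>2" for n
      using expectation_Y[of "\<lambda>y. (l 1 y)\<^sup>2" n] m[of n] I_pos by (simp add: fisher_info_def)
    show "distr M borel (\<lambda>\<omega>. l 1 (Y n \<omega>)) = distr D borel (l 1)" for n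
      unfolding distr_Y[of n, symmetric] by (subst distr_distr) (auto simp: comp_def)
  qed
  then show ?thesis using I_pos by (simp add: A1_def)
qed

lemma A1_bounded: "bounded_in_prob M (\<lambda>x. A1 (fst x) (snd x) / sqrt (real (fst x)))"
proof -
  have "bounded_in_prob M (\<lambda>x. A1 (fst x) (snd x) / sqrt (real (fst x) * I))"
    by (rule weak_conv_imp_bounded_in_prob[OF _ _ _ score_clt])
      (auto intro: real_dist_normal_dist isCont_cdf_normal)
  then have "bounded_in_prob M (\<lambda>x. A1 (fst x) (snd x) / sqrt (real (fst x) * I) * sqrt I)"
    by (intro bounded_in_prob_mult bounded_in_prob_const)
  then show ?thesis using I_pos by (simp add: real_sqrt_mult)
qed

end

definition rate :: "nat \<Rightarrow> real" where "rate n = real n powr (- 1 / 4)"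

lemma rate_pos: "n > 0 \<Longrightarrow> rate n > 0"
  by (simp add: rate_def)

lemma rate_square: "n > 0 \<Longrightarrow> (rate n)\<^sup>2 = 1 / sqrt (real n)"
  by (simp add: rate_def powr_half_sqrt powr_minus_divide flip: powr_numeral powr_powr)
   (simp add: powr_powr powr_half_sqrt[symmetric] powr_minus_divide[symmetric])

lemma rate_fourth: "n > 0 \<Longrightarrow> rate n ^ 4 = 1 / real n"
proof -
  assume n: "n > 0"
  have "rate n ^ 4 = ((rate n)\<^sup>2)\<^sup>2" by (simp flip: power_mult)
  then show ?thesis by (simp add: rate_square[OF n] power_divide)
qed

lemma rate_tendsto: "rate \<longlonglongrightarrow> 0"
  unfolding rate_def[abs_def] by (rule tendsto_neg_powr) (auto intro: filterlim_real_sequentially)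

context iid_regular
begin

definition expansion_error :: "real \<Rightarrow> nat \<Rightarrow> 'w \<Rightarrow> real" where
  "expansion_error h n \<omega> = rate n * (log_lik p Y n (\<theta> + h) \<omega> - log_lik p Y n \<theta> \<omega>
          - (h * A1 n \<omega> + h\<^sup>2 * A2 n \<omega> + h ^ 3 * A3 n \<omega>))"

text \<open>Summation of the expansion for one observation, uniformly over deterministic \<open>h = O(n\<^sup>-\<^sup>1\<^sup>/\<^sup>4)\<close>: a
  union bound over the sample for the exceptional events, and Markov's inequality for the sum of the
  error bounds.\<close>
lemma log_lik_expansion_event:
  assumes B: "B > 0" and e: "e > 0" and \<rho>: "\<rho> > 0"
  shows "\<forall>\<^sub>F n in sequentially. \<forall>h. \<bar>h\<bar> \<le> B * rate n \<longrightarrow>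
    (\<exists>A\<in>events. prob (space M - A) \<le> e \<and> (\<forall>\<omega>\<in>A. (\<forall>i<n. 0 < p (\<theta> + h) (Y i \<omega>)) \<and>
       \<bar>expansion_error h n \<omega>\<bar> \<le> \<rho>))"
proof -
  \<comment> \<open>The union bound costs \<open>\<epsilon> B\<^sup>4\<close> and Markov's inequality \<open>\<epsilon> B\<^sup>3 / \<rho>\<close>.\<close>
  define \<epsilon> where "\<epsilon> = min (e / (2 * B ^ 4)) (e * \<rho> / (2 * B ^ 3))"
  have \<epsilon>: "\<epsilon> > 0" using B e \<rho> by (simp add: \<epsilon>_def)
  have \<epsilon>1: "\<epsilon> * B ^ 4 \<le> e / 2" and \<epsilon>2: "\<epsilon> * B ^ 3 / \<rho> \<le> e / 2"
  proof -
    have "\<epsilon> * B ^ 4 \<le> e / (2 * B ^ 4) * B ^ 4" using B by (intro mult_right_mono) (auto simp: \<epsilon>_def)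
    then show "\<epsilon> * B ^ 4 \<le> e / 2" using B by simp
    have "\<epsilon> * B ^ 3 / \<rho> \<le> e * \<rho> / (2 * B ^ 3) * B ^ 3 / \<rho>"
      using B \<rho> by (intro divide_right_mono mult_right_mono) (auto simp: \<epsilon>_def)
    then show "\<epsilon> * B ^ 3 / \<rho> \<le> e / 2" using B \<rho> by simp
  qed
  obtain \<eta> where \<eta>: "\<eta> > 0" and G: "\<And>h. \<bar>h\<bar> < \<eta> \<Longrightarrow> \<exists>G\<in>sets \<mu>. \<exists>\<psi>. measure D (space \<mu> - G) \<le> \<epsilon> * h ^ 4 \<and>
     integrable D \<psi> \<and> (LINT y|D. \<psi> y) \<le> \<epsilon> * \<bar>h\<bar> ^ 3 \<and> (\<forall>y. 0 \<le> \<psi> y) \<and>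
     (\<forall>y\<in>G. 0 < p \<theta> y \<and> 0 < p (\<theta> + h) y \<and> \<bar>log_remainder h y\<bar> \<le> \<psi> y)"
    using log_density_expansion[OF \<epsilon>] by auto
  have "(\<lambda>n. B * rate n) \<longlonglongrightarrow> B * 0" by (intro tendsto_mult tendsto_const rate_tendsto)
  then have "\<forall>\<^sub>F n in sequentially. B * rate n < \<eta>"
    using \<eta> by (intro order_tendstoD) auto
  with eventually_gt_at_top[of 0] show ?thesis
  proof eventually_elim
    case (elim n)
    have d: "rate n > 0" by (rule rate_pos) fact
    have n: "real n = 1 / rate n ^ 4" by (simp add: rate_fourth[OF elim(1)])
    show ?case
    proof (intro allI impI)
      fix h assume h: "\<bar>h\<bar> \<le> B * rate n"
      then have "\<bar>h\<bar> < \<eta>" using elim by simp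
      from G[OF this] obtain G \<psi> where G: "G \<in> sets \<mu>" "measure D (space \<mu> - G) \<le> \<epsilon> * h ^ 4"
        and \<psi>: "integrable D \<psi>" "(LINT y|D. \<psi> y) \<le> \<epsilon> * \<bar>h\<bar> ^ 3" "\<And>y. 0 \<le> \<psi> y"
        and exp: "\<And>y. y \<in> G \<Longrightarrow> 0 < p \<theta> y \<and> 0 < p (\<theta> + h) y \<and> \<bar>log_remainder h y\<bar> \<le> \<psi> y"
        by blast
      note [measurable] = G(1)
      have \<psi>m [measurable]: "\<psi> \<in> borel_measurable \<mu>"
        using borel_measurable_integrable[OF \<psi>(1)] by simp
      define R where "R = (\<lambda>\<omega>. \<Sum>i<n. \<psi> (Y i \<omega>))"
      have Rint: "integrable M R" unfolding R_def using integrable_Y[OF \<psi>m] \<psi>(1) by auto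
      have R0: "0 \<le> R \<omega>" for \<omega> unfolding R_def using \<psi>(3) by (intro sum_nonneg) auto
      have ER: "expectation R = real n * (LINT y|D. \<psi> y)"
        unfolding R_def using integrable_Y[OF \<psi>m] expectation_Y[OF \<psi>m] \<psi>(1)
        by (subst Bochner_Integration.integral_sum) auto
      define Bad where "Bad = (\<lambda>i. {\<omega>\<in>space M. Y i \<omega> \<in> space \<mu> - G})"
      define L where "L = {\<omega>\<in>space M. \<rho> / rate n \<le> R \<omega>}"
      have Bad: "Bad i \<in> events" for i unfolding Bad_def by measurable
      have Rm: "R \<in> borel_measurable M" using Rint by simp
      have L: "L \<in> events" unfolding L_def using Rm by measurable
      define A where "A = space M - ((\<Union>i\<in>{..<n}. Bad i) \<union> L)"
      have A: "A \<in> events" unfolding A_def using Bad L by auto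
      have h4: "h ^ 4 \<le> B ^ 4 * rate n ^ 4" and h3: "\<bar>h\<bar> ^ 3 \<le> B ^ 3 * rate n ^ 3"
      proof -
        have "\<bar>h\<bar> ^ k \<le> (B * rate n) ^ k" for k using h by (intro power_mono) auto
        from this[of 4] this[of 3]
        show "h ^ 4 \<le> B ^ 4 * rate n ^ 4" "\<bar>h\<bar> ^ 3 \<le> B ^ 3 * rate n ^ 3"
          by (auto simp: power_mult_distrib power_even_abs)
      qed
      have PBad: "prob (Bad i) \<le> \<epsilon> * h ^ 4" for i
        unfolding Bad_def using prob_Y[of "space \<mu> - G" i] G by simp
      have "prob (\<Union>i\<in>{..<n}. Bad i) \<le> (\<Sum>i<n. prob (Bad i))"
        using Bad by (intro measure_UNION_le) auto
      also have "\<dots> \<le> (\<Sum>i<n. \<epsilon> * h ^ 4)" by (intro sum_mono PBad)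
      also have "\<dots> = real n * (\<epsilon> * h ^ 4)" by simp
      also have "\<dots> \<le> real n * (\<epsilon> * (B ^ 4 * rate n ^ 4))"
        using \<epsilon> h4 by (intro mult_left_mono) auto
      also have "\<dots> = \<epsilon> * B ^ 4" unfolding n using d by simp
      finally have P1: "prob (\<Union>i\<in>{..<n}. Bad i) \<le> e / 2" using \<epsilon>1 by simp
      have "prob L \<le> expectation R / (\<rho> / rate n)"
        unfolding L_def using \<rho> d R0 by (intro integral_Markov_inequality_measure[OF Rint sets.top]) auto
      also have "\<dots> \<le> real n * (\<epsilon> * (B ^ 3 * rate n ^ 3)) / (\<rho> / rate n)"
      proof -
        have "(LINT y|D. \<psi> y) \<le> \<epsilon> * (B ^ 3 * rate n ^ 3)"
          using \<psi>(2) mult_left_mono[OF h3, of \<epsilon>] \<epsilon> by linarith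
        then show ?thesis unfolding ER using \<rho> d by (intro divide_right_mono mult_left_mono) auto
      qed
      also have "\<dots> = \<epsilon> * B ^ 3 / \<rho>" unfolding n using d \<rho> by (simp add: eval_nat_numeral)
      finally have P2: "prob L \<le> e / 2" by (rule order_trans[OF _ \<epsilon>2])
      have "space M - A = (\<Union>i\<in>{..<n}. Bad i) \<union> L" unfolding A_def using Bad L sets.sets_into_space by blast
      then have "prob (space M - A) \<le> prob (\<Union>i\<in>{..<n}. Bad i) + prob L"
        using Bad L by (simp add: measure_Un_le sets.finite_UN)
      then have PA: "prob (space M - A) \<le> e" using P1 P2 by simp
      have "(\<forall>i<n. 0 < p (\<theta> + h) (Y i \<omega>)) \<and>
       \<bar>expansion_error h n \<omega>\<bar> \<le> \<rho>" if \<omega>: "\<omega> \<in> A" for \<omega>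
      proof
        have sp: "\<omega> \<in> space M" using \<omega> by (simp add: A_def)
        have in_G: "Y i \<omega> \<in> G" if "i < n" for i
          using \<omega> that sp measurable_space[OF Y_measurable sp, of i] by (auto simp: A_def Bad_def)
        show "\<forall>i<n. 0 < p (\<theta> + h) (Y i \<omega>)" using in_G exp by blast
        have eq: "expansion_error h n \<omega> = rate n * (\<Sum>i<n. log_remainder h (Y i \<omega>))"
          unfolding expansion_error_def log_lik_def A1_def A2_def A3_def log_remainder_def
          by (simp only: sum_subtractf sum.distrib sum_distrib_left)
        have "\<bar>\<Sum>i<n. log_remainder h (Y i \<omega>)\<bar>
          \<le> (\<Sum>i<n. \<psi> (Y i \<omega>))"
          using in_G exp by (intro sum_abs[THEN order_trans] sum_mono) blast
        also have "\<dots> \<le> \<rho> / rate n" using \<omega> sp by (auto simp: A_def L_def R_def)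
        finally show "\<bar>expansion_error h n \<omega>\<bar> \<le> \<rho>"
          unfolding eq abs_mult using d by (simp add: pos_le_divide_eq mult.commute)
      qed
      with A PA show "\<exists>A\<in>events. prob (space M - A) \<le> e \<and> (\<forall>\<omega>\<in>A. (\<forall>i<n. 0 < p (\<theta> + h) (Y i \<omega>)) \<and>
       \<bar>expansion_error h n \<omega>\<bar> \<le> \<rho>)" by blast
    qed
  qed
qed

text \<open>The same at the random points \<open>g + c n\<^sup>-\<^sup>1\<^sup>/\<^sup>4\<close>.\<close>
lemma log_lik_expansion_on_grid:
  fixes g :: "nat \<Rightarrow> 'w \<Rightarrow> real" and a :: "nat \<Rightarrow> real"
  assumes bdd: "bounded_in_prob M (\<lambda>x. sqrt (real (fst x)) * (g (fst x) (snd x) - \<theta>))"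
    and grid: "\<And>n \<omega>. \<exists>k::int. g n \<omega> = a n + (real_of_int k + 1 / 2) / sqrt (real n)"
  shows "\<forall>\<^sub>F x in in_prob M. \<forall>i<fst x. 0 < p (g (fst x) (snd x) + c * rate (fst x)) (Y i (snd x))"
    "((\<lambda>x. expansion_error (g (fst x) (snd x) + c * rate (fst x) - \<theta>) (fst x) (snd x)) \<longlongrightarrow> 0) (in_prob M)"
proof -
  have ev: "\<forall>\<^sub>F x in in_prob M. (\<forall>i<fst x. 0 < p (g (fst x) (snd x) + c * rate (fst x)) (Y i (snd x))) \<and>
       \<bar>expansion_error (g (fst x) (snd x) + c * rate (fst x) - \<theta>) (fst x) (snd x)\<bar> \<le> \<rho>" if \<rho>: "\<rho> > 0" for \<rho>
  proof (rule eventually_in_prob_grid[OF bdd grid, where Q = "\<lambda>n z \<omega>. (\<forall>i<n. 0 < p (z + c * rate n) (Y i \<omega>)) \<and>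
       \<bar>expansion_error (z + c * rate n - \<theta>) n \<omega>\<bar> \<le> \<rho>"])
    fix B e :: real assume B: "B > 0" and e: "e > 0"
    have "B + \<bar>c\<bar> > 0" using B by simp
    from log_lik_expansion_event[OF this e \<rho>] eventually_gt_at_top[of 0]
    show "\<forall>\<^sub>F n in sequentially. \<forall>z. \<bar>z - \<theta>\<bar> \<le> B / sqrt (real n) \<longrightarrow>
            (\<exists>A\<in>events. prob (space M - A) \<le> e \<and> (\<forall>\<omega>\<in>A. (\<forall>i<n. 0 < p (z + c * rate n) (Y i \<omega>)) \<and>
       \<bar>expansion_error (z + c * rate n - \<theta>) n \<omega>\<bar> \<le> \<rho>))"
    proof eventually_elim
      case (elim n)
      show ?case
      proof (intro allI impI)
        fix z assume z: "\<bar>z - \<theta>\<bar> \<le> B / sqrt (real n)"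
        have r: "rate n > 0" "rate n \<le> 1"
          using elim(2) powr_mono[of "- 1 / 4" 0 "real n"] by (auto simp: rate_def)
        have "\<bar>z - \<theta>\<bar> \<le> B * (rate n)\<^sup>2" using z rate_square[OF elim(2)] by simp
        also have "\<dots> \<le> B * (rate n * 1)" unfolding power2_eq_square using r B by (intro mult_left_mono) auto
        finally have "\<bar>z + c * rate n - \<theta>\<bar> \<le> B * rate n + \<bar>c * rate n\<bar>" by linarith
        also have "\<dots> = (B + \<bar>c\<bar>) * rate n" using r by (simp add: abs_mult distrib_right)
        finally have le: "\<bar>z + c * rate n - \<theta>\<bar> \<le> (B + \<bar>c\<bar>) * rate n" .
        have "\<theta> + (z + c * rate n - \<theta>) = z + c * rate n" by simp
        with elim(1)[rule_format, OF le]
        show "\<exists>A\<in>events. prob (space M - A) \<le> e \<and> (\<forall>\<omega>\<in>A. (\<forall>i<n. 0 < p (z + c * rate n) (Y i \<omega>)) \<and>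
       \<bar>expansion_error (z + c * rate n - \<theta>) n \<omega>\<bar> \<le> \<rho>)"
          by simp
      qed
    qed
  qed
  from ev[of 1] show "\<forall>\<^sub>F x in in_prob M. \<forall>i<fst x. 0 < p (g (fst x) (snd x) + c * rate (fst x)) (Y i (snd x))"
    by (auto elim: eventually_mono)
  show "((\<lambda>x. expansion_error (g (fst x) (snd x) + c * rate (fst x) - \<theta>) (fst x) (snd x)) \<longlongrightarrow> 0) (in_prob M)"
  proof (rule tendstoI)
    fix e :: real assume "e > 0"
    then have "e / 2 > 0" by simp
    from ev[OF this] show "\<forall>\<^sub>F x in in_prob M. dist (expansion_error (g (fst x) (snd x) + c * rate (fst x) - \<theta>) (fst x) (snd x)) 0 < e"
      by (rule eventually_mono) (use \<open>e > 0\<close> in \<open>auto simp: dist_real_def\<close>)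
  qed
qed

end

section \<open>The fitted coefficients and the estimator\<close>

lemma weighted_sum_of_cubic:
  fixes w z \<rho> :: "int \<Rightarrow> real" and \<alpha> :: "nat \<Rightarrow> real"
  assumes dual: "\<And>m. m \<le> 3 \<Longrightarrow> (\<Sum>j\<in>S. w j * real_of_int j ^ m) = (if m = k then 1 else 0)"
    and k: "k \<le> 3" and z: "\<And>j. j \<in> S \<Longrightarrow> z j = (\<Sum>m\<le>3. \<alpha> m * real_of_int j ^ m) + \<rho> j"
  shows "(\<Sum>j\<in>S. w j * z j) = \<alpha> k + (\<Sum>j\<in>S. w j * \<rho> j)"
proof -
  have "(\<Sum>j\<in>S. w j * z j) = (\<Sum>j\<in>S. (\<Sum>m\<le>3. \<alpha> m * (w j * real_of_int j ^ m)) + w j * \<rho> j)"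
    by (rule sum.cong) (auto simp: z distrib_left sum_distrib_left ac_simps)
  also have "\<dots> = (\<Sum>m\<le>3. \<alpha> m * (\<Sum>j\<in>S. w j * real_of_int j ^ m)) + (\<Sum>j\<in>S. w j * \<rho> j)"
    by (simp only: sum.distrib) (subst sum.swap, simp only: sum_distrib_left)
  also have "(\<Sum>m\<le>3. \<alpha> m * (\<Sum>j\<in>S. w j * real_of_int j ^ m)) = (\<Sum>m\<le>3. \<alpha> m * (if m = k then 1 else 0))"
    using dual by (intro sum.cong) auto
  also have "\<dots> = \<alpha> k" using k by (simp add: if_distrib[of "\<lambda>x. _ * x"] cong: if_cong)
  finally show ?thesis .
qed

text \<open>The coefficients of \<open>L + a1 h + a2 h\<^sup>2 + a3 h\<^sup>3\<close> as a polynomial in \<open>x\<close>, for \<open>h = d (x + \<tau>)\<close>.\<close>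
definition shifted_cubic_coeff :: "real \<Rightarrow> real \<Rightarrow> real \<Rightarrow> real \<Rightarrow> real \<Rightarrow> real \<Rightarrow> nat \<Rightarrow> real" where
  "shifted_cubic_coeff d \<tau> L a1 a2 a3 m =
     (if m = 0 then L + d * \<tau> * a1 + d\<^sup>2 * \<tau>\<^sup>2 * a2 + d ^ 3 * \<tau> ^ 3 * a3
      else if m = 1 then d * a1 + 2 * d\<^sup>2 * \<tau> * a2 + 3 * d ^ 3 * \<tau>\<^sup>2 * a3
      else if m = 2 then d\<^sup>2 * a2 + 3 * d ^ 3 * \<tau> * a3 else d ^ 3 * a3)"

lemma shifted_cubic:
  fixes x :: real
  shows "L + ((d * (x + \<tau>)) * a1 + (d * (x + \<tau>))\<^sup>2 * a2 + (d * (x + \<tau>)) ^ 3 * a3)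
    = (\<Sum>m\<le>3. shifted_cubic_coeff d \<tau> L a1 a2 a3 m * x ^ m)"
proof -
  have le3: "{..3::nat} = {0, 1, 2, 3}" by auto
  show ?thesis unfolding le3
    by (simp add: shifted_cubic_coeff_def power2_eq_square power3_eq_cube algebra_simps)
qed

context iid_regular
begin

text \<open>In terms of \<open>\<tau> = \<delta> T\<close>, the coefficient of \<open>j\<close> in the log likelihood is
  \<open>\<delta> A\<^sub>1 + 2 \<delta>\<^sup>2 \<tau> A\<^sub>2 + 3 \<delta>\<^sup>3 \<tau>\<^sup>2 A\<^sub>3\<close>.  After multiplication by \<open>\<delta>\<close> the three terms are \<open>Z\<close>,
  \<open>2 T A\<^sub>2 / n \<approx> - I T\<close> and a term of order \<open>\<delta>\<^sup>2\<close>.  The two other coefficients are handled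
  in the same way.\<close>
lemma mcle_coefficients:
  fixes g :: "nat \<Rightarrow> 'w \<Rightarrow> real" and a :: "nat \<Rightarrow> real" and J :: int
  assumes bdd: "bounded_in_prob M (\<lambda>x. sqrt (real (fst x)) * (g (fst x) (snd x) - \<theta>))"
    and grid: "\<And>n \<omega>. \<exists>k::int. g n \<omega> = a n + (real_of_int k + 1 / 2) / sqrt (real n)"
    and J: "J > 1" and m_pos: "\<And>n. 0 < m n"
    and m_lower: "(\<lambda>n. sqrt (real n) / real (m n)) \<longlonglongrightarrow> 0"
    and mc: "mc_evaluation M \<Theta> p Y m J g lbar"
    and ols: "\<And>n \<omega>. 1 \<le> n \<Longrightarrow> \<omega> \<in> space M \<Longrightarrow> cubic_ols J (rate n) (\<lambda>j. lbar n j \<omega>) (\<beta> n \<omega>)"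
  defines "T \<equiv> \<lambda>x. sqrt (real (fst x)) * (g (fst x) (snd x) - \<theta>)"
    and "b \<equiv> \<lambda>k x. \<beta> (fst x) (snd x) k * rate (fst x) ^ k"
  shows "((\<lambda>x. rate (fst x) * b 1 x - (A1 (fst x) (snd x) / sqrt (real (fst x)) - I * T x)) \<longlongrightarrow> 0) (in_prob M)"
    "((\<lambda>x. (rate (fst x))\<^sup>2 * b 2 x) \<longlongrightarrow> - I / 2) (in_prob M)"
    "bounded_in_prob M (\<lambda>x. rate (fst x) * b 3 x)"
proof -
  let ?F = "in_prob M"
  from mc[unfolded mc_evaluation_def] obtain \<gamma> \<epsilon> r C \<sigma> where
    lbar0: "\<forall>n\<ge>1. \<forall>j\<in>{-J..J}. \<forall>\<omega>\<in>space M.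
        eval_point g n j \<omega> \<in> \<Theta> \<and> (\<forall>i<n. 0 < p (eval_point g n j \<omega>) (Y i \<omega>)) \<longrightarrow>
        lbar n j \<omega> = log_lik p Y n (eval_point g n j \<omega>) \<omega> + \<gamma> n (eval_point g n j \<omega>) + \<epsilon> n j \<omega>"
    and \<epsilon>0: "\<forall>n\<ge>1. indep_vars (\<lambda>_. borel) (\<epsilon> n) {-J..J} \<and>
        (\<forall>j\<in>{-J..J}. \<forall>k\<in>{-J..J}. distr M borel (\<epsilon> n j) = distr M borel (\<epsilon> n k))"
    and \<sigma>: "0 < \<sigma>"
    and \<epsilon>_conv0: "\<forall>j\<in>{-J..J}. weak_conv_m
          (\<lambda>n. distr M borel (\<lambda>\<omega>. sqrt (real (m n) / real n) * \<epsilon> n j \<omega>))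
          (density lborel (normal_density 0 \<sigma>))"
    and bias0: "\<forall>n\<ge>1. \<forall>j\<in>{-J..J}. \<forall>\<omega>\<in>space M. g n \<omega> \<in> \<Theta> \<and> eval_point g n j \<omega> \<in> \<Theta> \<longrightarrow>
          \<gamma> n (eval_point g n j \<omega>) = \<gamma> n (g n \<omega>)
            + C * (real n / real (m n)) * (real_of_int j * real n powr (- 1 / 4)) * (1 + r j n \<omega>)"
    and r0: "\<forall>j\<in>{-J..J}. tendsto_zero_in_prob M (r j)"
    by (elim exE conjE) (rule that)
  have lbar: "lbar n j \<omega> = log_lik p Y n (eval_point g n j \<omega>) \<omega> + \<gamma> n (eval_point g n j \<omega>) + \<epsilon> n j \<omega>"
    if "n \<ge> 1" "j \<in> {-J..J}" "\<omega> \<in> space M" "eval_point g n j \<omega> \<in> \<Theta>"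
      "\<And>i. i < n \<Longrightarrow> 0 < p (eval_point g n j \<omega>) (Y i \<omega>)" for n j \<omega>
    using lbar0 that by blast
  have \<epsilon>: "indep_vars (\<lambda>_. borel) (\<epsilon> n) {-J..J}" if "n \<ge> 1" for n using \<epsilon>0 that by blast
  have \<epsilon>_conv: "weak_conv_m (\<lambda>n. distr M borel (\<lambda>\<omega>. sqrt (real (m n) / real n) * \<epsilon> n j \<omega>))
          (density lborel (normal_density 0 \<sigma>))" if "j \<in> {-J..J}" for j using \<epsilon>_conv0 that by blast
  have bias: "\<gamma> n (eval_point g n j \<omega>) = \<gamma> n (g n \<omega>)
      + C * (real n / real (m n)) * (real_of_int j * real n powr (- 1 / 4)) * (1 + r j n \<omega>)"
    if "n \<ge> 1" "j \<in> {-J..J}" "\<omega> \<in> space M" "g n \<omega> \<in> \<Theta>" "eval_point g n j \<omega> \<in> \<Theta>" for n j \<omega>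
    using bias0 that by blast
  have r: "tendsto_zero_in_prob M (r j)" if "j \<in> {-J..J}" for j using r0 that by blast
  obtain w where dual: "\<And>k m. k \<in> {1..3} \<Longrightarrow> m \<le> 3 \<Longrightarrow>
        (\<Sum>j\<in>{-J..J}. w k j * real_of_int j ^ m) = (if m = k then 1 else 0)"
    and wb: "\<And>k z h \<beta>. k \<in> {1..3} \<Longrightarrow> h > 0 \<Longrightarrow> cubic_ols J h z \<beta> \<Longrightarrow>
        \<beta> k * h ^ k = (\<Sum>j\<in>{-J..J}. w k j * z j)"
    using cubic_ols_weights[OF J] by blast
  define e where "e = (\<lambda>j x. expansion_error (g (fst x) (snd x) + real_of_int j * rate (fst x) - \<theta>) (fst x) (snd x))"
  \<comment> \<open>\<open>\<delta>\<close> times the weighted errors: expansion error, bias and Monte Carlo error.  The bias enters with the factor \<open>\<delta>\<^sup>2 n / m = \<surd>n / m\<close>.\<close>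
  define noise where "noise = (\<lambda>k x. \<Sum>j\<in>{-J..J}. w k j * (e j x
      + C * (sqrt (real (fst x)) / real (m (fst x))) * (real_of_int j * (1 + r j (fst x) (snd x)))
      + rate (fst x) * \<epsilon> (fst x) j (snd x)))"
  have rate0: "((\<lambda>x. rate (fst x)) \<longlongrightarrow> 0) ?F" by (rule tendsto_fst_in_prob[OF rate_tendsto])
  have noise: "((\<lambda>x. noise k x) \<longlongrightarrow> 0) ?F" for k
  proof -
    have "((\<lambda>x. w k j * (e j x
      + C * (sqrt (real (fst x)) / real (m (fst x))) * (real_of_int j * (1 + r j (fst x) (snd x)))
      + rate (fst x) * \<epsilon> (fst x) j (snd x))) \<longlongrightarrow> w k j * (0 + C * 0 * (real_of_int j * (1 + 0)) + 0)) ?F"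
      if j: "j \<in> {-J..J}" for j
    proof (intro tendsto_mult tendsto_add tendsto_const)
      show "(e j \<longlongrightarrow> 0) ?F" unfolding e_def by (rule log_lik_expansion_on_grid(2)[OF bdd grid])
      show "((\<lambda>x. sqrt (real (fst x)) / real (m (fst x))) \<longlongrightarrow> 0) ?F"
        by (rule tendsto_fst_in_prob[OF m_lower])
      show "((\<lambda>x. r j (fst x) (snd x)) \<longlongrightarrow> 0) ?F"
        using r[OF j] tendsto_zero_in_prob_iff[of "r j"] by simp
      have meas: "(\<lambda>\<omega>. sqrt (real (m n) / real n) * \<epsilon> n j \<omega>) \<in> borel_measurable M" if "n \<ge> 1" for n
      proof -
        have [measurable]: "\<epsilon> n j \<in> borel_measurable M"
          using \<epsilon>[OF that] j by (auto simp: indep_vars_def)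
        show ?thesis by measurable
      qed
      have "bounded_in_prob M (\<lambda>x. sqrt (real (m (fst x)) / real (fst x)) * \<epsilon> (fst x) j (snd x))"
        by (rule weak_conv_imp_bounded_in_prob[OF meas _ _ \<epsilon>_conv[OF j]])
          (auto intro: real_distribution_normal[OF \<sigma>] isCont_cdf_normal[OF \<sigma>])
      \<comment> \<open>\<open>\<delta>\<close> times the scale \<open>\<surd>(n / m)\<close> of the Monte Carlo error is \<open>\<surd>(\<surd>n / m)\<close>.\<close>
      moreover have "((\<lambda>x. sqrt (sqrt (real (fst x)) / real (m (fst x)))) \<longlongrightarrow> 0) ?F"
        using tendsto_fst_in_prob[OF tendsto_real_sqrt[OF m_lower]] by simp
      ultimately have "((\<lambda>x. sqrt (real (m (fst x)) / real (fst x)) * \<epsilon> (fst x) j (snd x)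
          * sqrt (sqrt (real (fst x)) / real (m (fst x)))) \<longlongrightarrow> 0) ?F"
        by (rule tendsto_zero_mult_bounded_in_prob)
      moreover have "\<forall>\<^sub>F x in ?F. sqrt (real (m (fst x)) / real (fst x)) * \<epsilon> (fst x) j (snd x)
          * sqrt (sqrt (real (fst x)) / real (m (fst x))) = rate (fst x) * \<epsilon> (fst x) j (snd x)"
        using eventually_fst_in_prob[OF eventually_gt_at_top[of 0]]
      proof eventually_elim
        case (elim x)
        have mp: "real (m (fst x)) > 0" using m_pos by simp
        have "sqrt (real (m (fst x)) / real (fst x)) * sqrt (sqrt (real (fst x)) / real (m (fst x)))
          = sqrt (real (m (fst x)) / real (fst x) * (sqrt (real (fst x)) / real (m (fst x))))"
          by (rule real_sqrt_mult[symmetric])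
        also have "real (m (fst x)) / real (fst x) * (sqrt (real (fst x)) / real (m (fst x))) = (rate (fst x))\<^sup>2"
          using mp elim unfolding rate_square[OF elim]
          by (simp add: field_simps) 
        also have "sqrt ((rate (fst x))\<^sup>2) = rate (fst x)" using rate_pos[OF elim] by simp
        finally show ?case by (simp add: mult.commute mult.left_commute)
      qed
      ultimately show "((\<lambda>x. rate (fst x) * \<epsilon> (fst x) j (snd x)) \<longlongrightarrow> 0) ?F"
        by (rule Lim_transform_eventually)
    qed
    then have "((\<lambda>x. noise k x) \<longlongrightarrow> (\<Sum>j\<in>{-J..J}. w k j * (0 + C * 0 * (real_of_int j * (1 + 0)) + 0))) ?F"
      unfolding noise_def by (intro tendsto_sum)
    then show ?thesis by simp
  qed
  have near: "\<forall>\<^sub>F x in ?F. g (fst x) (snd x) + c * rate (fst x) \<in> \<Theta>" for c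
  proof -
    have "(\<lambda>n. 1 / sqrt (real n)) \<longlonglongrightarrow> 0"
      using tendsto_real_sqrt[OF lim_inverse_n'] by (simp add: real_sqrt_divide)
    from tendsto_zero_mult_bounded_in_prob[OF bdd tendsto_fst_in_prob[OF this]]
    have "((\<lambda>x. sqrt (real (fst x)) * (g (fst x) (snd x) - \<theta>) * (1 / sqrt (real (fst x))) + \<theta> + c * rate (fst x)) \<longlongrightarrow> 0 + \<theta> + c * 0) ?F"
      by (intro tendsto_add tendsto_mult tendsto_const rate0)
    then have "\<forall>\<^sub>F x in ?F. sqrt (real (fst x)) * (g (fst x) (snd x) - \<theta>) * (1 / sqrt (real (fst x))) + \<theta> + c * rate (fst x) \<in> \<Theta>"
      using \<theta> by (intro topological_tendstoD[OF _ open_parameter_space]) auto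
    with eventually_fst_in_prob[OF eventually_gt_at_top[of 0]] show ?thesis
      by eventually_elim simp
  qed
  have all: "\<forall>\<^sub>F x in ?F. \<forall>j\<in>{-J..J}. g (fst x) (snd x) + real_of_int j * rate (fst x) \<in> \<Theta> \<and>
      (\<forall>i<fst x. 0 < p (g (fst x) (snd x) + real_of_int j * rate (fst x)) (Y i (snd x)))"
    using near log_lik_expansion_on_grid(1)[OF bdd grid]
    by (intro eventually_ball_finite ballI eventually_conj) auto
  define \<tau> where "\<tau> = (\<lambda>x. (g (fst x) (snd x) - \<theta>) / rate (fst x))"
  have coeff: "\<forall>\<^sub>F x in ?F. \<forall>k\<in>{1..3}. rate (fst x) * b k x = rate (fst x) *
      shifted_cubic_coeff (rate (fst x)) (\<tau> x) (log_lik p Y (fst x) \<theta> (snd x) + \<gamma> (fst x) (g (fst x) (snd x)))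
        (A1 (fst x) (snd x)) (A2 (fst x) (snd x)) (A3 (fst x) (snd x)) k + noise k x"
    using all near[of 0] eventually_snd_in_prob eventually_fst_in_prob[OF eventually_gt_at_top[of 0]]
  proof eventually_elim
    case (elim x)
    obtain n \<omega> where x: "x = (n, \<omega>)" by (cases x)
    from elim have n: "n > 0" and \<omega>: "\<omega> \<in> space M" and g: "g n \<omega> \<in> \<Theta>" by (auto simp: x)
    have d: "rate n > 0" by (rule rate_pos[OF n])
    have pt: "eval_point g n j \<omega> = g n \<omega> + real_of_int j * rate n" for j
      by (simp add: eval_point_def rate_def)
    let ?L = "log_lik p Y n \<theta> \<omega> + \<gamma> n (g n \<omega>)"
    let ?\<alpha> = "shifted_cubic_coeff (rate n) (\<tau> x) ?L (A1 n \<omega>) (A2 n \<omega>) (A3 n \<omega>)"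
    let ?\<rho> = "\<lambda>j. e j x / rate n + C * (real n / real (m n)) * (real_of_int j * rate n) * (1 + r j n \<omega>) + \<epsilon> n j \<omega>"
    have z: "lbar n j \<omega> = (\<Sum>i\<le>3. ?\<alpha> i * real_of_int j ^ i) + ?\<rho> j" if j: "j \<in> {-J..J}" for j
    proof -
      define h where "h = g n \<omega> + real_of_int j * rate n - \<theta>"
      have h: "h = rate n * (real_of_int j + \<tau> x)" using d by (simp add: h_def \<tau>_def x field_simps)
      have \<theta>h: "eval_point g n j \<omega> = \<theta> + h" by (simp add: pt h_def)
      have ok: "eval_point g n j \<omega> \<in> \<Theta>" "\<And>i. i < n \<Longrightarrow> 0 < p (eval_point g n j \<omega>) (Y i \<omega>)"
        using elim(1) j by (auto simp: pt x)
      have "lbar n j \<omega> = log_lik p Y n (eval_point g n j \<omega>) \<omega> + \<gamma> n (eval_point g n j \<omega>) + \<epsilon> n j \<omega>"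
        using n by (intro lbar[OF _ j \<omega> ok]) auto
      moreover have "\<gamma> n (eval_point g n j \<omega>) = \<gamma> n (g n \<omega>)
            + C * (real n / real (m n)) * (real_of_int j * rate n) * (1 + r j n \<omega>)"
        unfolding rate_def using n by (intro bias[OF _ j \<omega> g ok(1)]) auto
      moreover have "log_lik p Y n (eval_point g n j \<omega>) \<omega> = log_lik p Y n \<theta> \<omega>
          + (h * A1 n \<omega> + h\<^sup>2 * A2 n \<omega> + h ^ 3 * A3 n \<omega>) + e j x / rate n"
        unfolding \<theta>h e_def expansion_error_def x using d by (simp add: h_def)
      moreover have "?L + (h * A1 n \<omega> + h\<^sup>2 * A2 n \<omega> + h ^ 3 * A3 n \<omega>) = (\<Sum>i\<le>3. ?\<alpha> i * real_of_int j ^ i)"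
        unfolding h by (rule shifted_cubic)
      ultimately show ?thesis by linarith
    qed
    show ?case
    proof
      fix k :: nat assume k: "k \<in> {1..3}"
      have "b k x = (\<Sum>j\<in>{-J..J}. w k j * lbar n j \<omega>)"
        using wb[OF k d ols[OF _ \<omega>]] n by (simp add: b_def x)
      also have "\<dots> = ?\<alpha> k + (\<Sum>j\<in>{-J..J}. w k j * ?\<rho> j)"
        using k z by (intro weighted_sum_of_cubic dual) auto
      finally have bk: "b k x = ?\<alpha> k + (\<Sum>j\<in>{-J..J}. w k j * ?\<rho> j)" .
      have scale: "c * (\<Sum>j\<in>{-J..J}. w k j * f j) = (\<Sum>j\<in>{-J..J}. w k j * (c * f j))" for c and f :: "int \<Rightarrow> real"
        by (simp add: sum_distrib_left mult.left_commute)
      have "rate n * b k x = rate n * ?\<alpha> k + rate n * (\<Sum>j\<in>{-J..J}. w k j * ?\<rho> j)"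
        unfolding bk by (rule distrib_left)
      also have "rate n * (\<Sum>j\<in>{-J..J}. w k j * ?\<rho> j) = (\<Sum>j\<in>{-J..J}. w k j * (rate n * ?\<rho> j))"
        by (rule scale)
      also have "(\<Sum>j\<in>{-J..J}. w k j * (rate n * ?\<rho> j)) = noise k x"
        unfolding noise_def
      proof (rule sum.cong[OF refl])
        fix j
        have "rate n * (C * (real n / real (m n)) * (real_of_int j * rate n) * (1 + r j n \<omega>))
          = C * ((rate n)\<^sup>2 * real n / real (m n)) * (real_of_int j * (1 + r j n \<omega>))"
          by (simp add: power2_eq_square)
        also have "(rate n)\<^sup>2 * real n = sqrt (real n)" unfolding rate_square[OF n] using n
          by (simp add: real_div_sqrt)
        finally have "rate n * ?\<rho> j = e j x + C * (sqrt (real n) / real (m n)) * (real_of_int j * (1 + r j n \<omega>)) + rate n * \<epsilon> n j \<omega>"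
          using d by (simp add: distrib_left)
        then show "w k j * (rate n * ?\<rho> j) = w k j * (e j x + C * (sqrt (real (fst x)) / real (m (fst x))) *
            (real_of_int j * (1 + r j (fst x) (snd x))) + rate (fst x) * \<epsilon> (fst x) j (snd x))"
          by (simp add: x)
      qed
      finally show "rate (fst x) * b k x = rate (fst x) *
        shifted_cubic_coeff (rate (fst x)) (\<tau> x) (log_lik p Y (fst x) \<theta> (snd x) + \<gamma> (fst x) (g (fst x) (snd x)))
        (A1 (fst x) (snd x)) (A2 (fst x) (snd x)) (A3 (fst x) (snd x)) k + noise k x"
        by (simp add: x)
    qed
  qed
  have Tb: "bounded_in_prob M T" unfolding T_def by (rule bdd)
  let ?a2 = "\<lambda>x. A2 (fst x) (snd x) / real (fst x)" and ?a3 = "\<lambda>x. A3 (fst x) (snd x) / real (fst x)"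
  have rel: "\<forall>\<^sub>F x in ?F. rate (fst x) > 0 \<and> (rate (fst x))\<^sup>2 = 1 / sqrt (real (fst x)) \<and>
      rate (fst x) ^ 4 = 1 / real (fst x) \<and> \<tau> x = rate (fst x) * T x"
    using eventually_fst_in_prob[OF eventually_gt_at_top[of 0]]
  proof eventually_elim
    case (elim x)
    have "sqrt (real (fst x)) = 1 / (rate (fst x))\<^sup>2" by (simp add: rate_square[OF elim])
    then have "\<tau> x = rate (fst x) * T x"
      using rate_pos[OF elim] by (simp add: \<tau>_def T_def power2_eq_square)
    then show ?case using rate_pos[OF elim] rate_square[OF elim] rate_fourth[OF elim] by blast
  qed
  have rate2: "((\<lambda>x. (rate (fst x))\<^sup>2) \<longlongrightarrow> 0) ?F" using tendsto_power[OF rate0, of 2] by simp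
  show "((\<lambda>x. rate (fst x) * b 1 x - (A1 (fst x) (snd x) / sqrt (real (fst x)) - I * T x)) \<longlongrightarrow> 0) ?F"
  proof (rule Lim_transform_eventually)
    have "((\<lambda>x. T x * (2 * (?a2 x - (- I / 2)))) \<longlongrightarrow> 0) ?F"
      by (rule tendsto_zero_mult_bounded_in_prob[OF Tb]) (rule tendsto_mult_right_zero, rule LIM_zero[OF A2_limit])
    moreover have "((\<lambda>x. (?a3 x * (T x * T x)) * (3 * (rate (fst x))\<^sup>2)) \<longlongrightarrow> 0) ?F"
      by (rule tendsto_zero_mult_bounded_in_prob[OF bounded_in_prob_mult[OF A3_bounded bounded_in_prob_mult[OF Tb Tb]]])
        (rule tendsto_mult_right_zero[OF rate2])
    ultimately show "((\<lambda>x. T x * (2 * (?a2 x - (- I / 2))) + (?a3 x * (T x * T x)) * (3 * (rate (fst x))\<^sup>2) + noise 1 x) \<longlongrightarrow> 0) ?F"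
      using noise[of 1] by (intro tendsto_add_zero)
    show "\<forall>\<^sub>F x in ?F. T x * (2 * (?a2 x - (- I / 2))) + (?a3 x * (T x * T x)) * (3 * (rate (fst x))\<^sup>2) + noise 1 x
        = rate (fst x) * b 1 x - (A1 (fst x) (snd x) / sqrt (real (fst x)) - I * T x)"
      using coeff rel
    proof eventually_elim
      case (elim x)
      let ?d = "rate (fst x)"
      have "?d * b 1 x = ?d * (?d * A1 (fst x) (snd x) + 2 * ?d\<^sup>2 * (?d * T x) * A2 (fst x) (snd x)
          + 3 * ?d ^ 3 * (?d * T x)\<^sup>2 * A3 (fst x) (snd x)) + noise 1 x"
        using elim by (auto simp: shifted_cubic_coeff_def)
      also have "?d * (?d * A1 (fst x) (snd x) + 2 * ?d\<^sup>2 * (?d * T x) * A2 (fst x) (snd x)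
          + 3 * ?d ^ 3 * (?d * T x)\<^sup>2 * A3 (fst x) (snd x))
        = ?d\<^sup>2 * A1 (fst x) (snd x) + 2 * T x * (?d ^ 4 * A2 (fst x) (snd x))
          + 3 * ?d\<^sup>2 * (T x * T x) * (?d ^ 4 * A3 (fst x) (snd x))"
        by (simp add: eval_nat_numeral algebra_simps)
      finally have "?d * b 1 x = A1 (fst x) (snd x) / sqrt (real (fst x)) + 2 * T x * ?a2 x
          + 3 * ?d\<^sup>2 * (T x * T x) * ?a3 x + noise 1 x"
        using elim(2) by simp
      then show ?case by (simp add: algebra_simps)
    qed
  qed
  show "((\<lambda>x. (rate (fst x))\<^sup>2 * b 2 x) \<longlongrightarrow> - I / 2) ?F"
  proof (rule Lim_transform_eventually)
    have "((\<lambda>x. (?a3 x * T x) * (3 * (rate (fst x))\<^sup>2)) \<longlongrightarrow> 0) ?F"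
      by (rule tendsto_zero_mult_bounded_in_prob[OF bounded_in_prob_mult[OF A3_bounded Tb]])
        (rule tendsto_mult_right_zero[OF rate2])
    from tendsto_add[OF tendsto_add[OF A2_limit this] tendsto_mult[OF rate0 noise[of 2]]]
    show "((\<lambda>x. ?a2 x + (?a3 x * T x) * (3 * (rate (fst x))\<^sup>2) + rate (fst x) * noise 2 x) \<longlongrightarrow> - I / 2) ?F"
      by simp
    show "\<forall>\<^sub>F x in ?F. ?a2 x + (?a3 x * T x) * (3 * (rate (fst x))\<^sup>2) + rate (fst x) * noise 2 x = (rate (fst x))\<^sup>2 * b 2 x"
      using coeff rel
    proof eventually_elim
      case (elim x)
      let ?d = "rate (fst x)"
      have "?d * b 2 x = ?d * (?d\<^sup>2 * A2 (fst x) (snd x) + 3 * ?d ^ 3 * (?d * T x) * A3 (fst x) (snd x)) + noise 2 x"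
        using elim by (auto simp: shifted_cubic_coeff_def)
      then have "?d\<^sup>2 * b 2 x = ?d * (?d * (?d\<^sup>2 * A2 (fst x) (snd x) + 3 * ?d ^ 3 * (?d * T x) * A3 (fst x) (snd x)) + noise 2 x)"
        by (simp add: power2_eq_square)
      also have "\<dots> = ?d ^ 4 * A2 (fst x) (snd x) + 3 * ?d\<^sup>2 * T x * (?d ^ 4 * A3 (fst x) (snd x)) + ?d * noise 2 x"
        by (simp add: eval_nat_numeral algebra_simps)
      finally show ?case using elim(2) by (simp add: algebra_simps)
    qed
  qed
  show "bounded_in_prob M (\<lambda>x. rate (fst x) * b 3 x)"
  proof (rule bounded_in_prob_cong)
    show "bounded_in_prob M (\<lambda>x. ?a3 x + noise 3 x)"
      by (rule bounded_in_prob_add[OF A3_bounded tendsto_imp_bounded_in_prob[OF noise]])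
    show "\<forall>\<^sub>F x in ?F. ?a3 x + noise 3 x = rate (fst x) * b 3 x"
      using coeff rel
    proof eventually_elim
      case (elim x)
      let ?d = "rate (fst x)"
      have "?d * b 3 x = ?d * (?d ^ 3 * A3 (fst x) (snd x)) + noise 3 x"
        using elim by (auto simp: shifted_cubic_coeff_def)
      also have "?d * (?d ^ 3 * A3 (fst x) (snd x)) = ?d ^ 4 * A3 (fst x) (snd x)"
        by (simp add: eval_nat_numeral)
      finally show ?case using elim(2) by simp
    qed
  qed
qed

end

context iid_regular
begin

text \<open>The quadratic step removes the error \<open>T\<close> of the starting point; the two forms of the estimator differ
  from it by \<open>o(1)\<close> on the scale \<open>n\<^sup>-\<^sup>1\<^sup>/\<^sup>2\<close>.\<close>
lemma mcle_asymptotically_linear: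
  fixes g :: "nat \<Rightarrow> 'w \<Rightarrow> real" and a :: "nat \<Rightarrow> real" and J :: int
  assumes bdd: "bounded_in_prob M (\<lambda>x. sqrt (real (fst x)) * (g (fst x) (snd x) - \<theta>))"
    and grid: "\<And>n \<omega>. \<exists>k::int. g n \<omega> = a n + (real_of_int k + 1 / 2) / sqrt (real n)"
    and J: "J > 1" and m_pos: "\<And>n. 0 < m n"
    and m_lower: "(\<lambda>n. sqrt (real n) / real (m n)) \<longlonglongrightarrow> 0"
    and mc: "mc_evaluation M \<Theta> p Y m J g lbar"
    and ols: "\<And>n \<omega>. 1 \<le> n \<Longrightarrow> \<omega> \<in> space M \<Longrightarrow> cubic_ols J (rate n) (\<lambda>j. lbar n j \<omega>) (\<beta> n \<omega>)"
    and hat: "(\<forall>n\<ge>1. \<forall>\<omega>\<in>space M. \<exists>x. cubic_argmax J (rate n) (\<beta> n \<omega>) x \<and> \<theta>hat n \<omega> = g n \<omega> + rate n * x) \<or>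
      ((\<lambda>x. sqrt (real (fst x)) * (\<theta>hat (fst x) (snd x)
          - (g (fst x) (snd x) + \<beta> (fst x) (snd x) 1 / (- 2 * \<beta> (fst x) (snd x) 2)))) \<longlongrightarrow> 0) (in_prob M)"
  shows "((\<lambda>x. sqrt (real (fst x)) * (\<theta>hat (fst x) (snd x) - \<theta>) - A1 (fst x) (snd x) / sqrt (real (fst x)) / I) \<longlongrightarrow> 0) (in_prob M)"
proof -
  let ?F = "in_prob M"
  define T where "T = (\<lambda>x. sqrt (real (fst x)) * (g (fst x) (snd x) - \<theta>))"
  define Z where "Z = (\<lambda>x. A1 (fst x) (snd x) / sqrt (real (fst x)))"
  define V where "V = (\<lambda>x. rate (fst x) * (\<beta> (fst x) (snd x) 1 * rate (fst x) ^ 1))"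
  define U where "U = (\<lambda>x. (rate (fst x))\<^sup>2 * (\<beta> (fst x) (snd x) 2 * rate (fst x) ^ 2))"
  define Q where "Q = (\<lambda>x. rate (fst x) * (\<beta> (fst x) (snd x) 3 * rate (fst x) ^ 3))"
  have V0: "((\<lambda>x. V x - (Z x - I * T x)) \<longlongrightarrow> 0) ?F" and U: "(U \<longlongrightarrow> - I / 2) ?F" and Q: "bounded_in_prob M Q"
    using mcle_coefficients[OF bdd grid J m_pos m_lower mc ols] unfolding V_def U_def Q_def Z_def T_def by auto
  have Tb: "bounded_in_prob M T" and Zb: "bounded_in_prob M Z"
    unfolding T_def Z_def by (rule bdd, rule A1_bounded)
  have Vb: "bounded_in_prob M V"
  proof -
    have "bounded_in_prob M (\<lambda>x. (V x - (Z x - I * T x)) + (Z x + (- I) * T x))"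
      by (intro bounded_in_prob_add bounded_in_prob_mult bounded_in_prob_const Zb Tb tendsto_imp_bounded_in_prob[OF V0])
    then show ?thesis by simp
  qed
  \<comment> \<open>Otherwise the stationary point of the quadratic part would be a minimum.\<close>
  have U_neg: "\<forall>\<^sub>F x in ?F. U x < 0" by (rule order_tendstoD(2)[OF U]) (use I_pos in simp)
  have quotient: "((\<lambda>x. T x + V x / (- 2 * U x) - Z x / I) \<longlongrightarrow> 0) ?F"
  proof -
    have "((\<lambda>x. 1 / (- 2 * U x) - 1 / I) \<longlongrightarrow> 1 / (- 2 * (- I / 2)) - 1 / I) ?F"
      by (intro tendsto_intros U) (use I_pos in simp)
    then have "((\<lambda>x. 1 / (- 2 * U x) - 1 / I) \<longlongrightarrow> 0) ?F" by simp
    from tendsto_add[OF tendsto_zero_mult_bounded_in_prob[OF Vb this] tendsto_divide[OF V0 tendsto_const[of I]]]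
    have "((\<lambda>x. V x * (1 / (- 2 * U x) - 1 / I) + (V x - (Z x - I * T x)) / I) \<longlongrightarrow> 0) ?F"
      using I_pos by simp
    moreover have "V x * (1 / (- 2 * U x) - 1 / I) + (V x - (Z x - I * T x)) / I = T x + V x / (- 2 * U x) - Z x / I" for x
    proof -
      have "V x * (1 / (- 2 * U x) - 1 / I) = V x / (- 2 * U x) - V x / I"
        by (simp add: right_diff_distrib)
      moreover have "(V x - (Z x - I * T x)) / I = V x / I - Z x / I + T x"
        using I_pos by (simp add: diff_divide_distrib)
      ultimately show ?thesis by simp
    qed
    ultimately show ?thesis by simp
  qed
  have newton: "((\<lambda>x. sqrt (real (fst x)) * (\<theta>hat (fst x) (snd x) - g (fst x) (snd x)) - V x / (- 2 * U x)) \<longlongrightarrow> 0) ?F"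
    using hat
  proof
    assume "((\<lambda>x. sqrt (real (fst x)) * (\<theta>hat (fst x) (snd x)
          - (g (fst x) (snd x) + \<beta> (fst x) (snd x) 1 / (- 2 * \<beta> (fst x) (snd x) 2)))) \<longlongrightarrow> 0) ?F"
    moreover have "\<forall>\<^sub>F x in ?F. sqrt (real (fst x)) * (\<theta>hat (fst x) (snd x)
          - (g (fst x) (snd x) + \<beta> (fst x) (snd x) 1 / (- 2 * \<beta> (fst x) (snd x) 2)))
        = sqrt (real (fst x)) * (\<theta>hat (fst x) (snd x) - g (fst x) (snd x)) - V x / (- 2 * U x)"
      using eventually_fst_in_prob[OF eventually_gt_at_top[of 0]]
    proof eventually_elim
      case (elim x)
      have d: "rate (fst x) > 0" by (rule rate_pos[OF elim])
      have s: "sqrt (real (fst x)) = 1 / (rate (fst x))\<^sup>2" by (simp add: rate_square[OF elim])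
      have "V x / (- 2 * U x) = 1 / (rate (fst x))\<^sup>2 * (\<beta> (fst x) (snd x) 1 / (- 2 * \<beta> (fst x) (snd x) 2))"
        using d by (simp add: V_def U_def power2_eq_square)
      then show ?case unfolding s[symmetric] by (simp only: right_diff_distrib distrib_left diff_diff_eq)
    qed
    ultimately show ?thesis by (rule Lim_transform_eventually)
  next
    assume argmax: "\<forall>n\<ge>1. \<forall>\<omega>\<in>space M. \<exists>x. cubic_argmax J (rate n) (\<beta> n \<omega>) x \<and> \<theta>hat n \<omega> = g n \<omega> + rate n * x"
    \<comment> \<open>\<open>B\<close> bounds the maximizer on the scale of \<open>j\<close>; it is of order \<open>\<delta>\<close>.\<close>
    define W where "W = (\<lambda>x. \<bar>V x\<bar> + (real_of_int J)\<^sup>2 * \<bar>Q x\<bar>)"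
    define B where "B = (\<lambda>x. W x / (\<bar>U x\<bar> * (1 / rate (fst x))))"
    have abs_bounded: "bounded_in_prob M (\<lambda>x. \<bar>X x\<bar>)" if "bounded_in_prob M X" for X
      using that by (simp add: bounded_in_prob_def)
    have Wb: "bounded_in_prob M W" unfolding W_def
      by (intro bounded_in_prob_add bounded_in_prob_mult bounded_in_prob_const abs_bounded Vb Q)
    have "((\<lambda>x. rate (fst x) / \<bar>U x\<bar>) \<longlongrightarrow> 0 / \<bar>- I / 2\<bar>) ?F"
      by (intro tendsto_divide tendsto_rabs U tendsto_fst_in_prob[OF rate_tendsto]) (use I_pos in simp)
    from tendsto_zero_mult_bounded_in_prob[OF Wb this[simplified]]
    have B0: "(B \<longlongrightarrow> 0) ?F" by (simp add: B_def)
    have "((\<lambda>x. 3 * (B x)\<^sup>2 / (2 * \<bar>U x\<bar>)) \<longlongrightarrow> 3 * 0\<^sup>2 / (2 * \<bar>- I / 2\<bar>)) ?F"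
      by (intro tendsto_intros B0 U) (use I_pos in simp)
    then have "((\<lambda>x. 3 * (B x)\<^sup>2 / (2 * \<bar>U x\<bar>)) \<longlongrightarrow> 0) ?F" by simp
    from tendsto_zero_mult_bounded_in_prob[OF abs_bounded[OF Q] this]
    have bound0: "((\<lambda>x. 3 * \<bar>Q x\<bar> * (B x)\<^sup>2 / (2 * \<bar>U x\<bar>)) \<longlongrightarrow> 0) ?F"
      by (simp add: ac_simps)
    have B_small: "\<forall>\<^sub>F x in ?F. B x < real_of_int J"
      by (rule order_tendstoD(2)[OF B0]) (use J in simp)
    show ?thesis
    proof (rule Lim_null_comparison[OF _ bound0])
      show "\<forall>\<^sub>F x in ?F. norm (sqrt (real (fst x)) * (\<theta>hat (fst x) (snd x) - g (fst x) (snd x)) - V x / (- 2 * U x))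
          \<le> 3 * \<bar>Q x\<bar> * (B x)\<^sup>2 / (2 * \<bar>U x\<bar>)"
        using U_neg B_small eventually_snd_in_prob eventually_fst_in_prob[OF eventually_gt_at_top[of 0]]
      proof eventually_elim
        case (elim x)
        have d: "rate (fst x) > 0" by (rule rate_pos[OF elim(4)])
        have s: "sqrt (real (fst x)) = 1 / (rate (fst x))\<^sup>2" by (simp add: rate_square[OF elim(4)])
        have "fst x \<ge> 1" using elim(4) by simp
        with argmax elim(3) obtain u where u: "cubic_argmax J (rate (fst x)) (\<beta> (fst x) (snd x)) u"
          "\<theta>hat (fst x) (snd x) = g (fst x) (snd x) + rate (fst x) * u" by blast
        have "\<bar>1 / rate (fst x) * u - V x / (- 2 * U x)\<bar>
          \<le> 3 * \<bar>Q x\<bar> * ((\<bar>V x\<bar> + (real_of_int J)\<^sup>2 * \<bar>Q x\<bar>) / (\<bar>U x\<bar> * (1 / rate (fst x))))\<^sup>2 / (2 * \<bar>U x\<bar>)"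
        proof (rule cubic_argmax_near_quadratic[OF u(1)])
          show "0 < J" using J by simp
          show "\<beta> (fst x) (snd x) 1 * rate (fst x) ^ 1 = 1 / rate (fst x) * V x"
            "\<beta> (fst x) (snd x) 2 * rate (fst x) ^ 2 = (1 / rate (fst x))\<^sup>2 * U x"
            "\<beta> (fst x) (snd x) 3 * rate (fst x) ^ 3 = 1 / rate (fst x) * Q x"
            using d by (simp_all add: V_def U_def Q_def power_divide)
          show "(\<bar>V x\<bar> + (real_of_int J)\<^sup>2 * \<bar>Q x\<bar>) / (\<bar>U x\<bar> * (1 / rate (fst x))) < real_of_int J"
            using elim(2) by (simp add: B_def W_def)
        qed (use d elim(1) in auto)
        moreover have "sqrt (real (fst x)) * (\<theta>hat (fst x) (snd x) - g (fst x) (snd x)) = 1 / rate (fst x) * u"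
          unfolding s u(2) using d by (simp add: power2_eq_square)
        ultimately show ?case unfolding B_def W_def real_norm_def by simp
      qed
    qed
  qed
  have "((\<lambda>x. (sqrt (real (fst x)) * (\<theta>hat (fst x) (snd x) - g (fst x) (snd x)) - V x / (- 2 * U x))
       + (T x + V x / (- 2 * U x) - Z x / I)) \<longlongrightarrow> 0) ?F"
    by (rule tendsto_add_zero[OF newton quotient])
  moreover have "(sqrt (real (fst x)) * (\<theta>hat (fst x) (snd x) - g (fst x) (snd x)) - V x / (- 2 * U x))
       + (T x + V x / (- 2 * U x) - Z x / I)
     = sqrt (real (fst x)) * (\<theta>hat (fst x) (snd x) - \<theta>) - A1 (fst x) (snd x) / sqrt (real (fst x)) / I" for x
    by (simp add: T_def Z_def right_diff_distrib)
  ultimately show ?thesis by simp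
qed

end

lemma inverse_sqrt_powr: "real n powr (- 1 / 2) = 1 / sqrt (real n)"
  by (cases "n = 0") (simp_all add: powr_half_sqrt[symmetric] powr_minus_divide[symmetric])

lemma grid_midpoint_on_grid:
  "\<exists>k::int. grid_midpoint a (real n powr (- 1 / 2)) t = a + (real_of_int k + 1 / 2) / sqrt (real n)"
  unfolding grid_midpoint_def inverse_sqrt_powr by (auto intro!: exI)

lemma grid_midpoint_dist:
  assumes "d > 0" shows "\<bar>grid_midpoint a d t - t\<bar> \<le> d / 2"
proof -
  define z where "z = (t - a) / d"
  have "t = a + z * d" using assms by (simp add: z_def)
  then have "grid_midpoint a d t - t = (real_of_int \<lfloor>z\<rfloor> + 1 / 2 - z) * d"
    using assms by (simp add: grid_midpoint_def z_def algebra_simps)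
  moreover have "\<bar>real_of_int \<lfloor>z\<rfloor> + 1 / 2 - z\<bar> \<le> 1 / 2" by linarith
  then have "\<bar>(real_of_int \<lfloor>z\<rfloor> + 1 / 2 - z) * d\<bar> \<le> 1 / 2 * d"
    unfolding abs_mult using assms by (intro mult_mono) auto
  ultimately show ?thesis by simp
qed

text \<open>Discretization moves the estimator by at most half of the grid step \<open>n\<^sup>-\<^sup>1\<^sup>/\<^sup>2\<close>.\<close>
lemma (in prob_space) root_n_consistent_grid_bounded:
  fixes t :: "nat \<Rightarrow> 'a \<Rightarrow> real"
  assumes meas: "\<And>n. t n \<in> borel_measurable M"
    and cons: "\<And>e. e > 0 \<Longrightarrow> \<exists>B N. \<forall>n\<ge>N. prob {\<omega>\<in>space M. B < sqrt (real n) * \<bar>t n \<omega> - \<theta>\<bar>} \<le> e"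
  shows "bounded_in_prob M (\<lambda>x. sqrt (real (fst x)) *
     (grid_midpoint (a (fst x)) (real (fst x) powr (- 1 / 2)) (t (fst x) (snd x)) - \<theta>))"
  unfolding bounded_in_prob_def
proof (intro allI impI)
  fix e :: real assume "e > 0"
  from cons[OF this] obtain B N where BN: "\<And>n. n \<ge> N \<Longrightarrow> prob {\<omega>\<in>space M. B < sqrt (real n) * \<bar>t n \<omega> - \<theta>\<bar>} \<le> e"
    by blast
  have "\<forall>\<^sub>F n in sequentially. \<exists>A\<in>events. prob (space M - A) \<le> e \<and> (\<forall>\<omega>\<in>A. \<bar>sqrt (real n) *
     (grid_midpoint (a n) (real n powr (- 1 / 2)) (t n \<omega>) - \<theta>)\<bar> \<le> B + 1 / 2)"
    using eventually_ge_at_top[of N] eventually_gt_at_top[of 0]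
  proof eventually_elim
    case (elim n)
    note [measurable] = meas
    define A where "A = {\<omega>\<in>space M. sqrt (real n) * \<bar>t n \<omega> - \<theta>\<bar> \<le> B}"
    have A: "A \<in> events" unfolding A_def by measurable
    have "space M - A = {\<omega>\<in>space M. B < sqrt (real n) * \<bar>t n \<omega> - \<theta>\<bar>}" by (auto simp: A_def)
    then have P: "prob (space M - A) \<le> e" using BN[OF elim(1)] by simp
    have r: "sqrt (real n) > 0" using elim(2) by simp
    have "\<bar>sqrt (real n) * (grid_midpoint (a n) (real n powr (- 1 / 2)) (t n \<omega>) - \<theta>)\<bar> \<le> B + 1 / 2" if "\<omega> \<in> A" for \<omega>
    proof -
      let ?g = "grid_midpoint (a n) (real n powr (- 1 / 2)) (t n \<omega>)"
      have "\<bar>?g - t n \<omega>\<bar> \<le> 1 / sqrt (real n) / 2"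
        using grid_midpoint_dist[of "real n powr (- 1 / 2)" "a n" "t n \<omega>"] r unfolding inverse_sqrt_powr by simp
      then have "sqrt (real n) * \<bar>?g - t n \<omega>\<bar> \<le> sqrt (real n) * (1 / sqrt (real n) / 2)"
        using r by (intro mult_left_mono) auto
      also have "\<dots> = 1 / 2" using r by simp
      finally have 1: "sqrt (real n) * \<bar>?g - t n \<omega>\<bar> \<le> 1 / 2" .
      have "\<bar>sqrt (real n) * (?g - \<theta>)\<bar> = sqrt (real n) * \<bar>?g - \<theta>\<bar>" using r by (simp add: abs_mult)
      also have "\<dots> \<le> sqrt (real n) * (\<bar>?g - t n \<omega>\<bar> + \<bar>t n \<omega> - \<theta>\<bar>)"
        using r by (intro mult_left_mono) auto
      also have "\<dots> = sqrt (real n) * \<bar>?g - t n \<omega>\<bar> + sqrt (real n) * \<bar>t n \<omega> - \<theta>\<bar>" by (rule distrib_left)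
      also have "\<dots> \<le> B + 1 / 2" using 1 that by (simp add: A_def)
      finally show ?thesis .
    qed
    with A P show ?case by (intro bexI[of _ A]) auto
  qed
  then show "\<exists>B. \<forall>\<^sub>F n in sequentially. \<exists>A\<in>events. prob (space M - A) \<le> e \<and> (\<forall>\<omega>\<in>A. \<bar>sqrt (real (fst (n, \<omega>))) *
     (grid_midpoint (a (fst (n, \<omega>))) (real (fst (n, \<omega>)) powr (- 1 / 2)) (t (fst (n, \<omega>)) (snd (n, \<omega>))) - \<theta>)\<bar> \<le> B)"
    by auto
qed

section \<open>Efficiency of the estimator\<close>

theorem theorem4p3:
  fixes \<mu> :: "'y measure" and \<Theta> :: "real set"
    and p :: "real \<Rightarrow> 'y \<Rightarrow> real" and sd :: "nat \<Rightarrow> real \<Rightarrow> 'y \<Rightarrow> real"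
    and S :: "'w measure" and P :: "real \<Rightarrow> 'w measure" and Y :: "nat \<Rightarrow> 'w \<Rightarrow> 'y"
    and T :: "nat \<Rightarrow> (nat \<Rightarrow> 'y) \<Rightarrow> real" and a :: "nat \<Rightarrow> real" and \<theta>s :: "nat \<Rightarrow> 'w \<Rightarrow> real"
    and m :: "nat \<Rightarrow> nat" and J :: int
    and lbar :: "nat \<Rightarrow> int \<Rightarrow> 'w \<Rightarrow> real" and \<beta> :: "nat \<Rightarrow> 'w \<Rightarrow> nat \<Rightarrow> real"
    and \<theta>hat :: "nat \<Rightarrow> 'w \<Rightarrow> real"
  assumes regular: "regular_parametric_model \<mu> \<Theta> p sd"
    and fourth_order: "fourth_order_regularity \<mu> \<Theta> p sd"
    and family: "\<And>\<theta>. \<theta> \<in> \<Theta> \<Longrightarrow> prob_space (P \<theta>)" "\<And>\<theta>. \<theta> \<in> \<Theta> \<Longrightarrow> sets (P \<theta>) = sets S"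
    and data: "\<And>\<theta>. \<theta> \<in> \<Theta> \<Longrightarrow> iid_sample (P \<theta>) \<mu> (model \<mu> p \<theta>) Y"
    and m_pos: "\<And>n. 0 < m n"
    and m_lower: "(\<lambda>n. sqrt (real n) / real (m n)) \<longlonglongrightarrow> 0"
    and m_upper: "(\<lambda>n. real (m n) / real n) \<longlonglongrightarrow> 0"
    and J: "1 < J"
    and T_measurable: "\<And>n. T n \<in> borel_measurable (Pi\<^sub>M {..<n} (\<lambda>_. \<mu>))"
    and consistent: "uniformly_root_n_consistent \<Theta> P (estimator Y T)"
    and grid: "\<And>n \<omega>. \<theta>s n \<omega> = grid_midpoint (a n) (real n powr (- 1 / 2)) (estimator Y T n \<omega>)"
    and lbar_measurable: "\<And>n j. lbar n j \<in> borel_measurable S"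
    and monte_carlo: "\<And>\<theta>. \<theta> \<in> \<Theta> \<Longrightarrow> mc_evaluation (P \<theta>) \<Theta> p Y m J \<theta>s lbar"
    and ols: "\<And>n \<omega>. 1 \<le> n \<Longrightarrow> \<omega> \<in> space S \<Longrightarrow>
                cubic_ols J (real n powr (- 1 / 4)) (\<lambda>j. lbar n j \<omega>) (\<beta> n \<omega>)"
    and \<theta>hat_measurable: "\<And>n. \<theta>hat n \<in> borel_measurable S"
    and \<theta>hat: "mcle J \<theta>s \<beta> (space S) \<theta>hat \<or> mcle_quadratic_form \<Theta> P \<theta>s \<beta> \<theta>hat"
  shows "efficient \<mu> \<Theta> p sd P Y \<theta>hat"
  unfolding efficient_def
proof (rule ballI)
  fix \<theta> assume \<theta>: "\<theta> \<in> \<Theta>"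
  interpret prob_space "P \<theta>" by (rule family(1)[OF \<theta>])
  interpret iid_regular \<mu> \<Theta> p sd \<theta> "P \<theta>" Y
    by unfold_locales (fact regular fourth_order \<theta> data[OF \<theta>])+
  have space: "space (P \<theta>) = space S" by (rule sets_eq_imp_space_eq[OF family(2)[OF \<theta>]])
  have [measurable]: "\<theta>hat n \<in> borel_measurable (P \<theta>)" for n
    using \<theta>hat_measurable measurable_cong_sets[OF family(2)[OF \<theta>] refl] by blast
  have est: "estimator Y T n \<in> borel_measurable (P \<theta>)" for n
  proof -
    have "(\<lambda>\<omega>. \<lambda>i\<in>{..<n}. Y i \<omega>) \<in> measurable (P \<theta>) (Pi\<^sub>M {..<n} (\<lambda>_. \<mu>))"
      by (rule measurable_restrict) measurable
    from measurable_compose[OF this T_measurable] show ?thesis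
      by (simp add: estimator_def[abs_def])
  qed
  have cons: "\<exists>B N. \<forall>n\<ge>N. prob {\<omega>\<in>space (P \<theta>). B < sqrt (real n) * \<bar>estimator Y T n \<omega> - \<theta>\<bar>} \<le> e" if "e > 0" for e
    using consistent[unfolded uniformly_root_n_consistent_def, rule_format, of "{\<theta>}" e] \<theta> that by auto
  have bdd: "bounded_in_prob (P \<theta>) (\<lambda>x. sqrt (real (fst x)) * (\<theta>s (fst x) (snd x) - \<theta>))"
    unfolding grid by (rule root_n_consistent_grid_bounded[OF est cons])
  have on_grid: "\<exists>k::int. \<theta>s n \<omega> = a n + (real_of_int k + 1 / 2) / sqrt (real n)" for n \<omega>
    unfolding grid by (rule grid_midpoint_on_grid)
  have hat: "(\<forall>n\<ge>1. \<forall>\<omega>\<in>space (P \<theta>). \<exists>x. cubic_argmax J (rate n) (\<beta> n \<omega>) x \<and> \<theta>hat n \<omega> = \<theta>s n \<omega> + rate n * x) \<or>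
      ((\<lambda>x. sqrt (real (fst x)) * (\<theta>hat (fst x) (snd x)
          - (\<theta>s (fst x) (snd x) + \<beta> (fst x) (snd x) 1 / (- 2 * \<beta> (fst x) (snd x) 2)))) \<longlongrightarrow> 0) (in_prob (P \<theta>))"
    using \<theta>hat
  proof
    assume "mcle J \<theta>s \<beta> (space S) \<theta>hat"
    then show ?thesis unfolding mcle_def rate_def space by (rule disjI1)
  next
    assume "mcle_quadratic_form \<Theta> P \<theta>s \<beta> \<theta>hat"
    then have "tendsto_zero_in_prob (P \<theta>)
        (\<lambda>n \<omega>. sqrt (real n) * (\<theta>hat n \<omega> - (\<theta>s n \<omega> + \<beta> n \<omega> 1 / (- 2 * \<beta> n \<omega> 2))))"
      using \<theta> unfolding mcle_quadratic_form_def by blast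
    then show ?thesis unfolding tendsto_zero_in_prob_iff by (intro disjI2) (erule conjunct2)
  qed
  have linear: "((\<lambda>x. sqrt (real (fst x)) * (\<theta>hat (fst x) (snd x) - \<theta>)
      - A1 (fst x) (snd x) / sqrt (real (fst x)) / I) \<longlongrightarrow> 0) (in_prob (P \<theta>))"
    by (rule mcle_asymptotically_linear[OF bdd on_grid J m_pos m_lower monte_carlo[OF \<theta>] ols[folded rate_def] hat])
      (simp_all add: space)
  have I: "I > 0" by (rule I_pos)
  show "weak_conv_m (\<lambda>n. distr (P \<theta>) borel (\<lambda>\<omega>. sqrt (real n) * (\<theta>hat n \<omega> - \<theta>)))
          (density lborel (normal_density 0 (sqrt (1 / I)))) \<and>
        tendsto_zero_in_prob (P \<theta>) (\<lambda>n \<omega>. sqrt (real n) * (\<theta>hat n \<omega> - \<theta>)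
             - (\<Sum>i<n. score p sd 1 \<theta> (Y i \<omega>) / I) / sqrt (real n))"
  proof
    show "weak_conv_m (\<lambda>n. distr (P \<theta>) borel (\<lambda>\<omega>. sqrt (real n) * (\<theta>hat n \<omega> - \<theta>)))
          (density lborel (normal_density 0 (sqrt (1 / I))))"
    proof (rule slutsky_normal[OF _ _ score_clt])
      have "sqrt (1 / I) * (A / sqrt (real n * I)) = A / sqrt (real n) / I" for A n
        using I by (simp add: real_sqrt_mult real_sqrt_divide)
      then show "((\<lambda>x. sqrt (real (fst x)) * (\<theta>hat (fst x) (snd x) - \<theta>)
          - sqrt (1 / I) * (A1 (fst x) (snd x) / sqrt (real (fst x) * I))) \<longlongrightarrow> 0) (in_prob (P \<theta>))"
        using linear by simp
      show "sqrt (1 / I) > 0" using I by simp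
    qed measurable
    have sum: "(\<Sum>i<n. score p sd 1 \<theta> (Y i \<omega>) / I) / sqrt (real n) = A1 n \<omega> / sqrt (real n) / I" for n \<omega>
      by (simp add: A1_def sum_divide_distrib mult.commute)
    show "tendsto_zero_in_prob (P \<theta>) (\<lambda>n \<omega>. sqrt (real n) * (\<theta>hat n \<omega> - \<theta>)
             - (\<Sum>i<n. score p sd 1 \<theta> (Y i \<omega>) / I) / sqrt (real n))"
      unfolding sum tendsto_zero_in_prob_iff by (intro conjI allI linear) measurable
  qed
qed

end
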